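(* Let $A,B\subset\mathbb{R}^2$ be finite two-dimensional sets with $[A]=[B]$. Then $$\mathrm{tr}(A+B)^{1/2}\ \ge\ \mathrm{tr}(A)^{1/2}+\mathrm{tr}(B)^{1/2}.$$ Moreover, equality holds if and only if $A=B$ and (a) either $A$ is saturated, or (b) $A=\{z_1,\ldots,z_k\}$ for some $k\ge 4$, where $z_1,\ldots,z_{k-3}\in\mathrm{int}[z_{k-2},z_{k-1},z_k]$, and $z_1,\ldots,z_{k-2}$ are collinear and equally spaced in this order.
   Context: $[X]$ denotes the convex hull of $X$. A finite set $X\subset\mathbb{R}^2$ is two-dimensional if it is not contained in a line. For such $X$, $\mathrm{tr}(X)$ denotes the number of triangles in a triangulation of $[X]$ using exactly $X$ as the vertex set; this number does not depend on the triangulation and equals $2|X|-\Delta_X-2$, where $\Delta_X$ is the number of points of $X$ on the boundary of $[X]$. The lattice generated by $A$ is the additive subgroup $\Lambda(A)$ of $\mathbb{R}^2$ generated by $A-A$, and $A$ is saturated if $A=[A]\cap\Lambda(A)$. $A+B=\{a+b:a\in A,b\in B\}$.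
   Formalization: "Saturated" is taken up to translation: A equals [A] intersected with a+Λ(A) for a point a of A, since with A=[A]∩Λ(A) literally the equality criterion fails for a triangle {p,p+e1,p+e2} with p not in the integer lattice. *)

theory Defs
  imports "HOL-Analysis.Analysis" "HOL-Computational_Algebra.Group_Closure"
begin

text \<open>
  A triangulation is represented by its set of triangles, as solid closed sets; the library
  predicate \<^const>\<open>triangulation\<close> requires finiteness and that any two
  triangles meet in a (possibly empty) common face.
\<close>

definition triangulates :: "(real^2) set set \<Rightarrow> (real^2) set \<Rightarrow> bool" where
  "triangulates \<T> X \<longleftrightarrow>
     triangulation \<T> \<and> (\<forall>T\<in>\<T>. 2 simplex T) \<and>
     \<Union>\<T> = convex hull X \<and> {v. \<exists>T\<in>\<T>. v extreme_point_of T} = X"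

text \<open>
  The choice of the triangulation is immaterial: for finite, non-collinear \<open>X\<close> all of
  them have \<open>2 * card X - card (X \<inter> frontier (convex hull X)) - 2\<close> triangles.
\<close>

definition tr :: "(real^2) set \<Rightarrow> nat" where
  "tr X = card (SOME \<T>. triangulates \<T> X)"

text \<open>The set comprehension is the Minkowski difference \<open>A - A\<close>; on sets, HOL's
  minus is set difference.\<close>

definition generated_lattice :: "(real^2) set \<Rightarrow> (real^2) set" where
  "generated_lattice A = group_closure {x - y | x y. x \<in> A \<and> y \<in> A}"

text \<open>
  The points of \<open>A\<close> lie in a single coset of the group generated by the differences,
  which contains the origin only if \<open>A\<close> is suitably placed. Saturation is a property up to
  translation, usually written \<open>A = [A] \<inter> \<Lambda>(A)\<close> under the normalisation
  \<open>0 \<in> A\<close>. Here the lattice is therefore translated to pass through a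
  point of \<open>A\<close>; which point is immaterial, and for \<open>0 \<in> A\<close> the translation
  disappears.
\<close>

definition saturated :: "(real^2) set \<Rightarrow> bool" where
  "saturated A \<longleftrightarrow> (\<exists>a\<in>A. A = convex hull A \<inter> (\<lambda>v. a + v) ` generated_lattice A)"

end

theory Submission
  imports Defs
begin

text \<open>
  Let \<open>P\<close> be the common convex hull, \<open>C = A \<inter> B\<close>, and fix a triangulation of \<open>C\<close>.
  In a triangle \<open>t = xyz\<close> of it, the six points \<open>x, y, z, (x + y)/2, (y + z)/2, (x + z)/2\<close> are halves
  of points of \<open>A + B\<close> and give \<open>4\<close> triangles, and each
  further point \<open>a\<close> of \<open>A \<union> B\<close> in \<open>t\<close> produces the three new points \<open>(a + x)/2, (a + y)/2, (a + z)/2\<close>.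
  Counting gives \<open>tr (A + B) \<ge> 2 tr A + 2 tr B \<ge> (sqrt (tr A) + sqrt (tr B))\<^sup>2\<close>, strictly
  unless \<open>A = B\<close>. To count triangles locally without angles, a point \<open>q\<close> of a convex set gets as weight the
  number of signs for which the segment from \<open>q\<close> in direction \<open>\<plusminus>d\<close> enters the set, where \<open>d\<close> is a generic direction: these
  weights add up over the triangles, and the vertices of one triangle have total weight \<open>1\<close>.

  For \<open>A = B\<close> equality says that a midpoint of two points of \<open>A\<close> in a triangle of some
  triangulation is always one of the six points. Every triangle without further points of \<open>A\<close> belongs to a
  triangulation (lift \<open>A\<close> to a suitable convex height function), so this holds for all of them. The
  structure of \<open>A\<close> follows by induction, deleting an extreme point \<open>v\<close>: if the rest is saturated, then either every boundary
  edge of it seen from \<open>v\<close> spans with \<open>v\<close> a unimodular triangle, or the edges of the lattice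
  polygon at some corner force everything onto two rays. The deletions cannot all be of type (b).
\<close>

text \<open>Triangulating \<open>A \<inter> B\<close> is what makes the count local. Equal hulls
  have equal extreme points, and these lie in both sets, so the intersection has the same hull; and
  a point of \<open>A\<close> or \<open>B\<close> that lies in one of its triangles without being a
  vertex belongs to only one of the two sets, so no midpoint is counted for both. The weight stands
  in for the angle divided by pi: 2 in the interior, 1 inside an edge, and 1 for the three vertices
  of a triangle together. A further point of weight \<open>w\<close> produces three midpoints of
  total weight \<open>2 * w + 2\<close>: the factor 2 gives the bound, the surplus 2 gives
  strictness for \<open>A \<noteq> B\<close>.

  In the equality case the obstacle is that a fixed triangulation does not survive the deletion of a
  point. Hence the condition is put on all empty triangles, a form that passes to the set without an
  extreme point. Rigidity is then applied to the midpoint of \<open>v\<close> and a lattice point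
  just behind a visible edge: if the segment between them crosses the edge, the edge is unimodular;
  if it misses the edge for every choice, the last point of the lattice row marks a corner.\<close>

section \<open>Planar determinants and collinearity\<close>

definition cr :: "real^2 \<Rightarrow> real^2 \<Rightarrow> real" where
  "cr u v = u$1 * v$2 - u$2 * v$1"

lemma cr_simps:
  "cr (u + u') v = cr u v + cr u' v" "cr (u - u') v = cr u v - cr u' v"
  "cr u (v + v') = cr u v + cr u v'" "cr u (v - v') = cr u v - cr u v'"
  "cr (a *\<^sub>R u) v = a * cr u v" "cr u (a *\<^sub>R v) = a * cr u v"
  "cr (-u) v = - cr u v" "cr u (-v) = - cr u v"
  by (simp_all add: cr_def algebra_simps)

lemma cr_zero [simp]: "cr u u = 0" "cr 0 v = 0" "cr u 0 = 0"
  by (simp_all add: cr_def)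

lemma cr_anti: "cr v u = - cr u v"
  by (simp add: cr_def)

text \<open>Cramer's rule multiplied out, so that parallel \<open>u\<close> and \<open>v\<close> are
  allowed. It gives affine coordinates in \<open>coord_exists\<close> and turns slopes into sides of
  a line in \<open>next_edge\<close>.\<close>

lemma cr_cramer: "cr u v *\<^sub>R p = cr p v *\<^sub>R u + cr u p *\<^sub>R v"
  by (simp add: cr_def vec_eq_iff forall_2 algebra_simps)

lemma cr_eq_0_iff:
  assumes "u \<noteq> 0"
  shows "cr u v = 0 \<longleftrightarrow> (\<exists>c. v = c *\<^sub>R u)"
proof
  assume "cr u v = 0"
  then have e: "u$1 * v$2 = u$2 * v$1" by (simp add: cr_def)
  have "u$1 \<noteq> 0 \<or> u$2 \<noteq> 0"
    using assms by (auto simp: vec_eq_iff forall_2)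
  then show "\<exists>c. v = c *\<^sub>R u"
  proof
    assume "u$1 \<noteq> 0"
    then show ?thesis using e
      by (intro exI[of _ "v$1/u$1"]) (simp add: vec_eq_iff forall_2 field_simps)
  next
    assume "u$2 \<noteq> 0"
    then show ?thesis using e
      by (intro exI[of _ "v$2/u$2"]) (simp add: vec_eq_iff forall_2 field_simps)
  qed
qed (auto simp: cr_simps)

lemma cr_collinear: "collinear {x, y, z} \<longleftrightarrow> cr (y - x) (z - x) = 0"
proof -
  have "collinear {x, y, z} \<longleftrightarrow> collinear {y, x, z}" by (simp add: insert_commute)
  also have "\<dots> \<longleftrightarrow> collinear {0, y - x, z - x}" by (simp add: collinear_3)
  also have "\<dots> \<longleftrightarrow> cr (y - x) (z - x) = 0"
  proof (cases "y = x")
    case False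
    then have "y - x \<noteq> 0" by simp
    with cr_eq_0_iff[OF this] show ?thesis
      unfolding collinear_lemma by (metis False eq_iff_diff_eq_0 scaleR_zero_left)
  qed auto
  finally show ?thesis .
qed

lemma collinear_cr_iff:
  "collinear S \<longleftrightarrow> (\<forall>x\<in>S. \<forall>y\<in>S. \<forall>z\<in>S. cr (y - x) (z - x) = 0)"
proof
  assume "collinear S"
  then show "\<forall>x\<in>S. \<forall>y\<in>S. \<forall>z\<in>S. cr (y - x) (z - x) = 0"
    by (metis cr_collinear collinear_subset bot_least insert_subset)
next
  assume r: "\<forall>x\<in>S. \<forall>y\<in>S. \<forall>z\<in>S. cr (y - x) (z - x) = 0"
  show "collinear S"
  proof (cases "\<exists>x\<in>S. \<exists>y\<in>S. x \<noteq> y")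
    case True
    then obtain x y where xy: "x \<in> S" "y \<in> S" "y - x \<noteq> 0" by auto
    show ?thesis unfolding collinear_def
    proof (intro exI[of _ "y - x"] ballI)
      fix p q assume "p \<in> S" "q \<in> S"
      then have "cr (y - x) (p - x) = 0" "cr (y - x) (q - x) = 0" using r xy by auto
      then obtain a b where ab: "p - x = a *\<^sub>R (y - x)" "q - x = b *\<^sub>R (y - x)"
        using cr_eq_0_iff[OF xy(3)] by blast
      have "p - q = (p - x) - (q - x)" by simp
      also have "\<dots> = (a - b) *\<^sub>R (y - x)" unfolding ab by (simp add: scaleR_left_diff_distrib)
      finally have "p - q = (a - b) *\<^sub>R (y - x)" .
      then show "\<exists>c. p - q = c *\<^sub>R (y - x)" ..
    qed
  next
    case False
    then show ?thesis unfolding collinear_def by (metis diff_self scaleR_zero_left)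
  qed
qed

text \<open>Stated for arbitrary \<open>x\<close> and \<open>y\<close>, since
  \<open>vis_exists\<close> takes one of them to be the outside point \<open>v\<close>.\<close>

lemma point_off_line:
  assumes "\<not> collinear X" "x \<noteq> y"
  shows "\<exists>z\<in>X. cr (y - x) (z - x) \<noteq> 0"
proof (rule ccontr)
  assume "\<not> ?thesis"
  then have e: "cr (y - x) (z - x) = 0" if "z \<in> X" for z using that by blast
  have "y - x \<noteq> 0" using assms(2) by simp
  then have l: "\<exists>c. z - x = c *\<^sub>R (y - x)" if "z \<in> X" for z using e[OF that] cr_eq_0_iff by blast
  have "collinear X" unfolding collinear_def
  proof (intro exI[of _ "y - x"] ballI)
    fix u v assume "u \<in> X" "v \<in> X"
    then obtain c c' where "u - x = c *\<^sub>R (y - x)" "v - x = c' *\<^sub>R (y - x)" using l by blast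
    then have "(u - x) - (v - x) = (c - c') *\<^sub>R (y - x)" by (simp add: scaleR_left_diff_distrib)
    then show "\<exists>c. u - v = c *\<^sub>R (y - x)" by auto
  qed
  then show False using assms(1) by blast
qed

lemma not_collinear_affine:
  assumes "cr (y - x) (z - x) \<noteq> 0"
  shows "\<not> affine_dependent {x, y, z}" "x \<noteq> y" "y \<noteq> z" "x \<noteq> z" "card {x, y, z} = 3"
proof -
  have nc: "\<not> collinear {x,y,z}" using assms cr_collinear by blast
  then show "\<not> affine_dependent {x, y, z}" "x \<noteq> y" "y \<noteq> z" "x \<noteq> z"
    by (auto simp: collinear_3_eq_affine_dependent)
  then show "card {x, y, z} = 3" by simp
qed

section \<open>Barycentric coordinates\<close>

text \<open>A quotient of signed areas, hence independent of the orientation. It is the coordinate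
  at the first vertex; the other two are the cyclic shifts \<open>bary y z x p\<close> and
  \<open>bary z x y p\<close>, whose denominators agree by \<open>cr_cyc\<close>.\<close>

definition bary :: "real^2 \<Rightarrow> real^2 \<Rightarrow> real^2 \<Rightarrow> real^2 \<Rightarrow> real" where
  "bary x y z p = cr (y - p) (z - p) / cr (y - x) (z - x)"

lemma cr_cyc: "cr (z - y) (x - y) = cr (y - x) (z - x)" "cr (x - z) (y - z) = cr (y - x) (z - x)"
  by (simp_all add: cr_def algebra_simps)

lemma bary_sum:
  assumes "cr (y - x) (z - x) \<noteq> 0"
  shows "bary x y z p + bary y z x p + bary z x y p = 1"
  unfolding bary_def cr_cyc add_divide_distrib[symmetric]
  using assms by (simp add: cr_def field_simps)

lemma bary_eq:
  assumes "cr (y - x) (z - x) \<noteq> 0"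
  shows "bary x y z p *\<^sub>R x + bary y z x p *\<^sub>R y + bary z x y p *\<^sub>R z = p"
proof -
  let ?D = "cr (y - x) (z - x)"
  have "?D *\<^sub>R (bary x y z p *\<^sub>R x + bary y z x p *\<^sub>R y + bary z x y p *\<^sub>R z)
      = cr (y - p) (z - p) *\<^sub>R x + cr (z - p) (x - p) *\<^sub>R y + cr (x - p) (y - p) *\<^sub>R z"
    using assms unfolding bary_def cr_cyc(1)[of z y x] cr_cyc(2)[of x z y]
    by (simp add: scaleR_add_right)
  also have "\<dots> = ?D *\<^sub>R p"
    by (simp add: cr_def vec_eq_iff forall_2 algebra_simps)
  finally show ?thesis using scaleR_left_imp_eq[OF assms] by blast
qed

lemma bary_comb:
  assumes "cr (y - x) (z - x) \<noteq> 0" "u + v + w = 1"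
  shows "bary x y z (u *\<^sub>R x + v *\<^sub>R y + w *\<^sub>R z) = u"
proof -
  have u: "u = 1 - v - w" using assms(2) by simp
  have "cr (y - (u *\<^sub>R x + v *\<^sub>R y + w *\<^sub>R z)) (z - (u *\<^sub>R x + v *\<^sub>R y + w *\<^sub>R z)) = u * cr (y - x) (z - x)"
    unfolding u by (simp add: cr_def algebra_simps)
  then show ?thesis using assms(1) by (simp add: bary_def)
qed

lemma bary_vertex [simp]:
  assumes "cr (y - x) (z - x) \<noteq> 0"
  shows "bary x y z x = 1" "bary x y z y = 0" "bary x y z z = 0"
  using assms by (simp_all add: bary_def)

text \<open>The factor of \<open>s\<close> is the slope of the coordinate in direction
  \<open>d\<close>; its sign decides whether a segment enters the triangle.\<close>

lemma bary_move: "bary x y z (p + s *\<^sub>R d) = bary x y z p + s * (cr d (y - z) / cr (y - x) (z - x))"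
proof -
  have "cr (y - (p + s *\<^sub>R d)) (z - (p + s *\<^sub>R d)) = cr (y - p) (z - p) + s * cr d (y - z)"
    by (simp add: cr_def algebra_simps)
  then show ?thesis unfolding bary_def by (simp add: add_divide_distrib)
qed

lemma bary_midpoint: "bary x y z (midpoint p q) = (bary x y z p + bary x y z q) / 2"
proof -
  have "midpoint p q = p + (1/2) *\<^sub>R (q - p)"
    by (simp add: midpoint_def vec_eq_iff forall_2 field_simps)
  moreover have "bary x y z q = bary x y z p + 1 * (cr (q - p) (y - z) / cr (y - x) (z - x))"
    using bary_move[of x y z p 1 "q - p"] by simp
  ultimately show ?thesis using bary_move[of x y z p "1/2" "q - p"] by simp
qed

lemma in_triangle_iff:
  assumes "cr (y - x) (z - x) \<noteq> 0"
  shows "p \<in> convex hull {x, y, z} \<longleftrightarrow> 0 \<le> bary x y z p \<and> 0 \<le> bary y z x p \<and> 0 \<le> bary z x y p"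
proof
  assume "p \<in> convex hull {x, y, z}"
  then obtain u v w where uvw: "0 \<le> u" "0 \<le> v" "0 \<le> w" "u + v + w = 1"
    "p = u *\<^sub>R x + v *\<^sub>R y + w *\<^sub>R z" by (auto simp: convex_hull_3)
  have "bary x y z p = u" using bary_comb[OF assms uvw(4)] uvw(5) by simp
  moreover have "bary y z x p = v"
    using bary_comb[of z y x v w u] uvw assms cr_cyc(1)[of z y x] by (simp add: add.commute add.left_commute)
  moreover have "bary z x y p = w"
    using bary_comb[of x z y w u v] uvw assms cr_cyc(2)[of x z y] by (simp add: add.commute add.left_commute)
  ultimately show "0 \<le> bary x y z p \<and> 0 \<le> bary y z x p \<and> 0 \<le> bary z x y p"
    using uvw by simp
next
  assume "0 \<le> bary x y z p \<and> 0 \<le> bary y z x p \<and> 0 \<le> bary z x y p"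
  then show "p \<in> convex hull {x, y, z}"
    unfolding convex_hull_3 mem_Collect_eq using bary_sum[OF assms, of p] bary_eq[OF assms, of p] by metis
qed

lemma vertex_bary_iff:
  assumes "cr (y - x) (z - x) \<noteq> 0" "p \<in> convex hull {x, y, z}"
  shows "p = x \<longleftrightarrow> bary x y z p = 1"
proof
  assume "bary x y z p = 1"
  then have "bary y z x p = 0" "bary z x y p = 0"
    using bary_sum[OF assms(1), of p] assms by (auto simp: in_triangle_iff)
  with bary_eq[OF assms(1), of p] \<open>bary x y z p = 1\<close> show "p = x" by simp
qed (use assms in simp)

lemma interior_triangle_iff:
  assumes "cr (y - x) (z - x) \<noteq> 0"
  shows "p \<in> interior (convex hull {x, y, z}) \<longleftrightarrow> 0 < bary x y z p \<and> 0 < bary y z x p \<and> 0 < bary z x y p"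
proof -
  have *: "p \<in> interior (convex hull {x, y, z}) \<longleftrightarrow>
    (\<exists>u v w. 0 < u \<and> 0 < v \<and> 0 < w \<and> u + v + w = 1 \<and> u *\<^sub>R x + v *\<^sub>R y + w *\<^sub>R z = p)"
    using interior_convex_hull_3_minimal[of x y z] cr_collinear[of x y z] assms by auto
  show ?thesis
  proof
    assume "p \<in> interior (convex hull {x, y, z})"
    then obtain u v w where uvw: "0 < u" "0 < v" "0 < w" "u + v + w = 1"
      "p = u *\<^sub>R x + v *\<^sub>R y + w *\<^sub>R z" using * by metis
    have "bary x y z p = u" using bary_comb[OF assms uvw(4)] uvw(5) by simp
    moreover have "bary y z x p = v"
      using bary_comb[of z y x v w u] uvw assms cr_cyc(1)[of z y x] by (simp add: add.commute add.left_commute)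
    moreover have "bary z x y p = w"
      using bary_comb[of x z y w u v] uvw assms cr_cyc(2)[of x z y] by (simp add: add.commute add.left_commute)
    ultimately show "0 < bary x y z p \<and> 0 < bary y z x p \<and> 0 < bary z x y p"
      using uvw by simp
  next
    assume "0 < bary x y z p \<and> 0 < bary y z x p \<and> 0 < bary z x y p"
    then show "p \<in> interior (convex hull {x, y, z})"
      unfolding * using bary_sum[OF assms, of p] bary_eq[OF assms, of p] by metis
  qed
qed

section \<open>Counting germs in a generic direction\<close>

text \<open>One later point in \<open>S\<close> is enough: for convex \<open>S\<close> the whole
  segment up to it lies in \<open>S\<close>, by \<open>convex_ray\<close>.\<close>

definition enters :: "real^2 \<Rightarrow> (real^2) set \<Rightarrow> real^2 \<Rightarrow> bool" where
  "enters d S q \<longleftrightarrow> q \<in> S \<and> (\<exists>s>0. q + s *\<^sub>R d \<in> S)"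

definition wt :: "real^2 \<Rightarrow> (real^2) set \<Rightarrow> real^2 \<Rightarrow> nat" where
  "wt d S q = of_bool (enters d S q) + of_bool (enters (- d) S q)"

text \<open>Directions parallel to no line through two points of \<open>X\<close>. A germ in such a
  direction never runs along an edge, so it belongs to a single triangle.\<close>

definition generic :: "real^2 \<Rightarrow> (real^2) set \<Rightarrow> bool" where
  "generic d X \<longleftrightarrow> (\<forall>x\<in>X. \<forall>y\<in>X. x \<noteq> y \<longrightarrow> cr d (y - x) \<noteq> 0)"

lemma generic_subset: "generic d X \<Longrightarrow> Y \<subseteq> X \<Longrightarrow> generic d Y"
  by (auto simp: generic_def)

lemma generic_uminus: "generic d X \<Longrightarrow> generic (- d) X"
  by (auto simp: generic_def cr_simps)

lemma generic_exists:
  assumes "finite X"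
  shows "\<exists>d. generic d X"
proof -
  \<comment> \<open>The slopes to avoid. Vertical pairs add the value 0 through division by zero;
    the direction chosen below has first coordinate 1 and is never parallel to them.\<close>
  let ?F = "(\<lambda>(x, y). (y - x)$2 / (y - x)$1) ` (X \<times> X)"
  have "finite ?F" using assms by simp
  then obtain t where t: "t \<notin> ?F" using ex_new_if_finite infinite_UNIV_char_0 by blast
  have "cr (vector [1, t]) (y - x) \<noteq> 0" if "x \<in> X" "y \<in> X" "x \<noteq> y" for x y
  proof
    assume "cr (vector [1, t]) (y - x) = 0"
    then have e: "(y - x)$2 = t * (y - x)$1" by (simp add: cr_def)
    have "(y - x)$1 \<noteq> 0" using e that(3) by (auto simp: vec_eq_iff forall_2)
    then have "t = (y - x)$2 / (y - x)$1" using e by simp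
    then show False using t that by force
  qed
  then show ?thesis unfolding generic_def by blast
qed

text \<open>Positive coordinates survive a short move, so only those that vanish at \<open>p\<close>
  matter, and these have to increase along \<open>d\<close>. Genericity makes all three slopes
  nonzero.\<close>

lemma enters_triangle:
  assumes D: "cr (y - x) (z - x) \<noteq> 0" and g: "generic d {x, y, z}" and p: "p \<in> convex hull {x, y, z}"
  shows "enters d (convex hull {x, y, z}) p \<longleftrightarrow>
     (bary x y z p = 0 \<longrightarrow> cr d (y - z) / cr (y - x) (z - x) > 0) \<and>
     (bary y z x p = 0 \<longrightarrow> cr d (z - x) / cr (y - x) (z - x) > 0) \<and>
     (bary z x y p = 0 \<longrightarrow> cr d (x - y) / cr (y - x) (z - x) > 0)" (is "?l \<longleftrightarrow> ?r")
proof -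
  let ?D = "cr (y - x) (z - x)"
  define a where "a = cr d (y - z) / ?D"
  define b where "b = cr d (z - x) / ?D"
  define c where "c = cr d (x - y) / ?D"
  define u where "u = bary x y z p"
  define v where "v = bary y z x p"
  define w where "w = bary z x y p"
  have nz: "a \<noteq> 0" "b \<noteq> 0" "c \<noteq> 0"
    using g D not_collinear_affine[OF D] unfolding generic_def a_def b_def c_def by auto
  have pos: "0 \<le> u" "0 \<le> v" "0 \<le> w" using p in_triangle_iff[OF D] unfolding u_def v_def w_def by auto
  have mv: "p + s *\<^sub>R d \<in> convex hull {x, y, z} \<longleftrightarrow> 0 \<le> u + s * a \<and> 0 \<le> v + s * b \<and> 0 \<le> w + s * c" for s
    unfolding in_triangle_iff[OF D] bary_move cr_cyc u_def v_def w_def a_def b_def c_def by simp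
  \<comment> \<open>A positive coordinate stays nonnegative for a while whatever its slope; the
    \<open>+ 1\<close> in the witness guards against slope 0.\<close>
  have key: "\<exists>e>0. \<forall>s. 0 < s \<and> s \<le> e \<longrightarrow> 0 \<le> u + s * a"
    if "0 \<le> u" "u = 0 \<longrightarrow> a > 0" for u a :: real
  proof (cases "u = 0")
    case True then show ?thesis using that by (intro exI[of _ 1]) auto
  next
    case False
    show ?thesis
    proof (intro exI[of _ "u / (\<bar>a\<bar> + 1)"] conjI allI impI)
      show "u / (\<bar>a\<bar> + 1) > 0" using False that by simp
      fix s assume s: "0 < s \<and> s \<le> u / (\<bar>a\<bar> + 1)"
      then have "s * (\<bar>a\<bar> + 1) \<le> u" by (simp add: pos_le_divide_eq add_nonneg_pos)
      moreover have "s * a \<ge> - (s * \<bar>a\<bar>)" using s by (metis abs_ge_minus_self abs_mult abs_of_pos minus_le_iff)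
      ultimately show "0 \<le> u + s * a" using s by (simp add: algebra_simps)
    qed
  qed
  have "?l \<longleftrightarrow> (\<exists>s>0. 0 \<le> u + s * a \<and> 0 \<le> v + s * b \<and> 0 \<le> w + s * c)"
    unfolding enters_def using p mv by simp
  also have "\<dots> \<longleftrightarrow> (u = 0 \<longrightarrow> a > 0) \<and> (v = 0 \<longrightarrow> b > 0) \<and> (w = 0 \<longrightarrow> c > 0)" (is "_ \<longleftrightarrow> ?m")
  proof
    assume "\<exists>s>0. 0 \<le> u + s * a \<and> 0 \<le> v + s * b \<and> 0 \<le> w + s * c"
    then show ?m using nz by (auto simp: zero_le_mult_iff)
  next
    assume m: ?m
    obtain e1 where e1: "e1 > 0" "\<And>s. 0 < s \<and> s \<le> e1 \<Longrightarrow> 0 \<le> u + s * a" using key[of u a] pos m by blast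
    obtain e2 where e2: "e2 > 0" "\<And>s. 0 < s \<and> s \<le> e2 \<Longrightarrow> 0 \<le> v + s * b" using key[of v b] pos m by blast
    obtain e3 where e3: "e3 > 0" "\<And>s. 0 < s \<and> s \<le> e3 \<Longrightarrow> 0 \<le> w + s * c" using key[of w c] pos m by blast
    show "\<exists>s>0. 0 \<le> u + s * a \<and> 0 \<le> v + s * b \<and> 0 \<le> w + s * c"
      by (rule exI[of _ "min e1 (min e2 e3)"]) (use e1 e2 e3 in auto)
  qed
  finally show ?thesis unfolding a_def b_def c_def u_def v_def w_def .
qed

lemma wt_outside: "p \<notin> S \<Longrightarrow> wt d S p = 0"
  by (simp add: wt_def enters_def)

lemma wt_le_2: "wt d S p \<le> 2"
  by (simp add: wt_def)

text \<open>Inside an edge exactly one coordinate vanishes, and its slope changes sign with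
  \<open>d\<close>: one of the two germs enters. In the interior no coordinate vanishes and both
  enter.\<close>

lemma wt_triangle:
  assumes D: "cr (y - x) (z - x) \<noteq> 0" and g: "generic d {x, y, z}" and p: "p \<in> convex hull {x, y, z}"
  shows "0 < bary x y z p \<Longrightarrow> 0 < bary y z x p \<Longrightarrow> 0 < bary z x y p \<Longrightarrow> wt d (convex hull {x, y, z}) p = 2"
    and "0 < bary x y z p \<Longrightarrow> 0 < bary y z x p \<Longrightarrow> bary z x y p = 0 \<Longrightarrow> wt d (convex hull {x, y, z}) p = 1"
    and "0 < bary x y z p \<Longrightarrow> bary y z x p = 0 \<Longrightarrow> 0 < bary z x y p \<Longrightarrow> wt d (convex hull {x, y, z}) p = 1"
    and "bary x y z p = 0 \<Longrightarrow> 0 < bary y z x p \<Longrightarrow> 0 < bary z x y p \<Longrightarrow> wt d (convex hull {x, y, z}) p = 1"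
proof -
  let ?D = "cr (y - x) (z - x)"
  define a where "a = cr d (y - z) / ?D"
  define b where "b = cr d (z - x) / ?D"
  define c where "c = cr d (x - y) / ?D"
  have nz: "a \<noteq> 0" "b \<noteq> 0" "c \<noteq> 0"
    using g D not_collinear_affine[OF D] unfolding generic_def a_def b_def c_def by auto
  have m: "cr (-d) (y - z) / ?D = - a" "cr (-d) (z - x) / ?D = - b" "cr (-d) (x - y) / ?D = - c"
    unfolding a_def b_def c_def by (simp_all add: cr_simps(7))
  note e = enters_triangle[OF D g p, folded a_def b_def c_def]
    enters_triangle[OF D generic_uminus[OF g] p, unfolded m]
  show "0 < bary x y z p \<Longrightarrow> 0 < bary y z x p \<Longrightarrow> 0 < bary z x y p \<Longrightarrow> wt d (convex hull {x, y, z}) p = 2"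
    by (simp add: wt_def e)
  show "0 < bary x y z p \<Longrightarrow> 0 < bary y z x p \<Longrightarrow> bary z x y p = 0 \<Longrightarrow> wt d (convex hull {x, y, z}) p = 1"
    using nz by (simp add: wt_def e)
  show "0 < bary x y z p \<Longrightarrow> bary y z x p = 0 \<Longrightarrow> 0 < bary z x y p \<Longrightarrow> wt d (convex hull {x, y, z}) p = 1"
    using nz by (simp add: wt_def e)
  show "bary x y z p = 0 \<Longrightarrow> 0 < bary y z x p \<Longrightarrow> 0 < bary z x y p \<Longrightarrow> wt d (convex hull {x, y, z}) p = 1"
    using nz by (simp add: wt_def e)
qed

text \<open>The slopes of the three coordinates are nonzero with sum 0, so exactly two of them share
  a sign. A vertex is entered by \<open>d\<close> or by \<open>- d\<close> exactly when the slopes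
  of the other two coordinates agree in sign, and this happens at one vertex. It replaces the angle
  sum of a triangle.\<close>

lemma wt_triangle_vertices:
  assumes D: "cr (y - x) (z - x) \<noteq> 0" and g: "generic d {x, y, z}"
  shows "wt d (convex hull {x, y, z}) x + wt d (convex hull {x, y, z}) y + wt d (convex hull {x, y, z}) z = 1"
proof -
  let ?D = "cr (y - x) (z - x)"
  have nz: "cr d (y - z) \<noteq> 0" "cr d (z - x) \<noteq> 0" "cr d (x - y) \<noteq> 0"
    using g D not_collinear_affine[OF D] unfolding generic_def by auto
  have D': "cr (z - y) (x - y) \<noteq> 0" "cr (x - z) (y - z) \<noteq> 0" using D cr_cyc by auto
  have in_t: "x \<in> convex hull {x, y, z}" "y \<in> convex hull {x, y, z}" "z \<in> convex hull {x, y, z}"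
    by (auto intro: hull_inc)
  define a where "a = cr d (y - z) / ?D"
  define b where "b = cr d (z - x) / ?D"
  define c where "c = cr d (x - y) / ?D"
  have s: "a + b + c = 0" unfolding a_def b_def c_def
    by (simp flip: add_divide_distrib) (simp add: cr_simps)
  have abc: "a \<noteq> 0" "b \<noteq> 0" "c \<noteq> 0" using nz D unfolding a_def b_def c_def by auto
  have m: "cr (-d) (y - z) / ?D = - a" "cr (-d) (z - x) / ?D = - b" "cr (-d) (x - y) / ?D = - c"
    unfolding a_def b_def c_def by (simp_all add: cr_simps(7))
  note e = enters_triangle[OF D g] enters_triangle[OF D generic_uminus[OF g]]
  show ?thesis
    unfolding wt_def e(1)[OF in_t(1)] e(1)[OF in_t(2)] e(1)[OF in_t(3)]
       e(2)[OF in_t(1)] e(2)[OF in_t(2)] e(2)[OF in_t(3)]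
       m a_def[symmetric] b_def[symmetric] c_def[symmetric]
       bary_vertex[OF D] bary_vertex[OF D'(1)] bary_vertex[OF D'(2)]
    using s abc by (auto simp: of_bool_def)
qed

section \<open>Counting the triangles of a triangulation by weights\<close>

lemma triangulates_triangle:
  assumes "triangulates \<T> X" "T \<in> \<T>"
  obtains x y z where "{x, y, z} \<subseteq> X" "cr (y - x) (z - x) \<noteq> 0" "T = convex hull {x, y, z}"
proof -
  have "2 simplex T" using assms by (auto simp: triangulates_def)
  then obtain C where C: "\<not> affine_dependent C" "card C = 3" "T = convex hull C"
    by (auto simp: simplex_def)
  then obtain x y z where xyz: "C = {x, y, z}" "x \<noteq> y" "y \<noteq> z" "x \<noteq> z" by (auto simp: card_3_iff)
  have "C \<subseteq> X"
    using assms C extreme_point_of_convex_hull_affine_independent[OF C(1)] unfolding triangulates_def by blast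
  moreover have "cr (y - x) (z - x) \<noteq> 0"
    using C(1) xyz cr_collinear[of x y z] by (auto simp: collinear_3_eq_affine_dependent)
  ultimately show ?thesis using that xyz C by blast
qed

text \<open>A point of \<open>X\<close> in the triangle is a vertex of some triangle
  \<open>T'\<close>, hence extreme in the common face, hence extreme in the triangle itself.\<close>

lemma triangulates_vertices:
  assumes T: "triangulates \<T> X" "convex hull {x, y, z} \<in> \<T>" and D: "cr (y - x) (z - x) \<noteq> 0"
  shows "X \<inter> convex hull {x, y, z} = {x, y, z}"
proof
  note ext = extreme_point_of_convex_hull_affine_independent[OF not_collinear_affine(1)[OF D]]
  show "{x, y, z} \<subseteq> X \<inter> convex hull {x, y, z}"
    using T ext hull_subset[of "{x, y, z}" convex] unfolding triangulates_def by blast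
  show "X \<inter> convex hull {x, y, z} \<subseteq> {x, y, z}"
  proof
    fix p assume p: "p \<in> X \<inter> convex hull {x, y, z}"
    then obtain T' where T': "T' \<in> \<T>" "p extreme_point_of T'"
      using T unfolding triangulates_def by blast
    have "convex hull {x, y, z} \<inter> T' face_of convex hull {x, y, z}"
      using T T' unfolding triangulates_def triangulation_def by blast
    moreover have "p extreme_point_of (convex hull {x, y, z} \<inter> T')"
      using T'(2) p unfolding extreme_point_of_def by blast
    ultimately have "p extreme_point_of convex hull {x, y, z}"
      using face_of_trans unfolding face_of_singleton[symmetric] by blast
    then show "p \<in> {x, y, z}" using ext by blast
  qed
qed

text \<open>Infinitely many of these points accumulate at \<open>q\<close>. Needed after a
  pigeonhole argument that yields only infinitely many indices, not all.\<close>

lemma closed_inter_ray: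
  fixes S :: "'a::real_normed_vector set"
  assumes "closed S" "infinite {n::nat. q + (s / real (Suc n)) *\<^sub>R d \<in> S}"
  shows "q \<in> S"
proof -
  have "q \<in> closure S"
    unfolding closure_approachable
  proof (intro allI impI)
    fix e :: real assume e: "e > 0"
    have "(\<lambda>n. q + (s / real (Suc n)) *\<^sub>R d) \<longlonglongrightarrow> q + 0 *\<^sub>R d"
      by (intro tendsto_intros LIMSEQ_Suc lim_const_over_n)
    then have "\<forall>\<^sub>F n in sequentially. dist (q + (s / real (Suc n)) *\<^sub>R d) q < e"
      using e by (simp add: tendsto_iff)
    then obtain N where N: "\<And>n. n \<ge> N \<Longrightarrow> dist (q + (s / real (Suc n)) *\<^sub>R d) q < e"
      by (auto simp: eventually_sequentially)
    obtain n where "n \<ge> N" "q + (s / real (Suc n)) *\<^sub>R d \<in> S"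
      using assms(2) by (metis (mono_tags, lifting) finite_nat_set_iff_bounded_le linorder_le_cases mem_Collect_eq)
    then show "\<exists>y\<in>S. dist y q < e" using N by blast
  qed
  then show ?thesis using assms(1) by simp
qed

lemma convex_ray:
  fixes q :: "'a::real_vector"
  assumes "convex S" "q \<in> S" "q + s *\<^sub>R d \<in> S" "0 \<le> r" "r \<le> s"
  shows "q + r *\<^sub>R d \<in> S"
proof (cases "s = 0")
  case False
  then have "q + r *\<^sub>R d = (1 - r / s) *\<^sub>R q + (r / s) *\<^sub>R (q + s *\<^sub>R d)"
    by (simp add: scaleR_add_right scaleR_diff_left)
  then show ?thesis using assms False by (simp add: convexD_alt)
qed (use assms in auto)

text \<open>Two triangles with a common germ meet in a face that contains a segment in direction
  \<open>d\<close>. A proper face lies in an edge, which genericity excludes, so the face is the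
  whole triangle. Equality follows by symmetry.\<close>

lemma enters_unique:
  assumes T: "triangulates \<T> X" and g: "generic d X"
    and "T \<in> \<T>" "T' \<in> \<T>" "enters d T q" "enters d T' q"
  shows "T \<subseteq> T'"
proof -
  obtain s s' where s: "s > 0" "q + s *\<^sub>R d \<in> T" "s' > 0" "q + s' *\<^sub>R d \<in> T'" "q \<in> T" "q \<in> T'"
    using assms unfolding enters_def by blast
  have conv: "convex T" "convex T'"
    using T assms convex_simplex unfolding triangulates_def by blast+
  define m where "m = min s s'"
  have m: "m > 0" "q + m *\<^sub>R d \<in> T \<inter> T'"
    unfolding m_def using s convex_ray[OF conv(1), of q s d "min s s'"] convex_ray[OF conv(2), of q s' d "min s s'"] by auto
  obtain x y z where xyz: "{x, y, z} \<subseteq> X" "cr (y - x) (z - x) \<noteq> 0" "T = convex hull {x, y, z}"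
    using triangulates_triangle[OF T] assms by metis
  have "T \<inter> T' face_of T"
    using T assms unfolding triangulates_def triangulation_def by blast
  then obtain c where c: "c \<subseteq> {x, y, z}" "T \<inter> T' = convex hull c"
    using face_of_convex_hull_subset[of "{x,y,z}"] xyz(3) by (metis finite.emptyI finite.insertI finite_imp_compact)
  have no: False if "u \<in> {x, y, z}" "v \<in> {x, y, z}" "u \<noteq> v" "c \<subseteq> {u, v}" for u v
  proof -
    have "T \<inter> T' \<subseteq> closed_segment u v"
      using hull_mono[OF that(4), of convex] c(2) by (simp add: segment_convex_hull)
    then have "q \<in> closed_segment u v" "q + m *\<^sub>R d \<in> closed_segment u v" using m s by auto
    then obtain a b where ab: "q = (1 - a) *\<^sub>R u + a *\<^sub>R v" "q + m *\<^sub>R d = (1 - b) *\<^sub>R u + b *\<^sub>R v"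
      unfolding in_segment by blast
    have "m *\<^sub>R d = (q + m *\<^sub>R d) - q" by simp
    also have "\<dots> = (b - a) *\<^sub>R (v - u)" unfolding ab(2) unfolding ab(1) by (simp add: algebra_simps)
    finally have "m * cr d (v - u) = 0" by (metis cr_simps(5) cr_zero(1) mult_zero_right)
    moreover have "cr d (v - u) \<noteq> 0" using g that xyz(1) unfolding generic_def by blast
    ultimately show False using m(1) by simp
  qed
  have ne: "x \<noteq> y" "y \<noteq> z" "x \<noteq> z" using not_collinear_affine[OF xyz(2)] by auto
  have "c = {x, y, z}"
  proof (rule ccontr)
    assume "c \<noteq> {x, y, z}"
    then have "x \<notin> c \<or> y \<notin> c \<or> z \<notin> c" using c(1) by blast
    then have "c \<subseteq> {y, z} \<or> c \<subseteq> {x, z} \<or> c \<subseteq> {x, y}" using c(1) by blast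
    then show False using no[of y z] no[of x z] no[of x y] ne by blast
  qed
  then show ?thesis using c xyz by blast
qed

text \<open>Uniqueness is \<open>enters_unique\<close>. For existence, a germ of the hull gives
  points converging to \<open>q\<close>; one of the finitely many closed triangles contains
  infinitely many of them, and hence also \<open>q\<close>.\<close>

lemma enters_sum:
  assumes T: "triangulates \<T> X" and g: "generic d X"
  shows "(of_bool (enters d (convex hull X) q) :: nat) = (\<Sum>T\<in>\<T>. of_bool (enters d T q))"
proof (cases "\<exists>T\<in>\<T>. enters d T q")
  case True
  then obtain T where t: "T \<in> \<T>" "enters d T q" by blast
  have fin: "finite \<T>" and un: "\<Union>\<T> = convex hull X"
    using T unfolding triangulates_def triangulation_def by auto
  have "enters d (convex hull X) q" using t un unfolding enters_def by blast
  moreover have "enters d T' q \<longleftrightarrow> T' = T" if "T' \<in> \<T>" for T'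
    using enters_unique[OF T g] t that by blast
  then have "(\<Sum>T\<in>\<T>. of_bool (enters d T q)) = (\<Sum>T'\<in>\<T>. of_bool (T' = T) :: nat)"
    by (intro sum.cong) auto
  ultimately show ?thesis using t fin by (simp add: of_bool_def)
next
  case False
  have fin: "finite \<T>" and un: "\<Union>\<T> = convex hull X"
    using T unfolding triangulates_def triangulation_def by auto
  have "\<not> enters d (convex hull X) q"
  proof
    assume "enters d (convex hull X) q"
    then obtain s where s: "s > 0" "q \<in> convex hull X" "q + s *\<^sub>R d \<in> convex hull X"
      unfolding enters_def by blast
    have "\<forall>n\<in>UNIV. \<exists>T\<in>\<T>. q + (s / real (Suc n)) *\<^sub>R d \<in> T"
    proof
      fix n :: nat
      have "q + (s / real (Suc n)) *\<^sub>R d \<in> convex hull X"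
        by (rule convex_ray[OF _ s(2,3)]) (use s in \<open>auto simp: field_simps\<close>)
      then show "\<exists>T\<in>\<T>. q + (s / real (Suc n)) *\<^sub>R d \<in> T" using un by blast
    qed
    then have "\<exists>T\<in>\<T>. infinite {n \<in> UNIV. q + (s / real (Suc n)) *\<^sub>R d \<in> T}"
      by (rule pigeonhole_infinite_rel[OF infinite_UNIV_nat fin])
    then obtain T' where T': "T' \<in> \<T>" "infinite {n \<in> UNIV. q + (s / real (Suc n)) *\<^sub>R d \<in> T'}"
      by (elim bexE)
    have "closed T'" using T T' closed_simplex unfolding triangulates_def by blast
    then have "q \<in> T'" using closed_inter_ray T' by simp
    moreover obtain n where "q + (s / real (Suc n)) *\<^sub>R d \<in> T'"
      using infinite_imp_nonempty[OF T'(2)] by blast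
    moreover have "s / real (Suc n) > 0" using s by simp
    ultimately have "enters d T' q" unfolding enters_def by blast
    then show False using False T' by blast
  qed
  then show ?thesis using False by simp
qed

lemma wt_sum:
  assumes "triangulates \<T> X" "generic d X"
  shows "wt d (convex hull X) q = (\<Sum>T\<in>\<T>. wt d T q)"
  unfolding wt_def sum.distrib
  using enters_sum[OF assms] enters_sum[OF assms(1) generic_uminus[OF assms(2)]] by simp

text \<open>The finite set \<open>M\<close> is unrelated to the vertex set \<open>X\<close>: one
  triangulation of \<open>A \<inter> B\<close> serves to count \<open>A\<close>, \<open>B\<close>
  and all midpoints.\<close>

lemma wt_sum_local:
  assumes "triangulates \<T> X" "generic d X" "finite M"
  shows "(\<Sum>m\<in>M. wt d (convex hull X) m) = (\<Sum>T\<in>\<T>. \<Sum>m\<in>M \<inter> T. wt d T m)"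
proof -
  have "(\<Sum>m\<in>M. wt d (convex hull X) m) = (\<Sum>T\<in>\<T>. \<Sum>m\<in>M. wt d T m)"
    unfolding wt_sum[OF assms(1,2)] by (rule sum.swap)
  also have "\<dots> = (\<Sum>T\<in>\<T>. \<Sum>m\<in>M \<inter> T. wt d T m)"
    by (intro sum.cong refl sum.mono_neutral_right) (use assms wt_outside in auto)
  finally show ?thesis .
qed

text \<open>Each triangle meets \<open>X\<close> in its three vertices and receives weight 1. The
  right-hand side does not mention the triangulation, so the choice inside \<open>tr\<close> becomes
  irrelevant.\<close>

lemma card_triangulation:
  assumes T: "triangulates \<T> X" and g: "generic d X" and fin: "finite X"
  shows "card \<T> = (\<Sum>x\<in>X. wt d (convex hull X) x)"
proof -
  have "(\<Sum>x\<in>X \<inter> T. wt d T x) = 1" if "T \<in> \<T>" for T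
  proof -
    obtain x y z where xyz: "{x, y, z} \<subseteq> X" "cr (y - x) (z - x) \<noteq> 0" "T = convex hull {x, y, z}"
      using triangulates_triangle[OF T \<open>T \<in> \<T>\<close>] by metis
    have "X \<inter> T = {x, y, z}" using triangulates_vertices[OF T] xyz that by simp
    then show ?thesis
      using wt_triangle_vertices[OF xyz(2) generic_subset[OF g xyz(1)]] not_collinear_affine[OF xyz(2)] xyz(3) by simp
  qed
  then show ?thesis unfolding wt_sum_local[OF T g fin] by simp
qed

section \<open>The six points of a triangle\<close>

lemma bary_le_1:
  assumes "cr (y - x) (z - x) \<noteq> 0" "p \<in> convex hull {x, y, z}"
  shows "bary x y z p \<le> 1"
  using assms bary_sum[OF assms(1), of p] in_triangle_iff[OF assms(1), of p] by linarith

text \<open>Comparing the coordinates at \<open>x\<close> gives that of \<open>p'\<close> as 1 plus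
  that of \<open>p\<close>; inside the triangle this forces the value 1 and so the vertex
  \<open>x\<close>.\<close>

lemma midpoint_vertex_aux:
  assumes D: "cr (y - x) (z - x) \<noteq> 0" and p: "p \<in> convex hull {x, y, z}" "p' \<in> convex hull {x, y, z}"
    and e: "midpoint p x = midpoint p' y"
  shows "p' = x"
proof -
  have "bary x y z p + 1 = bary x y z p'"
    using arg_cong[OF e, of "bary x y z"] D by (simp add: bary_midpoint)
  then have "bary x y z p' = 1"
    using bary_le_1[OF D p(2)] in_triangle_iff[OF D, of p] p(1) by linarith
  then show ?thesis using vertex_bary_iff[OF D p(2)] by simp
qed

lemma midpoint_vertex:
  fixes x y z :: "real^2"
  assumes D: "\<not> collinear {x, y, z}" and p: "p \<in> convex hull {x, y, z}" "p' \<in> convex hull {x, y, z}"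
    and v: "v \<in> {x, y, z}" "v' \<in> {x, y, z}" "v \<noteq> v'"
    and e: "midpoint p v = midpoint p' v'"
  shows "p' = v"
proof -
  have "{x, y, z} = {v, v', x} \<or> {x, y, z} = {v, v', y} \<or> {x, y, z} = {v, v', z}" using v by auto
  then obtain w where w: "{x, y, z} = {v, v', w}" by blast
  then show ?thesis using midpoint_vertex_aux[of v' v w p p'] D p e cr_collinear[of v v' w] by simp
qed

definition six :: "real^2 \<Rightarrow> real^2 \<Rightarrow> real^2 \<Rightarrow> (real^2) set" where
  "six x y z = {x, y, z, midpoint x y, midpoint y z, midpoint x z}"

text \<open>A vertex counts as the midpoint of itself with itself.\<close>

lemma six_iff: "m \<in> six x y z \<longleftrightarrow> (\<exists>u\<in>{x, y, z}. \<exists>v\<in>{x, y, z}. m = midpoint u v)"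
  unfolding six_def
  by (simp add: midpoint_sym[of y x] midpoint_sym[of z x] midpoint_sym[of z y]) blast

lemma six_subset: "six x y z \<subseteq> convex hull {x, y, z}"
proof -
  have "midpoint u v \<in> convex hull {x, y, z}" if "u \<in> {x, y, z}" "v \<in> {x, y, z}" for u v
    using that by (meson convex_contains_segment convex_convex_hull hull_inc midpoint_in_closed_segment subsetD)
  then show ?thesis unfolding subset_iff six_iff by blast
qed

lemma midpoint_not_six:
  assumes D: "\<not> collinear {x, y, z}" and p: "p \<in> convex hull {x, y, z}" "p \<notin> {x, y, z}" and v: "v \<in> {x, y, z}"
  shows "midpoint p v \<notin> six x y z"
proof
  assume "midpoint p v \<in> six x y z"
  then obtain u u' where u: "u \<in> {x, y, z}" "u' \<in> {x, y, z}" "midpoint p v = midpoint u' u"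
    unfolding six_iff by blast
  have u_in: "u' \<in> convex hull {x, y, z}" using u(2) hull_inc by metis
  show False
  proof (cases "v = u")
    case True
    then have "p = u'" using u(3) by (simp add: midpoint_def)
    then show False using p u by simp
  next
    case False
    then have "u' = v" using midpoint_vertex[OF D p(1) u_in v u(1)] u(3) by blast
    then have "p = u" using u(3) by (simp add: midpoint_def)
    then show False using p u by simp
  qed
qed

text \<open>The vertices have total weight 1, and each of the three edge midpoints has weight 1.
  This is the local source of the factor 4 in \<open>tr (A + A) = 4 * tr A\<close>.\<close>

lemma sum_six:
  assumes D: "cr (y - x) (z - x) \<noteq> 0" and g: "generic d {x, y, z}"
  shows "(\<Sum>m\<in>six x y z. wt d (convex hull {x, y, z}) m) = 4"
proof -
  have D': "cr (z - y) (x - y) \<noteq> 0" "cr (x - z) (y - z) \<noteq> 0" using D cr_cyc[of z y x] cr_cyc(2)[of x z y] by auto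
  have ne: "x \<noteq> y" "y \<noteq> z" "x \<noteq> z" using not_collinear_affine[OF D] by auto
  note b = bary_midpoint bary_vertex[OF D] bary_vertex[OF D'(1)] bary_vertex[OF D'(2)]
  have ne2: "x \<noteq> midpoint y z" "y \<noteq> midpoint x z" "z \<noteq> midpoint x y"
    using b by (metis add.right_neutral div_0 zero_neq_one)+
  have ne3: "midpoint x y \<noteq> midpoint y z" "midpoint x y \<noteq> midpoint x z" "midpoint y z \<noteq> midpoint x z"
    using ne by (auto simp: midpoint_def)
  have ne4: "x \<noteq> midpoint x y" "y \<noteq> midpoint x y" "y \<noteq> midpoint y z" "z \<noteq> midpoint y z"
    "x \<noteq> midpoint x z" "z \<noteq> midpoint x z"
    using ne midpoint_eq_endpoint by metis+
  have s: "six x y z \<subseteq> convex hull {x, y, z}" by (rule six_subset)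
  have m: "midpoint x y \<in> convex hull {x, y, z}" "midpoint y z \<in> convex hull {x, y, z}"
    "midpoint x z \<in> convex hull {x, y, z}" using s unfolding six_def by blast+
  have w: "wt d (convex hull {x, y, z}) (midpoint x y) = 1" "wt d (convex hull {x, y, z}) (midpoint y z) = 1"
    "wt d (convex hull {x, y, z}) (midpoint x z) = 1"
    using wt_triangle(2)[OF D g m(1)] wt_triangle(4)[OF D g m(2)] wt_triangle(3)[OF D g m(3)]
    unfolding b by simp_all
  show ?thesis
    unfolding six_def using ne ne2 ne3 ne4 w wt_triangle_vertices[OF D g] by simp
qed

text \<open>For interior \<open>p\<close> all three midpoints are interior: 6 = 2 * 2 + 2. For
  \<open>p\<close> inside an edge two midpoints stay in that edge and the third is interior: 1 + 1 +
  2 = 2 * 1 + 2.\<close>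

lemma wt_nonvertex:
  assumes D: "cr (y - x) (z - x) \<noteq> 0" and g: "generic d {x, y, z}"
    and p: "p \<in> convex hull {x, y, z}" "p \<notin> {x, y, z}"
  shows "wt d (convex hull {x, y, z}) p \<ge> 1"
    and "(\<Sum>v\<in>{x, y, z}. wt d (convex hull {x, y, z}) (midpoint p v)) = 2 * wt d (convex hull {x, y, z}) p + 2"
proof -
  have D': "cr (z - y) (x - y) \<noteq> 0" "cr (x - z) (y - z) \<noteq> 0" using D cr_cyc[of z y x] cr_cyc(2)[of x z y] by auto
  have ne: "x \<noteq> y" "y \<noteq> z" "x \<noteq> z" using not_collinear_affine[OF D] by auto
  note b = bary_midpoint bary_vertex[OF D] bary_vertex[OF D'(1)] bary_vertex[OF D'(2)]
  let ?u = "bary x y z p" and ?v = "bary y z x p" and ?w = "bary z x y p"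
  have pos: "0 \<le> ?u" "0 \<le> ?v" "0 \<le> ?w" "?u + ?v + ?w = 1"
    using in_triangle_iff[OF D] p bary_sum[OF D] by auto
  have perm: "convex hull {y, z, x} = convex hull {x, y, z}" "convex hull {z, x, y} = convex hull {x, y, z}"
    by (simp_all add: insert_commute)
  have "?u \<noteq> 1" "?v \<noteq> 1" "?w \<noteq> 1"
    using vertex_bary_iff[OF D p(1)] vertex_bary_iff[OF D'(1), of p] vertex_bary_iff[OF D'(2), of p] p
    unfolding perm by auto
  then have cases: "(?u > 0 \<and> ?v > 0 \<and> ?w > 0) \<or> (?u > 0 \<and> ?v > 0 \<and> ?w = 0) \<or> (?u > 0 \<and> ?v = 0 \<and> ?w > 0)
       \<or> (?u = 0 \<and> ?v > 0 \<and> ?w > 0)" using pos by linarith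
  have mid: "midpoint p v \<in> convex hull {x, y, z}" if "v \<in> {x, y, z}" for v
    using that p(1) by (meson convex_contains_segment convex_convex_hull hull_inc midpoint_in_closed_segment subsetD)
  note W = wt_triangle[OF D g]
  show "wt d (convex hull {x, y, z}) p \<ge> 1"
    using cases W[OF p(1)] by auto
  have "wt d (convex hull {x, y, z}) (midpoint p x) + wt d (convex hull {x, y, z}) (midpoint p y)
     + wt d (convex hull {x, y, z}) (midpoint p z) = 2 * wt d (convex hull {x, y, z}) p + 2"
    using cases W[OF p(1)] W[OF mid, of x] W[OF mid, of y] W[OF mid, of z] unfolding b
    by (elim disjE conjE) simp_all
  then show "(\<Sum>v\<in>{x, y, z}. wt d (convex hull {x, y, z}) (midpoint p v)) = 2 * wt d (convex hull {x, y, z}) p + 2"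
    using ne by simp
qed

text \<open>The six points and the midpoints of further points with vertices are pairwise distinct
  elements of \<open>M\<close>: equal midpoints with different vertices would make the further point
  a vertex, by \<open>midpoint_vertex\<close>.\<close>

lemma local_inequality:
  assumes D: "cr (y - x) (z - x) \<noteq> 0" and g: "generic d {x, y, z}"
    and fin: "finite A" "finite B" "finite M"
    and A: "{x, y, z} \<subseteq> A" "A \<subseteq> convex hull {x, y, z}" and B: "{x, y, z} \<subseteq> B" "B \<subseteq> convex hull {x, y, z}"
    and AB: "A \<inter> B = {x, y, z}" and M: "\<And>a b. a \<in> A \<Longrightarrow> b \<in> B \<Longrightarrow> midpoint a b \<in> M"
  defines "w \<equiv> wt d (convex hull {x, y, z})"
  shows "(\<Sum>m\<in>M. w m) \<ge> 2 * (\<Sum>a\<in>A. w a) + 2 * (\<Sum>b\<in>B. w b) + 2 * card (A - {x, y, z}) + 2 * card (B - {x, y, z})"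
proof -
  let ?V = "{x, y, z}"
  have nc: "\<not> collinear {x, y, z}" using D cr_collinear by simp
  define E where "E = (A - ?V) \<union> (B - ?V)"
  have E: "finite E" "E \<subseteq> convex hull ?V" "E \<inter> ?V = {}" unfolding E_def using fin A B by auto
  let ?g = "\<lambda>(a, v). midpoint a v"
  have inj: "inj_on ?g (E \<times> ?V)"
  proof (rule inj_onI, clarify)
    fix a v a' v' assume "a \<in> E" "a' \<in> E" and v: "v \<in> ?V" "v' \<in> ?V" and e: "midpoint a v = midpoint a' v'"
    then have a: "a \<in> convex hull ?V" "a' \<in> convex hull ?V" "a' \<notin> ?V" using E by auto
    have "v = v'" using midpoint_vertex[OF nc a(1,2) v _ e] a(3) v by auto
    then show "a = a' \<and> v = v'" using e by (simp add: midpoint_def)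
  qed
  have sub: "?g ` (E \<times> ?V) \<subseteq> M"
  proof -
    have "midpoint a v \<in> M" if "a \<in> E" "v \<in> ?V" for a v
    proof (cases "a \<in> A")
      case False
      then have "midpoint v a \<in> M" using that M A(1) unfolding E_def by blast
      then show ?thesis by (simp add: midpoint_sym)
    qed (use that M B(1) in blast)
    then show ?thesis by auto
  qed
  have sub2: "six x y z \<subseteq> M" unfolding subset_iff six_iff using M A(1) B(1) by blast
  have disj: "six x y z \<inter> ?g ` (E \<times> ?V) = {}"
  proof -
    have "midpoint a v \<notin> six x y z" if "a \<in> E" "v \<in> ?V" for a v
      using midpoint_not_six[OF nc, of a v] that E by blast
    then show ?thesis by auto
  qed
  have fsix: "finite (six x y z)" unfolding six_def by simp
  have sumE: "(\<Sum>m\<in>?g ` (E \<times> ?V). w m) = (\<Sum>a\<in>E. 2 * w a + 2)"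
  proof -
    have "(\<Sum>m\<in>?g ` (E \<times> ?V). w m) = (\<Sum>p\<in>E \<times> ?V. w (?g p))"
      by (rule sum.reindex[OF inj, unfolded comp_def])
    also have "\<dots> = (\<Sum>a\<in>E. \<Sum>v\<in>?V. w (midpoint a v))"
      unfolding sum.cartesian_product by (rule sum.cong) auto
    also have "\<dots> = (\<Sum>a\<in>E. 2 * w a + 2)"
      by (rule sum.cong[OF refl], unfold w_def, rule wt_nonvertex(2)[OF D g]) (use E in auto)
    finally show ?thesis .
  qed
  have "(\<Sum>m\<in>M. w m) \<ge> (\<Sum>m\<in>six x y z \<union> ?g ` (E \<times> ?V). w m)"
    by (rule sum_mono2) (use fin sub sub2 in auto)
  also have "(\<Sum>m\<in>six x y z \<union> ?g ` (E \<times> ?V). w m) = 4 + (\<Sum>a\<in>E. 2 * w a + 2)"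
    using sum.union_disjoint[OF fsix _ disj, of w] E sumE sum_six[OF D g] by (simp add: w_def)
  finally have 1: "4 + (\<Sum>a\<in>E. 2 * w a + 2) \<le> (\<Sum>m\<in>M. w m)" .
  have "(\<Sum>a\<in>E. 2 * w a + 2) = (\<Sum>a\<in>A - ?V. 2 * w a + 2) + (\<Sum>a\<in>B - ?V. 2 * w a + 2)"
    unfolding E_def by (rule sum.union_disjoint) (use fin AB in auto)
  then have 2: "(\<Sum>a\<in>E. 2 * w a + 2) = 2 * (\<Sum>a\<in>A - ?V. w a) + 2 * card (A - ?V) + 2 * (\<Sum>a\<in>B - ?V. w a) + 2 * card (B - ?V)"
    unfolding sum.distrib sum_distrib_left[symmetric] by simp
  have V: "(\<Sum>a\<in>?V. w a) = 1"
    using wt_triangle_vertices[OF D g] not_collinear_affine[OF D] unfolding w_def by simp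
  have "(\<Sum>a\<in>A. w a) = (\<Sum>a\<in>A - ?V. w a) + 1" "(\<Sum>a\<in>B. w a) = (\<Sum>a\<in>B - ?V. w a) + 1"
    using sum.subset_diff[OF A(1) fin(1), of w] sum.subset_diff[OF B(1) fin(2), of w] V by simp_all
  then show ?thesis using 1 2 by simp
qed

section \<open>Triangulations from lifted points\<close>

text \<open>No sign condition on the coefficients: \<open>saturated_rigid\<close> uses the
  coefficients 1, 1, -1 of a point reflection.\<close>

lemma bary_affine3:
  assumes "a + b + c = 1"
  shows "bary x y z (a *\<^sub>R u + b *\<^sub>R v + c *\<^sub>R w) = a * bary x y z u + b * bary x y z v + c * bary x y z w"
proof -
  have a: "a = 1 - b - c" using assms by simp
  have 1: "a *\<^sub>R u + b *\<^sub>R v + c *\<^sub>R w = (u + b *\<^sub>R (v - u)) + c *\<^sub>R (w - u)"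
    unfolding a by (simp add: algebra_simps)
  have "bary x y z p = bary x y z u + 1 * (cr (p - u) (y - z) / cr (y - x) (z - x))" for p
    using bary_move[of x y z u 1 "p - u"] by simp
  note 2 = this[of v] this[of w]
  show ?thesis unfolding 1 unfolding bary_move 2 unfolding a by (simp add: ring_distribs)
qed

lemma in_hull3I:
  assumes "a + b + c = 1" "0 \<le> a" "0 \<le> b" "0 \<le> c"
  shows "a *\<^sub>R x + b *\<^sub>R y + c *\<^sub>R z \<in> convex hull {x, y, z}"
  unfolding convex_hull_3 using assms by blast

definition interp :: "(real^2 \<Rightarrow> real) \<Rightarrow> real^2 \<Rightarrow> real^2 \<Rightarrow> real^2 \<Rightarrow> real^2 \<Rightarrow> real" where
  "interp h x y z p = bary x y z p * h x + bary y z x p * h y + bary z x y p * h z"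



lemma interp_affine3:
  assumes "a + b + c = 1"
  shows "interp h x y z (a *\<^sub>R u + b *\<^sub>R v + c *\<^sub>R w)
    = a * interp h x y z u + b * interp h x y z v + c * interp h x y z w"
  unfolding interp_def bary_affine3[OF assms] by (simp add: algebra_simps)

lemma interp_vertex:
  assumes "cr (y - x) (z - x) \<noteq> 0"
  shows "interp h x y z x = h x" "interp h x y z y = h y" "interp h x y z z = h z"
proof -
  have D': "cr (z - y) (x - y) \<noteq> 0" "cr (x - z) (y - z) \<noteq> 0" using assms cr_cyc[of z y x] cr_cyc(2)[of x z y] by auto
  show "interp h x y z x = h x" "interp h x y z y = h y" "interp h x y z z = h z"
    unfolding interp_def bary_vertex[OF assms] bary_vertex[OF D'(1)] bary_vertex[OF D'(2)] by simp_all
qed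

text \<open>The triangles below the lower faces of the convex hull of the graph of \<open>h\<close>.\<close>

definition lower_triple :: "(real^2 \<Rightarrow> real) \<Rightarrow> (real^2) set \<Rightarrow> real^2 \<Rightarrow> real^2 \<Rightarrow> real^2 \<Rightarrow> bool" where
  "lower_triple h X x y z \<longleftrightarrow> {x, y, z} \<subseteq> X \<and> cr (y - x) (z - x) \<noteq> 0 \<and>
     (\<forall>w\<in>X - {x, y, z}. interp h x y z w < h w)"

lemma lower_triple_le:
  assumes "lower_triple h X x y z" "w \<in> X"
  shows "interp h x y z w \<le> h w" "interp h x y z w = h w \<longleftrightarrow> w \<in> {x, y, z}"
proof -
  have "w \<in> {x, y, z} \<Longrightarrow> interp h x y z w = h w"
    using interp_vertex[of y x z h] assms unfolding lower_triple_def by auto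
  moreover have "w \<notin> {x, y, z} \<Longrightarrow> interp h x y z w < h w"
    using assms unfolding lower_triple_def by auto
  ultimately show "interp h x y z w \<le> h w" "interp h x y z w = h w \<longleftrightarrow> w \<in> {x, y, z}" by (cases "w \<in> {x, y, z}"; simp)+
qed

text \<open>Each of the two planes lies below all lifted points, so on its own triangle each is the
  higher one, and on the intersection they agree. A point there can put weight only on vertices at
  which both planes touch the lifted set, that is on common vertices.\<close>

lemma lower_triples_meet:
  assumes l: "lower_triple h X x y z" "lower_triple h X x' y' z'"
  shows "convex hull {x, y, z} \<inter> convex hull {x', y', z'} = convex hull ({x, y, z} \<inter> {x', y', z'})"
proof
  show "convex hull ({x, y, z} \<inter> {x', y', z'}) \<subseteq> convex hull {x, y, z} \<inter> convex hull {x', y', z'}"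
    by (metis Int_lower1 Int_lower2 hull_mono le_inf_iff)
  have D: "cr (y - x) (z - x) \<noteq> 0" "cr (y' - x') (z' - x') \<noteq> 0" and X: "{x, y, z} \<subseteq> X" "{x', y', z'} \<subseteq> X"
    using l unfolding lower_triple_def by auto
  have le: "interp h x' y' z' p \<le> interp h x y z p"
    if l: "lower_triple h X x y z" "lower_triple h X x' y' z'" and p: "p \<in> convex hull {x, y, z}" for p x y z x' y' z'
  proof -
    have D: "cr (y - x) (z - x) \<noteq> 0" and X: "{x, y, z} \<subseteq> X"
      using l unfolding lower_triple_def by auto
    have n: "0 \<le> bary x y z p" "0 \<le> bary y z x p" "0 \<le> bary z x y p" using in_triangle_iff[OF D] p by auto
    have "interp h x' y' z' p = bary x y z p * interp h x' y' z' x + bary y z x p * interp h x' y' z' y + bary z x y p * interp h x' y' z' z"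
      using interp_affine3[OF bary_sum[OF D, of p]] bary_eq[OF D, of p] by metis
    also have "\<dots> \<le> bary x y z p * h x + bary y z x p * h y + bary z x y p * h z"
      using lower_triple_le(1)[OF l(2)] X n by (intro add_mono mult_left_mono) auto
    finally show ?thesis unfolding interp_def[of h x y z] .
  qed
  show "convex hull {x, y, z} \<inter> convex hull {x', y', z'} \<subseteq> convex hull ({x, y, z} \<inter> {x', y', z'})"
  proof
    fix p assume p: "p \<in> convex hull {x, y, z} \<inter> convex hull {x', y', z'}"
    let ?a = "bary x y z p" and ?b = "bary y z x p" and ?c = "bary z x y p"
    let ?i = "interp h x' y' z'"
    have n: "0 \<le> ?a" "0 \<le> ?b" "0 \<le> ?c" using in_triangle_iff[OF D(1)] p by auto
    have s: "?a + ?b + ?c = 1" by (rule bary_sum[OF D(1)])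
    have pe: "?a *\<^sub>R x + ?b *\<^sub>R y + ?c *\<^sub>R z = p" by (rule bary_eq[OF D(1)])
    have "interp h x y z p = ?i p" using le[OF l] le[OF l(2,1)] p by force
    moreover have "?i p = ?a * ?i x + ?b * ?i y + ?c * ?i z"
      using interp_affine3[OF s] pe by metis
    ultimately have "?a * (h x - ?i x) + ?b * (h y - ?i y) + ?c * (h z - ?i z) = 0"
      unfolding interp_def[of h x y z] by (simp add: algebra_simps)
    moreover have "0 \<le> ?a * (h x - ?i x)" "0 \<le> ?b * (h y - ?i y)" "0 \<le> ?c * (h z - ?i z)"
      using n lower_triple_le(1)[OF l(2)] X by auto
    ultimately have "?a * (h x - ?i x) = 0" "?b * (h y - ?i y) = 0" "?c * (h z - ?i z) = 0" by linarith+
    then have "?a \<noteq> 0 \<Longrightarrow> x \<in> {x', y', z'}" "?b \<noteq> 0 \<Longrightarrow> y \<in> {x', y', z'}" "?c \<noteq> 0 \<Longrightarrow> z \<in> {x', y', z'}"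
      using lower_triple_le(2)[OF l(2), of x] lower_triple_le(2)[OF l(2), of y] lower_triple_le(2)[OF l(2), of z] X by simp_all
    then have mem: "?a \<noteq> 0 \<Longrightarrow> x \<in> {x, y, z} \<inter> {x', y', z'}" "?b \<noteq> 0 \<Longrightarrow> y \<in> {x, y, z} \<inter> {x', y', z'}"
      "?c \<noteq> 0 \<Longrightarrow> z \<in> {x, y, z} \<inter> {x', y', z'}" by blast+
    let ?S = "{x, y, z} \<inter> {x', y', z'}"
    define f where "f v = (if v = x then ?a else if v = y then ?b else ?c)" for v
    have ne: "x \<noteq> y" "y \<noteq> z" "x \<noteq> z" using not_collinear_affine[OF D(1)] by auto
    have "\<forall>v\<in>{x, y, z} - ?S. f v = 0" using mem unfolding f_def by auto
    then have "sum f ?S = sum f {x, y, z}" "(\<Sum>v\<in>?S. f v *\<^sub>R v) = (\<Sum>v\<in>{x, y, z}. f v *\<^sub>R v)"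
      by (intro sum.mono_neutral_left; auto)+
    moreover have "sum f {x, y, z} = 1" "(\<Sum>v\<in>{x, y, z}. f v *\<^sub>R v) = p"
      using ne s pe by (simp_all add: f_def add.assoc)
    moreover have "\<forall>v\<in>?S. 0 \<le> f v" using n unfolding f_def by auto
    ultimately show "p \<in> convex hull ?S" by (subst convex_hull_finite) auto
  qed
qed

text \<open>A simplex-method pivot: \<open>w\<close> lies below the plane through the lifted triangle and replaces \<open>x\<close>.\<close>

lemma exchange_step:
  assumes D: "cr (y - x) (z - x) \<noteq> 0" and p: "p \<in> convex hull {x, y, z}"
    and px: "0 < bary x y z p" and wx: "0 < bary x y z w"
    and ry: "bary x y z p * bary y z x w \<le> bary y z x p * bary x y z w"
    and rz: "bary x y z p * bary z x y w \<le> bary z x y p * bary x y z w"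
    and hw: "h w < interp h x y z w"
  shows "p \<in> convex hull {w, y, z}"
    and "cr (y - w) (z - w) \<noteq> 0 \<Longrightarrow> interp h w y z p < interp h x y z p"
proof -
  \<comment> \<open>The coefficient of \<open>w\<close> that eliminates \<open>x\<close> when
    \<open>p\<close> is rewritten over \<open>w\<close>, \<open>y\<close>, \<open>z\<close>; the
    ratio conditions keep the other two coefficients nonnegative.\<close>
  define t where "t = bary x y z p / bary x y z w"
  have t: "t > 0" unfolding t_def using px wx by simp
  define b where "b = bary y z x p - t * bary y z x w"
  define c where "c = bary z x y p - t * bary z x y w"
  have bc: "b \<ge> 0" "c \<ge> 0"
    unfolding b_def c_def t_def using ry rz wx by (simp_all add: field_simps)
  have a0: "bary x y z p - t * bary x y z w = 0" unfolding t_def using wx by simp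
  have "t * (bary x y z w + bary y z x w + bary z x y w) = t" unfolding bary_sum[OF D] by simp
  then have s: "t + b + c = 1"
    using bary_sum[OF D, of p] a0 unfolding b_def c_def distrib_left by linarith
  have pe: "t *\<^sub>R w + b *\<^sub>R y + c *\<^sub>R z = p"
  proof -
    have "p - t *\<^sub>R w = (bary x y z p *\<^sub>R x + bary y z x p *\<^sub>R y + bary z x y p *\<^sub>R z)
       - t *\<^sub>R (bary x y z w *\<^sub>R x + bary y z x w *\<^sub>R y + bary z x y w *\<^sub>R z)"
      using bary_eq[OF D] by simp
    also have "\<dots> = (bary x y z p - t * bary x y z w) *\<^sub>R x + b *\<^sub>R y + c *\<^sub>R z"
      unfolding b_def c_def by (simp add: algebra_simps)
    finally have "p - t *\<^sub>R w = b *\<^sub>R y + c *\<^sub>R z" unfolding a0 by simp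
    then show ?thesis by (simp add: algebra_simps)
  qed
  show "p \<in> convex hull {w, y, z}"
    using in_hull3I[of t b c w y z] s pe bc t by simp
  assume D': "cr (y - w) (z - w) \<noteq> 0"
  have "interp h w y z p = t * h w + b * h y + c * h z"
    using interp_affine3[OF s, of h w y z w y z] interp_vertex[OF D', of h] pe by metis
  also have "\<dots> < t * interp h x y z w + b * h y + c * h z" using hw t by simp
  also have "\<dots> = interp h x y z p"
    using interp_affine3[OF s, of h x y z w y z] interp_vertex[OF D, of h] pe by metis
  finally show "interp h w y z p < interp h x y z p" .
qed

text \<open>The ratio test: the index with the largest quotient of \<open>m\<close> by
  \<open>l\<close> may leave the triangle. Some quotient is positive because the \<open>m\<close>
  add up to 1.\<close>

lemma min_ratio:
  fixes l1 l2 l3 m1 m2 m3 :: real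
  assumes "l1 > 0" "l2 > 0" "l3 > 0" "m1 + m2 + m3 = 1"
  shows "(m1 > 0 \<and> l1 * m2 \<le> l2 * m1 \<and> l1 * m3 \<le> l3 * m1) \<or>
         (m2 > 0 \<and> l2 * m3 \<le> l3 * m2 \<and> l2 * m1 \<le> l1 * m2) \<or>
         (m3 > 0 \<and> l3 * m1 \<le> l1 * m3 \<and> l3 * m2 \<le> l2 * m3)"
proof -
  define r1 where "r1 = m1 / l1"
  define r2 where "r2 = m2 / l2"
  define r3 where "r3 = m3 / l3"
  have m: "m1 = r1 * l1" "m2 = r2 * l2" "m3 = r3 * l3" unfolding r1_def r2_def r3_def using assms by auto
  have c: "l1 * m2 \<le> l2 * m1 \<longleftrightarrow> r2 \<le> r1" "l1 * m3 \<le> l3 * m1 \<longleftrightarrow> r3 \<le> r1"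
    "l2 * m3 \<le> l3 * m2 \<longleftrightarrow> r3 \<le> r2" "l2 * m1 \<le> l1 * m2 \<longleftrightarrow> r1 \<le> r2"
    "l3 * m1 \<le> l1 * m3 \<longleftrightarrow> r1 \<le> r3" "l3 * m2 \<le> l2 * m3 \<longleftrightarrow> r2 \<le> r3"
    unfolding m using assms by (simp_all add: mult.assoc[symmetric] mult.commute[of _ "_ * _"])
  have p: "m1 > 0 \<longleftrightarrow> r1 > 0" "m2 > 0 \<longleftrightarrow> r2 > 0" "m3 > 0 \<longleftrightarrow> r3 > 0"
    unfolding m using assms by (simp_all add: zero_less_mult_iff)
  have "r1 > 0 \<or> r2 > 0 \<or> r3 > 0" using assms(4) p by linarith
  then show ?thesis unfolding c p by linarith
qed


lemma collinear_hull:
  fixes S :: "'a::euclidean_space set"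
  assumes "collinear S" shows "collinear (convex hull S)"
proof -
  obtain u v where "S \<subseteq> affine hull {u, v}" using assms collinear_affine_hull by blast
  then have "convex hull S \<subseteq> affine hull {u, v}"
    by (simp add: affine_imp_convex hull_minimal)
  then show ?thesis using collinear_affine_hull by blast
qed

text \<open>Among the triangles of \<open>X\<close> that contain \<open>p\<close> (one exists by
  Caratheodory) take one whose interpolated height at \<open>p\<close> is least. A point of
  \<open>X\<close> below its plane could be exchanged for a vertex and would lower that height.
  Since \<open>p\<close> avoids all lines, no such triangle is degenerate and all coordinates of
  \<open>p\<close> are positive.\<close>

lemma lower_triple_cover:
  assumes fin: "finite X" and p: "p \<in> convex hull X"
    and off: "\<And>x y. x \<in> X \<Longrightarrow> y \<in> X \<Longrightarrow> x \<noteq> y \<Longrightarrow> cr (y - x) (p - x) \<noteq> 0"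
    and two: "\<exists>x\<in>X. \<exists>y\<in>X. x \<noteq> y"
    and gen: "\<And>x y z w. {x, y, z, w} \<subseteq> X \<Longrightarrow> cr (y - x) (z - x) \<noteq> 0 \<Longrightarrow> w \<notin> {x, y, z} \<Longrightarrow> h w \<noteq> interp h x y z w"
  shows "\<exists>x y z. lower_triple h X x y z \<and> p \<in> convex hull {x, y, z}"
proof -
  have pX: "p \<notin> X"
  proof
    assume "p \<in> X"
    then obtain y where "y \<in> X" "y \<noteq> p" using two by auto
    then show False using off[of p y] \<open>p \<in> X\<close> by simp
  qed
  have nondeg: "cr (y - x) (z - x) \<noteq> 0" if xyz: "{x, y, z} \<subseteq> X" "p \<in> convex hull {x, y, z}" for x y z
  proof
    assume "cr (y - x) (z - x) = 0"
    then have "collinear {x, y, z}" using cr_collinear by blast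
    then have col: "collinear (convex hull {x, y, z})" by (rule collinear_hull)
    have "x \<noteq> y \<or> x \<noteq> z"
    proof (rule ccontr)
      assume "\<not> (x \<noteq> y \<or> x \<noteq> z)"
      then have "p = x" using xyz(2) by simp
      then show False using pX xyz(1) by blast
    qed
    then obtain v where v: "v \<in> {x, y, z}" "v \<noteq> x" by blast
    have "collinear {x, v, p}"
      by (rule collinear_subset[OF col]) (use v xyz(2) hull_subset[of "{x,y,z}" convex] in auto)
    then show False using off[of x v] v xyz(1) cr_collinear[of x v p] by auto
  qed
  have pos: "0 < bary x y z p" if xyz: "{x, y, z} \<subseteq> X" "p \<in> convex hull {x, y, z}" for x y z
  proof -
    have D: "cr (y - x) (z - x) \<noteq> 0" using nondeg[OF xyz] .
    have "cr (z - y) (p - y) \<noteq> 0" using off[of y z] not_collinear_affine[OF D] xyz by auto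
    then have "bary x y z p \<noteq> 0" using D unfolding bary_def by (simp add: cr_def algebra_simps)
    then show ?thesis using in_triangle_iff[OF D, of p] xyz by simp
  qed
  define Q where "Q = {(x, y, z). {x, y, z} \<subseteq> X \<and> p \<in> convex hull {x, y, z}}"
  have finQ: "finite Q"
    by (rule finite_subset[of _ "X \<times> X \<times> X"]) (auto simp: Q_def fin)
  obtain S where S: "finite S" "S \<subseteq> X" "card S \<le> 3" "p \<in> convex hull S"
    using p unfolding caratheodory[of X] by auto
  have "\<exists>x y z. S = {x, y, z}"
  proof -
    have "S \<noteq> {}" using S by auto
    then have "card S = 1 \<or> card S = 2 \<or> card S = 3" using S(1,3) card_gt_0_iff[of S] by linarith
    then show ?thesis by (auto simp: card_1_singleton_iff card_2_iff card_3_iff)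
  qed
  then have "Q \<noteq> {}" using S unfolding Q_def by auto
  then obtain q where q: "q \<in> Q" "\<And>q'. q' \<in> Q \<Longrightarrow> (\<lambda>(x, y, z). interp h x y z p) q \<le> (\<lambda>(x, y, z). interp h x y z p) q'"
    using arg_min_if_finite[OF finQ, of "\<lambda>(x, y, z). interp h x y z p"] by (meson linorder_not_less)
  obtain x y z where xyz: "q = (x, y, z)" by (cases q)
  have X: "{x, y, z} \<subseteq> X" and ph: "p \<in> convex hull {x, y, z}" using q(1) unfolding xyz Q_def by auto
  have min: "interp h x y z p \<le> interp h u v w p" if "{u, v, w} \<subseteq> X" "p \<in> convex hull {u, v, w}" for u v w
    using q(2)[of "(u, v, w)"] that unfolding xyz Q_def by auto
  have D: "cr (y - x) (z - x) \<noteq> 0" using nondeg[OF X ph] .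
  have D': "cr (z - y) (x - y) \<noteq> 0" "cr (x - z) (y - z) \<noteq> 0" using D cr_cyc[of z y x] cr_cyc(2)[of x z y] by auto
  have perm: "{y, z, x} = {x, y, z}" "{z, x, y} = {x, y, z}" by auto
  have pos3: "0 < bary x y z p" "0 < bary y z x p" "0 < bary z x y p"
    using pos[of x y z] pos[of y z x] pos[of z x y] X ph perm by auto
  have "interp h x y z w < h w" if w: "w \<in> X" "w \<notin> {x, y, z}" for w
  proof (rule ccontr)
    assume "\<not> interp h x y z w < h w"
    moreover have "h w \<noteq> interp h x y z w" using gen[of x y z w] X w D by simp
    ultimately have hw: "h w < interp h x y z w" by simp
    have no: False if "{u, v, v'} \<subseteq> X" "p \<in> convex hull {u, v, v'}" "cr (v - u) (v' - u) \<noteq> 0 \<Longrightarrow> interp h u v v' p < interp h x y z p" for u v v'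
      using min[OF that(1,2)] that(3) nondeg[OF that(1,2)] by simp
    have ph': "p \<in> convex hull {y, z, x}" "p \<in> convex hull {z, x, y}" unfolding perm by (fact ph)+
    have X': "{w, y, z} \<subseteq> X" "{w, z, x} \<subseteq> X" "{w, x, y} \<subseteq> X" using X w by auto
    have cyc: "interp h y z x q = interp h x y z q" "interp h z x y q = interp h x y z q" for q
      by (simp_all add: interp_def)
    have hw': "h w < interp h y z x w" "h w < interp h z x y w" using hw unfolding cyc by simp_all
    from min_ratio[OF pos3, of "bary x y z w" "bary y z x w" "bary z x y w"] bary_sum[OF D, of w]
    consider "0 < bary x y z w" "bary x y z p * bary y z x w \<le> bary y z x p * bary x y z w" "bary x y z p * bary z x y w \<le> bary z x y p * bary x y z w"
      | "0 < bary y z x w" "bary y z x p * bary z x y w \<le> bary z x y p * bary y z x w" "bary y z x p * bary x y z w \<le> bary x y z p * bary y z x w"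
      | "0 < bary z x y w" "bary z x y p * bary x y z w \<le> bary x y z p * bary z x y w" "bary z x y p * bary y z x w \<le> bary y z x p * bary z x y w"
      by blast
    then show False
    proof cases
      case 1
      show False using no[OF X'(1)] exchange_step[OF D ph pos3(1) 1 hw] by blast
    next
      case 2
      show False using no[OF X'(2)] exchange_step[OF D'(1) ph'(1) pos3(2) 2 hw'(1)] unfolding cyc by blast
    next
      case 3
      show False using no[OF X'(3)] exchange_step[OF D'(2) ph'(2) pos3(3) 3 hw'(2)] unfolding cyc by blast
    qed
  qed
  then show ?thesis using X D ph unfolding lower_triple_def by blast
qed

lemma negligible_line:
  assumes "u \<noteq> 0" shows "negligible {p. cr u (p - x) = 0}"
proof -
  define a :: "real^2" where "a = vector [- u$2, u$1]"
  have "a \<noteq> 0" using assms unfolding a_def by (auto simp: vec_eq_iff forall_2)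
  moreover have "cr u (p - x) = a \<bullet> p - a \<bullet> x" for p
    unfolding a_def by (simp add: cr_def inner_vec_def sum_2 algebra_simps)
  then have "{p. cr u (p - x) = 0} = {p. a \<bullet> p = a \<bullet> x}" by simp
  ultimately show ?thesis using negligible_hyperplane by auto
qed

lemma interior_hull_nonempty:
  fixes X :: "(real^2) set"
  assumes "\<not> collinear X"
  shows "interior (convex hull X) \<noteq> {}"
proof -
  obtain x y z where xyz: "x \<in> X" "y \<in> X" "z \<in> X" "cr (y - x) (z - x) \<noteq> 0"
    using assms unfolding collinear_cr_iff by blast
  have "interior (convex hull {x, y, z}) \<noteq> {}"
    using interior_convex_hull_eq_empty[of "{x, y, z}"] not_collinear_affine[OF xyz(4)] by simp
  moreover have "convex hull {x, y, z} \<subseteq> convex hull X" using xyz by (intro hull_mono) auto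
  ultimately show ?thesis using interior_mono by blast
qed

text \<open>\<open>gen\<close> excludes coplanar lifted points, so that lower faces are triangles;
  \<open>cvx\<close> makes the lift strictly convex on \<open>X\<close>, so that no point of
  \<open>X\<close> is missed as a vertex.\<close>

lemma lower_triples_triangulate:
  fixes X :: "(real^2) set"
  assumes fin: "finite X" and nc: "\<not> collinear X"
    and gen: "\<And>x y z w. {x, y, z, w} \<subseteq> X \<Longrightarrow> cr (y - x) (z - x) \<noteq> 0 \<Longrightarrow> w \<notin> {x, y, z} \<Longrightarrow> h w \<noteq> interp h x y z w"
    and cvx: "\<And>x y z w. {x, y, z, w} \<subseteq> X \<Longrightarrow> cr (y - x) (z - x) \<noteq> 0 \<Longrightarrow> w \<notin> {x, y, z} \<Longrightarrow>
        w \<in> convex hull {x, y, z} \<Longrightarrow> h w < interp h x y z w"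
  shows "triangulates {convex hull {x, y, z} | x y z. lower_triple h X x y z} X" (is "triangulates ?T X")
  unfolding triangulates_def triangulation_def
proof (intro conjI ballI allI impI)
  show finT: "finite ?T"
  proof (rule finite_subset)
    show "?T \<subseteq> (\<lambda>(x, y, z). convex hull {x, y, z}) ` (X \<times> X \<times> X)" unfolding lower_triple_def by auto
  qed (use fin in auto)
  have simp2: "2 simplex T" if T: "T \<in> ?T" for T
  proof -
    obtain x y z where "T = convex hull {x, y, z}" "cr (y - x) (z - x) \<noteq> 0"
      using T unfolding lower_triple_def by blast
    then show ?thesis using not_collinear_affine[of y x z] unfolding simplex_def by fastforce
  qed
  then show "\<exists>n. n simplex T" if "T \<in> ?T" for T using that by blast
  show "2 simplex T" if "T \<in> ?T" for T using simp2 that .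
  show "T \<inter> T' face_of T" if TT: "T \<in> ?T \<and> T' \<in> ?T" for T T'
  proof -
    obtain x y z x' y' z' where t: "T = convex hull {x, y, z}" "lower_triple h X x y z" "T' = convex hull {x', y', z'}" "lower_triple h X x' y' z'"
      using TT by blast
    then have D: "cr (y - x) (z - x) \<noteq> 0" unfolding lower_triple_def by blast
    have "\<exists>c\<subseteq>{x, y, z}. T \<inter> T' = convex hull c"
      unfolding t(1,3) lower_triples_meet[OF t(2,4)] by (rule exI[of _ "{x, y, z} \<inter> {x', y', z'}"]) simp
    then show ?thesis
      unfolding t(1) face_of_convex_hull_affine_independent[OF not_collinear_affine(1)[OF D]] .
  qed
  show un: "\<Union> ?T = convex hull X"
  proof
    show "\<Union> ?T \<subseteq> convex hull X"
      unfolding lower_triple_def using hull_mono by blast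
    show "convex hull X \<subseteq> \<Union> ?T"
    proof
      fix p assume p: "p \<in> convex hull X"
      let ?L = "\<Union>((\<lambda>(x, y). {p. cr (y - x) (p - x) = 0}) ` {(x, y) \<in> X \<times> X. x \<noteq> y})"
      have "finite {(x, y) \<in> X \<times> X. x \<noteq> y}" by (rule finite_subset[of _ "X \<times> X"]) (use fin in auto)
      then have negl: "negligible ?L"
        by (intro negligible_Union) (use negligible_line in auto)
      \<comment> \<open>Finitely many lines are negligible, so points off all of them occur
        arbitrarily near \<open>p\<close> in the interior of the hull. These are covered, and a
        finite union of triangles is closed.\<close>
      have "p \<in> closure (\<Union> ?T)"
        unfolding closure_approachable
      proof (intro allI impI)
        fix e :: real assume e: "e > 0"
        have "p \<in> closure (interior (convex hull X))"
          using p closure_subset convex_closure_interior[OF convex_convex_hull interior_hull_nonempty[OF nc]] by blast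
        then obtain q where q: "q \<in> interior (convex hull X)" "dist q p < e"
          using e unfolding closure_approachable by blast
        let ?U = "interior (convex hull X) \<inter> ball p e"
        have "open ?U" "?U \<noteq> {}" using q by (auto simp: dist_commute)
        then have "\<not> ?U \<subseteq> ?L" using negligible_subset[OF negl] open_not_negligible by blast
        then obtain r where r': "r \<in> ?U" "r \<notin> ?L" by (meson subsetI)
        then have r: "r \<in> interior (convex hull X)" "dist p r < e" by simp_all
        have off: "cr (y - x) (r - x) \<noteq> 0" if "x \<in> X" "y \<in> X" "x \<noteq> y" for x y
          using r'(2) that by blast
        have two: "\<exists>x\<in>X. \<exists>y\<in>X. x \<noteq> y"
          using nc unfolding collinear_cr_iff by (metis cr_zero(1))
        have "\<exists>x y z. lower_triple h X x y z \<and> r \<in> convex hull {x, y, z}"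
          by (rule lower_triple_cover[OF fin _ off two gen]) (use r interior_subset in auto)
        then have "r \<in> \<Union> ?T" by blast
        moreover have "dist r p < e" using r(2) by (simp add: dist_commute)
        ultimately show "\<exists>y\<in>\<Union> ?T. dist y p < e" by (rule bexI[rotated])
      qed
      moreover have "closed (\<Union> ?T)" using finT simp2 closed_simplex by (intro closed_Union) auto
      ultimately show "p \<in> \<Union> ?T" by simp
    qed
  qed
  show "{v. \<exists>T\<in>?T. v extreme_point_of T} = X"
  proof (intro equalityI subsetI)
    fix v assume "v \<in> {v. \<exists>T\<in>?T. v extreme_point_of T}"
    then show "v \<in> X" using extreme_point_of_convex_hull unfolding lower_triple_def by blast
  next
    fix v assume v: "v \<in> X"
    then have "v \<in> \<Union> ?T" using un hull_inc by auto
    then obtain x y z where t: "lower_triple h X x y z" "v \<in> convex hull {x, y, z}" by blast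
    then have D: "cr (y - x) (z - x) \<noteq> 0" and X: "{x, y, z} \<subseteq> X" unfolding lower_triple_def by blast+
    have "v \<in> {x, y, z}"
      using cvx[of x y z v] lower_triple_le(1)[OF t(1) v] D X v t(2) by fastforce
    then show "v \<in> {v. \<exists>T\<in>?T. v extreme_point_of T}"
      using extreme_point_of_convex_hull_affine_independent[OF not_collinear_affine(1)[OF D]] t(1) by blast
  qed
qed

text \<open>With heights \<open>g x + t ^ Suc (idx x)\<close>, each coincidence to be avoided is a nonzero polynomial in \<open>t\<close>,
  and strict inequalities for \<open>g\<close> survive for small \<open>t\<close>.\<close>

lemma perturb_heights:
  assumes fin: "finite X"
  shows "\<exists>h. \<forall>x\<in>X. \<forall>y\<in>X. \<forall>z\<in>X. \<forall>w\<in>X - {x, y, z}.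
     h w \<noteq> interp h x y z w \<and> (interp g x y z w < g w \<longrightarrow> interp h x y z w < h w)
     \<and> (g w < interp g x y z w \<longrightarrow> h w < interp h x y z w)"
proof -
  obtain idx :: "real^2 \<Rightarrow> nat" where idx: "inj_on idx X"
    using finite_imp_inj_to_nat_seg[OF fin] by blast
  \<comment> \<open>\<open>Suc\<close> lets every perturbation vanish at \<open>t = 0\<close>, also
    for index 0.\<close>
  define h where "h t x = g x + t ^ Suc (idx x)" for t :: real and x
  define P where "P x y z w = [:g w - interp g x y z w:] + monom 1 (Suc (idx w))
     - monom (bary x y z w) (Suc (idx x)) - monom (bary y z x w) (Suc (idx y)) - monom (bary z x y w) (Suc (idx z))" for x y z w
  have P: "poly (P x y z w) t = h t w - interp (h t) x y z w" for x y z w t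
    unfolding P_def h_def interp_def by (simp add: poly_monom algebra_simps)
  have P0: "poly (P x y z w) 0 = g w - interp g x y z w" for x y z w
    unfolding P_def by (simp add: poly_monom)
  have Pnz: "P x y z w \<noteq> 0" if "x \<in> X" "y \<in> X" "z \<in> X" "w \<in> X - {x, y, z}" for x y z w
  proof -
    have "idx w \<noteq> idx x" "idx w \<noteq> idx y" "idx w \<noteq> idx z" using that idx by (auto dest: inj_onD)
    \<comment> \<open>The exponent belonging to \<open>w\<close> differs from those of
      \<open>x\<close>, \<open>y\<close>, \<open>z\<close> and from 0, so nothing can cancel
      it.\<close>
    then have "coeff (P x y z w) (Suc (idx w)) = 1" unfolding P_def by simp
    then show ?thesis by auto
  qed
  let ?good = "\<lambda>t (x, y, z, w). poly (P x y z w) t \<noteq> 0 \<and> (poly (P x y z w) 0 > 0 \<longrightarrow> poly (P x y z w) t > 0)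
     \<and> (poly (P x y z w) 0 < 0 \<longrightarrow> poly (P x y z w) t < 0)"
  let ?Q = "{(x, y, z, w). x \<in> X \<and> y \<in> X \<and> z \<in> X \<and> w \<in> X - {x, y, z}}"
  have "finite ?Q" by (rule finite_subset[of _ "X \<times> X \<times> X \<times> X"]) (use fin in auto)
  moreover have "\<forall>\<^sub>F t in at_right (0::real). ?good t q" if "q \<in> ?Q" for q
  proof -
    obtain x y z w where q: "q = (x, y, z, w)" by (cases q)
    let ?p = "P x y z w"
    have "finite {t. poly ?p t = 0}" using Pnz that q by (intro poly_roots_finite) auto
    then have "\<forall>\<^sub>F t in at_right (0::real). \<forall>r\<in>{t. poly ?p t = 0}. t \<noteq> r"
      by (intro eventually_ball_finite ballI eventually_neq_at_within) auto
    then have 1: "\<forall>\<^sub>F t in at_right (0::real). poly ?p t \<noteq> 0"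
      by (rule eventually_mono) auto
    have lim: "((\<lambda>t. poly ?p t) \<longlongrightarrow> poly ?p 0) (at_right 0)"
      by (rule tendsto_intros)+
    have 2: "\<forall>\<^sub>F t in at_right (0::real). poly ?p 0 > 0 \<longrightarrow> poly ?p t > 0"
      using order_tendstoD(1)[OF lim, of 0] by (cases "poly ?p 0 > 0") auto
    have 3: "\<forall>\<^sub>F t in at_right (0::real). poly ?p 0 < 0 \<longrightarrow> poly ?p t < 0"
      using order_tendstoD(2)[OF lim, of 0] by (cases "poly ?p 0 < 0") auto
    show ?thesis unfolding q using 1 2 3 by eventually_elim simp
  qed
  ultimately have "\<forall>\<^sub>F t in at_right (0::real). \<forall>q\<in>?Q. ?good t q"
    by (intro eventually_ball_finite ballI)
  then obtain t where t: "\<forall>q\<in>?Q. ?good t q"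
    using eventually_happens' trivial_limit_at_right_real by blast
  show ?thesis
  proof (intro exI[of _ "h t"] ballI)
    fix x y z w assume "x \<in> X" "y \<in> X" "z \<in> X" "w \<in> X - {x, y, z}"
    then have "?good t (x, y, z, w)" using t by blast
    then show "h t w \<noteq> interp (h t) x y z w \<and> (interp g x y z w < g w \<longrightarrow> interp (h t) x y z w < h t w)
     \<and> (g w < interp g x y z w \<longrightarrow> h t w < interp (h t) x y z w)"
      unfolding split_conv P0 unfolding P by auto
  qed
qed

text \<open>The gap is the variance of the vertices about \<open>w\<close>: the average of their
  squared distances with the coordinates of \<open>w\<close> as weights.\<close>

lemma interp_square_strict:
  assumes D: "cr (y - x) (z - x) \<noteq> 0" and w: "w \<in> convex hull {x, y, z}" "w \<notin> {x, y, z}"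
  shows "w \<bullet> w < interp (\<lambda>p. p \<bullet> p) x y z w"
proof -
  define a where "a = bary x y z w"
  define b where "b = bary y z x w"
  define c where "c = bary z x y w"
  have n: "0 \<le> a" "0 \<le> b" "0 \<le> c" using in_triangle_iff[OF D] w unfolding a_def b_def c_def by auto
  have s: "a + b + c = 1" unfolding a_def b_def c_def by (rule bary_sum[OF D])
  have e: "a *\<^sub>R x + b *\<^sub>R y + c *\<^sub>R z = w" unfolding a_def b_def c_def by (rule bary_eq[OF D])
  have sq: "(p - w) \<bullet> (p - w) = p \<bullet> p - 2 * (p \<bullet> w) + w \<bullet> w" for p
    by (simp add: inner_diff_left inner_diff_right inner_commute)
  have "a * (x \<bullet> w) + b * (y \<bullet> w) + c * (z \<bullet> w) = (a *\<^sub>R x + b *\<^sub>R y + c *\<^sub>R z) \<bullet> w"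
    by (simp add: inner_add_left)
  also have "\<dots> = w \<bullet> w" unfolding e ..
  finally have ww: "a * (x \<bullet> w) + b * (y \<bullet> w) + c * (z \<bullet> w) = w \<bullet> w" .
  have "a * ((x - w) \<bullet> (x - w)) + b * ((y - w) \<bullet> (y - w)) + c * ((z - w) \<bullet> (z - w))
     = (a * (x \<bullet> x) + b * (y \<bullet> y) + c * (z \<bullet> z)) - 2 * (a * (x \<bullet> w) + b * (y \<bullet> w) + c * (z \<bullet> w)) + (a + b + c) * (w \<bullet> w)"
    unfolding sq by (simp add: algebra_simps)
  also have "\<dots> = interp (\<lambda>p. p \<bullet> p) x y z w - w \<bullet> w"
    unfolding ww s unfolding interp_def a_def b_def c_def by simp
  finally have eq: "interp (\<lambda>p. p \<bullet> p) x y z w - w \<bullet> w =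
     a * ((x - w) \<bullet> (x - w)) + b * ((y - w) \<bullet> (y - w)) + c * ((z - w) \<bullet> (z - w))" by simp
  have p: "0 < (x - w) \<bullet> (x - w)" "0 < (y - w) \<bullet> (y - w)" "0 < (z - w) \<bullet> (z - w)" using w(2) by auto
  have "0 \<le> a * ((x - w) \<bullet> (x - w))" "0 \<le> b * ((y - w) \<bullet> (y - w))" "0 \<le> c * ((z - w) \<bullet> (z - w))"
    using p n by simp_all
  moreover have "0 < a * ((x - w) \<bullet> (x - w)) \<or> 0 < b * ((y - w) \<bullet> (y - w)) \<or> 0 < c * ((z - w) \<bullet> (z - w))"
    using p n s by (auto simp: zero_less_mult_iff)
  ultimately show ?thesis using eq by linarith
qed

lemma max_combination:
  fixes a b c u v w :: real
  assumes "0 \<le> a" "0 \<le> b" "0 \<le> c"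
  shows "max 0 (- (a * u + b * v + c * w)) \<le> a * max 0 (- u) + b * max 0 (- v) + c * max 0 (- w)"
proof -
  have "a * (- u) \<le> a * max 0 (- u)" "b * (- v) \<le> b * max 0 (- v)" "c * (- w) \<le> c * max 0 (- w)"
    using assms by (intro mult_left_mono; simp)+
  moreover have "0 \<le> a * max 0 (- u)" "0 \<le> b * max 0 (- v)" "0 \<le> c * max 0 (- w)" using assms by auto
  ultimately show ?thesis by simp
qed

text \<open>The height is \<open>K * \<phi> p + p \<bullet> p\<close>, slightly perturbed. The
  function \<phi> adds up the negative parts of the three coordinates: it is convex, 0 on the
  triangle and positive at all other points of \<open>X\<close>, so a large \<open>K\<close> turns
  the triangle into a lower face. The square makes the convexity strict.\<close>

lemma triangulation_extends:
  fixes X :: "(real^2) set"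
  assumes fin: "finite X" and abc: "{a, b, c} \<subseteq> X" "cr (b - a) (c - a) \<noteq> 0" "X \<inter> convex hull {a, b, c} = {a, b, c}"
  shows "\<exists>\<T>. triangulates \<T> X \<and> convex hull {a, b, c} \<in> \<T>"
proof -
  note D = abc(2)
  have D': "cr (c - b) (a - b) \<noteq> 0" "cr (a - c) (b - c) \<noteq> 0" using D cr_cyc[of c b a] cr_cyc(2)[of a c b] by auto
  have nc: "\<not> collinear X" using abc(1,2) unfolding collinear_cr_iff by blast
  let ?sq = "\<lambda>p::real^2. p \<bullet> p"
  define \<phi> where "\<phi> p = max 0 (- bary a b c p) + max 0 (- bary b c a p) + max 0 (- bary c a b p)" for p
  have \<phi>0: "\<phi> a = 0" "\<phi> b = 0" "\<phi> c = 0"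
    unfolding \<phi>_def bary_vertex[OF D] bary_vertex[OF D'(1)] bary_vertex[OF D'(2)] by simp_all
  have \<phi>pos: "\<phi> p > 0" if "p \<in> X - {a, b, c}" for p
  proof -
    have "p \<notin> convex hull {a, b, c}" using that abc(3) by blast
    then show ?thesis unfolding in_triangle_iff[OF D] \<phi>_def by auto
  qed
  have \<phi>cvx: "\<phi> w \<le> interp \<phi> x y z w" if Dx: "cr (y - x) (z - x) \<noteq> 0" and w: "w \<in> convex hull {x, y, z}" for x y z w
  proof -
    have n: "0 \<le> bary x y z w" "0 \<le> bary y z x w" "0 \<le> bary z x y w" using in_triangle_iff[OF Dx] w by auto
    have e: "bary u v u' w = bary x y z w * bary u v u' x + bary y z x w * bary u v u' y + bary z x y w * bary u v u' z" for u v u'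
      using bary_affine3[OF bary_sum[OF Dx, of w], of u v u' x y z] unfolding bary_eq[OF Dx] .
    have m: "max 0 (- bary u v u' w) \<le> bary x y z w * max 0 (- bary u v u' x) + bary y z x w * max 0 (- bary u v u' y) + bary z x y w * max 0 (- bary u v u' z)" for u v u'
      unfolding e[of u v u'] by (rule max_combination[OF n])
    show ?thesis using m[of a b c] m[of b c a] m[of c a b] unfolding \<phi>_def interp_def distrib_left by linarith
  qed
  define W where "W = X - {a, b, c}"
  \<comment> \<open>Chosen to exceed every single quotient, so that each remaining point is lifted
    above the plane over the triangle. \<open>max 0\<close> makes every term at most the sum, and
    the 1 makes the comparison strict.\<close>
  define K where "K = 1 + (\<Sum>w\<in>W. max 0 ((interp ?sq a b c w - w \<bullet> w) / \<phi> w))"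
  have finW: "finite W" using fin unfolding W_def by simp
  have K: "K \<ge> 0" unfolding K_def by (simp add: sum_nonneg add_nonneg_nonneg)
  have Kw: "interp ?sq a b c w < K * \<phi> w + w \<bullet> w" if "w \<in> W" for w
  proof -
    have "max 0 ((interp ?sq a b c w - w \<bullet> w) / \<phi> w) \<le> (\<Sum>w\<in>W. max 0 ((interp ?sq a b c w - w \<bullet> w) / \<phi> w))"
      using that finW by (intro member_le_sum) auto
    then have "(interp ?sq a b c w - w \<bullet> w) / \<phi> w < K" unfolding K_def by simp
    moreover have "\<phi> w > 0" using \<phi>pos that unfolding W_def by simp
    ultimately show ?thesis by (simp add: field_simps)
  qed
  define g where "g p = K * \<phi> p + p \<bullet> p" for p
  have ig: "interp g x y z w = K * interp \<phi> x y z w + interp ?sq x y z w" for x y z w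
    unfolding g_def interp_def by (simp add: algebra_simps)
  obtain h where h: "\<forall>x\<in>X. \<forall>y\<in>X. \<forall>z\<in>X. \<forall>w\<in>X - {x, y, z}.
     h w \<noteq> interp h x y z w \<and> (interp g x y z w < g w \<longrightarrow> interp h x y z w < h w)
     \<and> (g w < interp g x y z w \<longrightarrow> h w < interp h x y z w)"
    using perturb_heights[OF fin, of g] by blast
  have "triangulates {convex hull {x, y, z} | x y z. lower_triple h X x y z} X"
  proof (rule lower_triples_triangulate[OF fin nc])
    show "h w \<noteq> interp h x y z w" if "{x, y, z, w} \<subseteq> X" "cr (y - x) (z - x) \<noteq> 0" "w \<notin> {x, y, z}" for x y z w
      using h that by simp
    show "h w < interp h x y z w" if "{x, y, z, w} \<subseteq> X" "cr (y - x) (z - x) \<noteq> 0" "w \<notin> {x, y, z}"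
        "w \<in> convex hull {x, y, z}" for x y z w
    proof -
      have "g w < interp g x y z w"
        unfolding ig unfolding g_def
        using mult_left_mono[OF \<phi>cvx[OF that(2,4)] K] interp_square_strict[OF that(2,4,3)] by linarith
      then show ?thesis using h that by simp
    qed
  qed
  moreover have "lower_triple h X a b c"
  proof -
    have "interp h a b c w < h w" if w: "w \<in> X - {a, b, c}" for w
    proof -
      have "interp \<phi> a b c w = 0" unfolding interp_def \<phi>0 by simp
      then have "interp g a b c w < g w" using Kw[of w] w unfolding ig unfolding g_def W_def by simp
      then show ?thesis using h w abc(1) by simp
    qed
    then show ?thesis using abc(1) D unfolding lower_triple_def by blast
  qed
  ultimately show ?thesis by blast
qed

section \<open>Empty triangles and existence of triangulations\<close>

lemma subtriangle:
  assumes D: "cr (y - x) (z - x) \<noteq> 0" and u: "u \<in> convex hull {x, y, z}" "u \<noteq> z"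
  shows "convex hull {x, y, u} \<subseteq> convex hull {x, y, z}" "z \<notin> convex hull {x, y, u}"
proof -
  show "convex hull {x, y, u} \<subseteq> convex hull {x, y, z}"
    by (rule hull_minimal) (use u(1) hull_subset[of "{x, y, z}" convex] in auto)
  have D': "cr (x - z) (y - z) \<noteq> 0" using D cr_cyc(2)[of x z y] by auto
  have perm: "{z, x, y} = {x, y, z}" by auto
  have "bary z x y u \<noteq> 1" using vertex_bary_iff[OF D', of u] u unfolding perm by auto
  then have less: "bary z x y u < 1" using bary_le_1[OF D', of u] u unfolding perm by auto
  show "z \<notin> convex hull {x, y, u}"
  proof
    assume "z \<in> convex hull {x, y, u}"
    then obtain a b c where abc: "0 \<le> a" "0 \<le> b" "0 \<le> c" "a + b + c = 1" "z = a *\<^sub>R x + b *\<^sub>R y + c *\<^sub>R u"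
      by (auto simp: convex_hull_3)
    have "bary z x y z = c * bary z x y u"
      unfolding abc(5)[THEN arg_cong, of "bary z x y"]
      using bary_affine3[OF abc(4), of z x y x y u] bary_vertex[OF D'] abc(5) by simp
    then have e: "1 = c * bary z x y u" using bary_vertex(1)[OF D'] by simp
    have "c \<le> 1" using abc by linarith
    moreover have "0 \<le> bary z x y u" using in_triangle_iff[OF D] u(1) by simp
    ultimately have "c * bary z x y u \<le> bary z x y u" by (simp add: mult_left_le_one_le abc(3))
    then show False using e less by linarith
  qed
qed

text \<open>Descent on the apex: a further point \<open>u\<close> in the triangle is off the line
  \<open>x y\<close>, since the edge carries no other point, and with \<open>u\<close> as apex the
  triangle loses the old apex.\<close>

lemma empty_triangle_on_edge:
  fixes X :: "(real^2) set"
  assumes fin: "finite X" and xy: "x \<in> X" "y \<in> X" "X \<inter> closed_segment x y = {x, y}"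
    and z: "z \<in> X" "cr (y - x) (z - x) \<noteq> 0"
  shows "\<exists>s\<in>X. cr (y - x) (s - x) \<noteq> 0 \<and> s \<in> convex hull {x, y, z} \<and> X \<inter> convex hull {x, y, s} = {x, y, s}"
  using z
proof (induction "card (X \<inter> convex hull {x, y, z})" arbitrary: z rule: less_induct)
  case less
  show ?case
  proof (cases "X \<inter> convex hull {x, y, z} = {x, y, z}")
    case True
    then show ?thesis using less.prems by blast
  next
    case False
    then obtain u where u: "u \<in> X" "u \<in> convex hull {x, y, z}" "u \<notin> {x, y, z}"
      using less.prems xy hull_subset[of "{x, y, z}" convex] by blast
    note sub = subtriangle[OF less.prems(2) u(2)]
    have D: "cr (y - x) (u - x) \<noteq> 0"
    proof
      assume e: "cr (y - x) (u - x) = 0"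
      have "bary z x y u = 0" unfolding bary_def using e by (simp add: cr_def algebra_simps)
      then have "u = bary x y z u *\<^sub>R x + bary y z x u *\<^sub>R y" "bary x y z u + bary y z x u = 1"
        "0 \<le> bary x y z u" "0 \<le> bary y z x u"
        using bary_eq[OF less.prems(2), of u] bary_sum[OF less.prems(2), of u] in_triangle_iff[OF less.prems(2)] u by auto
      then have "u \<in> convex hull {x, y}" unfolding convex_hull_2 by blast
      then show False using u xy(3) by (auto simp: segment_convex_hull)
    qed
    have "X \<inter> convex hull {x, y, u} \<subset> X \<inter> convex hull {x, y, z}"
      using sub u less.prems hull_inc[of z "{x, y, z}" convex] by auto
    then have "card (X \<inter> convex hull {x, y, u}) < card (X \<inter> convex hull {x, y, z})"
      using fin by (intro psubset_card_mono) auto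
    from less.hyps[OF this u(1) D] show ?thesis using sub(1) u(3) by auto
  qed
qed

text \<open>Taking \<open>y\<close> nearest to \<open>x\<close> gives an edge without further
  points, from which \<open>empty_triangle_on_edge\<close> starts.\<close>

lemma empty_triangle_exists:
  fixes X :: "(real^2) set"
  assumes fin: "finite X" and nc: "\<not> collinear X"
  obtains x y z where "{x, y, z} \<subseteq> X" "cr (y - x) (z - x) \<noteq> 0" "X \<inter> convex hull {x, y, z} = {x, y, z}"
proof -
  obtain x where x: "x \<in> X" using nc by (metis collinear_empty ex_in_conv)
  have "X - {x} \<noteq> {}" using nc by (metis Diff_eq_empty_iff collinear_sing subset_singletonD collinear_empty)
  then obtain y where y: "y \<in> X - {x}" "\<And>u. u \<in> X - {x} \<Longrightarrow> dist x y \<le> dist x u"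
    using arg_min_if_finite[of "X - {x}" "dist x"] fin by (metis finite_Diff linorder_not_less)
  have seg: "X \<inter> closed_segment x y = {x, y}"
  proof -
    have "u = y" if u: "u \<in> X" "u \<in> closed_segment x y" "u \<noteq> x" for u
    proof (rule ccontr)
      assume "u \<noteq> y"
      then have "u \<in> open_segment x y" using u by (simp add: open_segment_def)
      then have "dist x u < dist x y" using dist_in_open_segment(1)[of u x y] by (simp add: dist_commute)
      then show False using y(2)[of u] u by simp
    qed
    then show ?thesis using x y by auto
  qed
  have "\<exists>z\<in>X. cr (y - x) (z - x) \<noteq> 0" using point_off_line[OF nc, of x y] y by blast
  then obtain z where z: "z \<in> X" "cr (y - x) (z - x) \<noteq> 0" by blast
  have yX: "y \<in> X" using y by simp
  obtain s where s: "s \<in> X" "cr (y - x) (s - x) \<noteq> 0" "X \<inter> convex hull {x, y, s} = {x, y, s}"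
    using empty_triangle_on_edge[OF fin x yX seg z] by (elim bexE conjE)
  show ?thesis by (rule that[OF _ s(2,3)]) (use x yX s in simp)
qed

lemma triangulation_exists:
  fixes X :: "(real^2) set"
  assumes "finite X" "\<not> collinear X"
  shows "\<exists>\<T>. triangulates \<T> X"
proof -
  obtain x y z where "{x, y, z} \<subseteq> X" "cr (y - x) (z - x) \<noteq> 0" "X \<inter> convex hull {x, y, z} = {x, y, z}"
    by (rule empty_triangle_exists[OF assms])
  from triangulation_extends[OF assms(1) this] show ?thesis by (elim exE conjE) (rule exI)
qed

lemma tr_triangulates:
  assumes "finite X" "\<not> collinear X"
  shows "\<exists>\<T>. triangulates \<T> X \<and> tr X = card \<T>"
  unfolding tr_def using someI_ex[OF triangulation_exists[OF assms]] by blast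

lemma tr_eq:
  assumes "finite X" "\<not> collinear X" "generic d X"
  shows "tr X = (\<Sum>x\<in>X. wt d (convex hull X) x)"
proof -
  obtain \<T> where T: "triangulates \<T> X" "tr X = card \<T>"
    using tr_triangulates[OF assms(1,2)] by (elim exE conjE)
  show ?thesis unfolding T(2) by (rule card_triangulation[OF T(1) assms(3,1)])
qed

section \<open>The inequality\<close>

text \<open>Halving the sums brings them back into the common hull, where the triangulation used for
  \<open>A\<close> and \<open>B\<close> also counts them.\<close>

definition midpoints :: "(real^2) set \<Rightarrow> (real^2) set \<Rightarrow> (real^2) set" where
  "midpoints A B = (\<lambda>(a, b). midpoint a b) ` (A \<times> B)"

lemma finite_midpoints: "finite A \<Longrightarrow> finite B \<Longrightarrow> finite (midpoints A B)"
  by (simp add: midpoints_def)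

lemma midpointsI: "a \<in> A \<Longrightarrow> b \<in> B \<Longrightarrow> midpoint a b \<in> midpoints A B"
  by (auto simp: midpoints_def)

lemma midpoints_eq_sum: "A + B = (\<lambda>m. 2 *\<^sub>R m) ` midpoints A B"
proof -
  have e: "(\<lambda>x. 2 *\<^sub>R (case x of (a, b) \<Rightarrow> midpoint a b)) = (\<lambda>(a, b). a + b :: real^2)"
    by (auto simp: midpoint_def fun_eq_iff)
  show ?thesis unfolding midpoints_def image_image e by (auto simp: set_plus_def)
qed

lemma hull_double:
  fixes A B :: "(real^2) set"
  assumes "convex hull A = convex hull B"
  shows "convex hull (A + B) = (\<lambda>p. 2 *\<^sub>R p) ` (convex hull A)"
proof
  show "convex hull (A + B) \<subseteq> (\<lambda>p. 2 *\<^sub>R p) ` (convex hull A)"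
  proof
    fix p assume "p \<in> convex hull (A + B)"
    then obtain a b where ab: "a \<in> convex hull A" "b \<in> convex hull A" "p = a + b"
      unfolding convex_hull_set_plus assms by (auto simp: set_plus_def)
    then have "midpoint a b \<in> convex hull A"
      by (meson convex_contains_segment convex_convex_hull midpoint_in_closed_segment subsetD)
    moreover have "p = 2 *\<^sub>R midpoint a b" using ab by (simp add: midpoint_def)
    ultimately show "p \<in> (\<lambda>p. 2 *\<^sub>R p) ` (convex hull A)" by blast
  qed
  show "(\<lambda>p. 2 *\<^sub>R p) ` (convex hull A) \<subseteq> convex hull (A + B)"
  proof
    fix p assume "p \<in> (\<lambda>p. 2 *\<^sub>R p) ` (convex hull A)"
    then obtain q where q: "q \<in> convex hull A" "p = q + q" by (metis imageE scaleR_2)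
    then show "p \<in> convex hull (A + B)" unfolding convex_hull_set_plus using assms by blast
  qed
qed

text \<open>Only the length of the segment changes under dilation, so a sum has in the doubled hull
  the weight that its half has in the hull.\<close>

lemma enters_double: "enters d ((\<lambda>p. 2 *\<^sub>R p) ` S) (2 *\<^sub>R q) \<longleftrightarrow> enters d S q"
proof -
  have mem: "2 *\<^sub>R p \<in> (\<lambda>p. 2 *\<^sub>R p) ` S \<longleftrightarrow> p \<in> S" for p by auto
  have "(\<exists>s>0. 2 *\<^sub>R q + s *\<^sub>R d \<in> (\<lambda>p. 2 *\<^sub>R p) ` S) \<longleftrightarrow> (\<exists>s>0. q + s *\<^sub>R d \<in> S)"
  proof
    assume "\<exists>s>0. 2 *\<^sub>R q + s *\<^sub>R d \<in> (\<lambda>p. 2 *\<^sub>R p) ` S"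
    then obtain s where s: "s > 0" "2 *\<^sub>R q + s *\<^sub>R d \<in> (\<lambda>p. 2 *\<^sub>R p) ` S" by blast
    moreover have "2 *\<^sub>R q + s *\<^sub>R d = 2 *\<^sub>R (q + (s / 2) *\<^sub>R d)" by (simp add: scaleR_add_right)
    ultimately have "q + (s / 2) *\<^sub>R d \<in> S" using mem by simp
    then show "\<exists>s>0. q + s *\<^sub>R d \<in> S" using s by (intro exI[of _ "s / 2"]) simp
  next
    assume "\<exists>s>0. q + s *\<^sub>R d \<in> S"
    then obtain s where s: "s > 0" "q + s *\<^sub>R d \<in> S" by blast
    have "2 *\<^sub>R q + (2 * s) *\<^sub>R d = 2 *\<^sub>R (q + s *\<^sub>R d)" by (simp add: scaleR_add_right)
    then show "\<exists>s>0. 2 *\<^sub>R q + s *\<^sub>R d \<in> (\<lambda>p. 2 *\<^sub>R p) ` S" using s mem by (intro exI[of _ "2 * s"]) simp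
  qed
  then show ?thesis unfolding enters_def mem by blast
qed

lemma not_collinear_sum:
  fixes A B :: "(real^2) set"
  assumes "\<not> collinear A" "B \<noteq> {}"
  shows "\<not> collinear (A + B)"
proof -
  obtain b where b: "b \<in> B" using assms by blast
  obtain x y z where xyz: "x \<in> A" "y \<in> A" "z \<in> A" "cr (y - x) (z - x) \<noteq> 0"
    using assms(1) unfolding collinear_cr_iff by blast
  then have m: "x + b \<in> A + B" "y + b \<in> A + B" "z + b \<in> A + B" using b by auto
  show ?thesis
  proof
    assume "collinear (A + B)"
    then have "cr ((y + b) - (x + b)) ((z + b) - (x + b)) = 0" using m unfolding collinear_cr_iff by blast
    then show False using xyz by simp
  qed
qed

lemma tr_sum_midpoints:
  fixes A B :: "(real^2) set"
  assumes fin: "finite A" "finite B" and nc: "\<not> collinear A" "\<not> collinear B"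
    and hull: "convex hull A = convex hull B" and g: "generic d (A + B)"
  shows "tr (A + B) = (\<Sum>m\<in>midpoints A B. wt d (convex hull A) m)"
proof -
  have "finite (A + B)" using fin by (simp add: finite_set_plus)
  moreover have "\<not> collinear (A + B)" by (rule not_collinear_sum[OF nc(1)]) (use nc(2) in auto)
  ultimately have "tr (A + B) = (\<Sum>y\<in>A + B. wt d (convex hull (A + B)) y)" using g by (rule tr_eq)
  also have "\<dots> = (\<Sum>m\<in>midpoints A B. wt d (convex hull (A + B)) (2 *\<^sub>R m))"
    unfolding midpoints_eq_sum[of A B] by (subst sum.reindex) (auto intro: inj_onI)
  also have "\<dots> = (\<Sum>m\<in>midpoints A B. wt d (convex hull A) m)"
    unfolding hull_double[OF hull] wt_def enters_double ..
  finally show ?thesis .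
qed

text \<open>The extreme points of the common hull lie in both sets, and by Krein-Milman they span
  it.\<close>

lemma hull_inter:
  fixes A B :: "(real^2) set"
  assumes fin: "finite A" "finite B" and hull: "convex hull A = convex hull B"
  shows "convex hull (A \<inter> B) = convex hull A"
proof
  show "convex hull (A \<inter> B) \<subseteq> convex hull A" by (simp add: hull_mono)
  have "convex hull A = convex hull {x. x extreme_point_of (convex hull A)}"
    using fin by (intro Krein_Milman_Minkowski) (auto simp: finite_imp_compact_convex_hull)
  moreover have "{x. x extreme_point_of (convex hull A)} \<subseteq> A \<inter> B"
    using extreme_point_of_convex_hull[of _ A] extreme_point_of_convex_hull[of _ B] hull by auto
  ultimately show "convex hull A \<subseteq> convex hull (A \<inter> B)" using hull_mono by metis
qed

lemma midpoints_local:
  fixes A B :: "(real^2) set"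
  assumes T: "triangulates \<T> (A \<inter> B)" "T \<in> \<T>" and fin: "finite A" "finite B" and g: "generic d (A \<inter> B)"
  shows "2 * (\<Sum>a\<in>A \<inter> T. wt d T a) + 2 * (\<Sum>b\<in>B \<inter> T. wt d T b) + 2 * card (A \<inter> T - B) + 2 * card (B \<inter> T - A)
    \<le> (\<Sum>m\<in>midpoints A B \<inter> T. wt d T m)"
proof -
  obtain x y z where xyz: "{x, y, z} \<subseteq> A \<inter> B" "cr (y - x) (z - x) \<noteq> 0" "T = convex hull {x, y, z}"
    by (rule triangulates_triangle[OF T])
  have V: "A \<inter> B \<inter> T = {x, y, z}"
    using triangulates_vertices[OF T(1) _ xyz(2)] T(2) xyz(3) by simp
  have gg: "generic d {x, y, z}" by (rule generic_subset[OF g xyz(1)])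
  have mid: "midpoint a b \<in> midpoints A B \<inter> T" if "a \<in> A \<inter> T" "b \<in> B \<inter> T" for a b
  proof
    show "midpoint a b \<in> midpoints A B" using that by (intro midpointsI) auto
    have "convex T" unfolding xyz(3) by simp
    then show "midpoint a b \<in> T" using that by (meson IntD2 convex_contains_segment midpoint_in_closed_segment subsetD)
  qed
  have "2 * (\<Sum>a\<in>A \<inter> T. wt d (convex hull {x, y, z}) a) + 2 * (\<Sum>b\<in>B \<inter> T. wt d (convex hull {x, y, z}) b)
     + 2 * card (A \<inter> T - {x, y, z}) + 2 * card (B \<inter> T - {x, y, z}) \<le> (\<Sum>m\<in>midpoints A B \<inter> T. wt d (convex hull {x, y, z}) m)"
    by (rule local_inequality[OF xyz(2) gg _ _ _ _ _ _ _ _ mid])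
       (use fin V xyz(3) finite_midpoints[OF fin] in auto)
  moreover have "A \<inter> T - {x, y, z} = A \<inter> T - B" "B \<inter> T - {x, y, z} = B \<inter> T - A" using V by auto
  ultimately show ?thesis unfolding xyz(3)[symmetric] by simp
qed

text \<open>One triangulation of \<open>A \<inter> B\<close> and one direction generic for all three
  sets serve every count. For \<open>A \<noteq> B\<close> a point in only one of the sets lies in
  some triangle and makes its surplus positive.\<close>

theorem tr_sum_ge:
  fixes A B :: "(real^2) set"
  assumes fin: "finite A" "finite B" and nc: "\<not> collinear A" "\<not> collinear B"
    and hull: "convex hull A = convex hull B"
  shows "2 * tr A + 2 * tr B \<le> tr (A + B)" and "A \<noteq> B \<Longrightarrow> 2 * tr A + 2 * tr B < tr (A + B)"
proof -
  let ?C = "A \<inter> B"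
  have hC: "convex hull ?C = convex hull A" by (rule hull_inter[OF fin hull])
  have finC: "finite ?C" using fin by simp
  have ncC: "\<not> collinear ?C"
  proof
    assume "collinear ?C"
    then have "collinear (convex hull A)" using collinear_hull[of ?C] hC by simp
    then show False using nc(1) collinear_subset hull_subset by metis
  qed
  obtain \<T> where T: "triangulates \<T> ?C" using triangulation_exists[OF finC ncC] by (elim exE)
  have finT: "finite \<T>" and un: "\<Union>\<T> = convex hull A"
    using T hC unfolding triangulates_def triangulation_def by auto
  obtain d where d: "generic d (A \<union> B \<union> (A + B))"
    using generic_exists[of "A \<union> B \<union> (A + B)"] fin by (auto simp: finite_set_plus)
  then have g: "generic d A" "generic d B" "generic d ?C" "generic d (A + B)" by (auto intro: generic_subset)
  have trA: "tr A = (\<Sum>T\<in>\<T>. \<Sum>a\<in>A \<inter> T. wt d T a)"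
    unfolding tr_eq[OF fin(1) nc(1) g(1)] hC[symmetric] by (rule wt_sum_local[OF T g(3) fin(1)])
  have trB: "tr B = (\<Sum>T\<in>\<T>. \<Sum>a\<in>B \<inter> T. wt d T a)"
    unfolding tr_eq[OF fin(2) nc(2) g(2)] hull[symmetric] hC[symmetric] by (rule wt_sum_local[OF T g(3) fin(2)])
  have trAB: "tr (A + B) = (\<Sum>T\<in>\<T>. \<Sum>a\<in>midpoints A B \<inter> T. wt d T a)"
    unfolding tr_sum_midpoints[OF fin nc hull g(4)] hC[symmetric]
    by (rule wt_sum_local[OF T g(3) finite_midpoints[OF fin]])
  let ?e = "\<lambda>T. 2 * card (A \<inter> T - B) + 2 * card (B \<inter> T - A)"
  have "(\<Sum>T\<in>\<T>. 2 * (\<Sum>a\<in>A \<inter> T. wt d T a) + 2 * (\<Sum>a\<in>B \<inter> T. wt d T a) + ?e T) \<le> tr (A + B)"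
    unfolding trAB using midpoints_local[OF T _ fin g(3)] by (intro sum_mono) (simp add: add.assoc)
  then have ge: "2 * tr A + 2 * tr B + (\<Sum>T\<in>\<T>. ?e T) \<le> tr (A + B)"
    unfolding trA trB sum.distrib sum_distrib_left by simp
  then show "2 * tr A + 2 * tr B \<le> tr (A + B)" by simp
  assume "A \<noteq> B"
  then obtain p where p: "p \<in> (A - B) \<union> (B - A)" by blast
  have "A \<subseteq> convex hull A" "B \<subseteq> convex hull A" using hull_subset[of A convex] hull_subset[of B convex] hull by auto
  then have "p \<in> \<Union>\<T>" using p un by blast
  then obtain T' where T': "T' \<in> \<T>" "p \<in> T'" by blast
  have "A \<inter> T' - B \<noteq> {} \<or> B \<inter> T' - A \<noteq> {}" using p T' by blast
  then have "?e T' > 0" using fin by (auto simp: card_gt_0_iff)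
  moreover have "?e T' \<le> (\<Sum>T\<in>\<T>. ?e T)" by (rule member_le_sum) (use T' finT in auto)
  ultimately show "2 * tr A + 2 * tr B < tr (A + B)" using ge by linarith
qed

section \<open>Equality for A = B as a condition on empty triangles\<close>

text \<open>Refers to all empty triangles rather than to a triangulation, which is what makes
  \<open>rigid_delete\<close> true.\<close>

definition rigid :: "(real^2) set \<Rightarrow> bool" where
  "rigid A \<longleftrightarrow> (\<forall>x y z. {x, y, z} \<subseteq> A \<longrightarrow> cr (y - x) (z - x) \<noteq> 0 \<longrightarrow> A \<inter> convex hull {x, y, z} = {x, y, z} \<longrightarrow>
     (\<forall>a\<in>A. \<forall>b\<in>A. midpoint a b \<in> convex hull {x, y, z} \<longrightarrow> midpoint a b \<in> six x y z))"

text \<open>Each triangle contains its six points and so contributes at least 4. Any other midpoint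
  in it has weight at least 1, so the total is minimal exactly when there is none.\<close>

lemma doubling_iff_six:
  assumes fin: "finite A" and nc: "\<not> collinear A" and T: "triangulates \<T> A"
  shows "tr (A + A) = 4 * tr A \<longleftrightarrow>
    (\<forall>x y z. {x, y, z} \<subseteq> A \<longrightarrow> cr (y - x) (z - x) \<noteq> 0 \<longrightarrow> convex hull {x, y, z} \<in> \<T> \<longrightarrow>
     midpoints A A \<inter> convex hull {x, y, z} \<subseteq> six x y z)" (is "_ \<longleftrightarrow> ?r")
proof -
  have finT: "finite \<T>" and un: "\<Union>\<T> = convex hull A"
    using T unfolding triangulates_def triangulation_def by auto
  obtain d where d: "generic d (A \<union> (A + A))"
    using generic_exists[of "A \<union> (A + A)"] fin by (auto simp: finite_set_plus)
  then have g: "generic d A" "generic d (A + A)" by (auto intro: generic_subset)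
  define S where "S T = (\<Sum>m\<in>midpoints A A \<inter> T. wt d T m)" for T
  have tr2: "tr (A + A) = (\<Sum>T\<in>\<T>. S T)"
    unfolding S_def tr_sum_midpoints[OF fin fin nc nc refl g(2)]
    by (rule wt_sum_local[OF T g(1) finite_midpoints[OF fin fin]])
  have tr1: "tr A = card \<T>" unfolding tr_eq[OF fin nc g(1)] card_triangulation[OF T g(1) fin] ..
  have S: "4 \<le> S (convex hull {x, y, z}) \<and> (S (convex hull {x, y, z}) = 4 \<longleftrightarrow> midpoints A A \<inter> convex hull {x, y, z} \<subseteq> six x y z)"
    if xyz: "{x, y, z} \<subseteq> A" "cr (y - x) (z - x) \<noteq> 0" for x y z
  proof -
    let ?t = "convex hull {x, y, z}"
    have gg: "generic d {x, y, z}" by (rule generic_subset[OF g(1) xyz(1)])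
    have sub: "six x y z \<subseteq> midpoints A A \<inter> ?t"
    proof (rule Int_greatest[OF _ six_subset])
      show "six x y z \<subseteq> midpoints A A" unfolding subset_iff six_iff using midpointsI xyz(1) by blast
    qed
    have f: "finite (midpoints A A \<inter> ?t)" using finite_midpoints[OF fin fin] by simp
    have eq: "S ?t = 4 + (\<Sum>m\<in>midpoints A A \<inter> ?t - six x y z. wt d ?t m)"
      unfolding S_def using sum.subset_diff[OF sub f, of "wt d ?t"] sum_six[OF xyz(2) gg] by simp
    have pos: "1 \<le> wt d ?t m" if "m \<in> midpoints A A \<inter> ?t - six x y z" for m
      by (rule wt_nonvertex(1)[OF xyz(2) gg]) (use that in \<open>auto simp: six_def\<close>)
    have "(\<Sum>m\<in>midpoints A A \<inter> ?t - six x y z. wt d ?t m) = 0 \<longleftrightarrow> midpoints A A \<inter> ?t - six x y z = {}"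
    proof -
      have "wt d ?t m \<noteq> 0" if "m \<in> midpoints A A \<inter> ?t - six x y z" for m
        using pos[OF that] by simp
      then show ?thesis using f by (subst sum_eq_0_iff) blast+
    qed
    then show ?thesis using eq by auto
  qed
  have tri: "\<exists>x y z. {x, y, z} \<subseteq> A \<and> cr (y - x) (z - x) \<noteq> 0 \<and> T = convex hull {x, y, z}" if "T \<in> \<T>" for T
    using triangulates_triangle[OF T that] by metis
  have "4 \<le> S T'" if "T' \<in> \<T>" for T' using tri[OF that] S by blast
  then have "(\<Sum>T\<in>\<T>. S T) = 4 * card \<T> \<longleftrightarrow> (\<forall>T\<in>\<T>. S T = 4)"
    using sum_mono_inv[of "\<lambda>_. 4" \<T> S] finT by auto
  also have "\<dots> \<longleftrightarrow> ?r"
  proof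
    assume l: "\<forall>T\<in>\<T>. S T = 4"
    show ?r using S l by blast
  next
    assume r: ?r
    show "\<forall>T\<in>\<T>. S T = 4"
    proof
      fix T' assume "T' \<in> \<T>"
      then obtain x y z where xyz: "{x, y, z} \<subseteq> A" "cr (y - x) (z - x) \<noteq> 0" "T' = convex hull {x, y, z}"
        using tri by blast
      have "midpoints A A \<inter> convex hull {x, y, z} \<subseteq> six x y z"
        using r xyz \<open>T' \<in> \<T>\<close> by blast
      then show "S T' = 4" using S[OF xyz(1,2)] xyz(3) by simp
    qed
  qed
  finally show ?thesis unfolding tr1 tr2 .
qed

text \<open>Forwards, a triangulation is chosen through the given empty triangle; backwards, any
  triangulation will do, as its triangles are empty.\<close>

theorem doubling_iff_rigid:
  assumes fin: "finite A" and nc: "\<not> collinear A"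
  shows "tr (A + A) = 4 * tr A \<longleftrightarrow> rigid A"
proof
  assume l: "tr (A + A) = 4 * tr A"
  show "rigid A"
    unfolding rigid_def
  proof (intro allI impI ballI)
    fix x y z a b
    assume xyz: "{x, y, z} \<subseteq> A" "cr (y - x) (z - x) \<noteq> 0" "A \<inter> convex hull {x, y, z} = {x, y, z}"
      and ab: "a \<in> A" "b \<in> A" "midpoint a b \<in> convex hull {x, y, z}"
    obtain \<T> where T: "triangulates \<T> A" "convex hull {x, y, z} \<in> \<T>"
      using triangulation_extends[OF fin xyz] by (elim exE conjE)
    have "midpoints A A \<inter> convex hull {x, y, z} \<subseteq> six x y z"
      using doubling_iff_six[OF fin nc T(1)] l xyz(1,2) T(2) by simp
    then show "midpoint a b \<in> six x y z" using ab midpointsI by blast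
  qed
next
  assume r: "rigid A"
  obtain \<T> where T: "triangulates \<T> A" using triangulation_exists[OF fin nc] by (elim exE)
  show "tr (A + A) = 4 * tr A"
    unfolding doubling_iff_six[OF fin nc T]
  proof (intro allI impI subsetI)
    fix x y z m assume xyz: "{x, y, z} \<subseteq> A" "cr (y - x) (z - x) \<noteq> 0" "convex hull {x, y, z} \<in> \<T>"
      and m: "m \<in> midpoints A A \<inter> convex hull {x, y, z}"
    then obtain a b where ab: "a \<in> A" "b \<in> A" "m = midpoint a b" unfolding midpoints_def by auto
    have "A \<inter> convex hull {x, y, z} = {x, y, z}" by (rule triangulates_vertices[OF T xyz(3,2)])
    then show "m \<in> six x y z" using r ab xyz m unfolding rigid_def by simp
  qed
qed

section \<open>The two families of extremal sets\<close>

text \<open>An empty triangle contains no lattice points but its vertices. If some coordinate of the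
  midpoint is at least 1/2, reflecting that vertex in the midpoint stays in the triangle and yields
  a vertex. Otherwise the lattice point \<open>x + y + z - a - b\<close> lies in the triangle, is a
  vertex, and \<open>a + b\<close> is the sum of the other two.\<close>

lemma saturated_rigid:
  assumes sat: "saturated A"
  shows "rigid A"
  unfolding rigid_def
proof (intro allI impI ballI)
  fix x y z a b
  assume xyz: "{x, y, z} \<subseteq> A" "cr (y - x) (z - x) \<noteq> 0" "A \<inter> convex hull {x, y, z} = {x, y, z}"
    and ab: "a \<in> A" "b \<in> A" "midpoint a b \<in> convex hull {x, y, z}"
  obtain a0 where a0: "a0 \<in> A" "A = convex hull A \<inter> (\<lambda>v. a0 + v) ` generated_lattice A"
    using sat unfolding saturated_def by blast
  let ?K = "(\<lambda>v. a0 + v) ` generated_lattice A"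
  have AK: "A \<subseteq> ?K" using a0(2) by blast
  have K: "u + v - w \<in> ?K" if "u \<in> ?K" "v \<in> ?K" "w \<in> ?K" for u v w
  proof -
    obtain u' v' w' where "u = a0 + u'" "v = a0 + v'" "w = a0 + w'" and
      m: "u' \<in> generated_lattice A" "v' \<in> generated_lattice A" "w' \<in> generated_lattice A"
      using \<open>u \<in> ?K\<close> \<open>v \<in> ?K\<close> \<open>w \<in> ?K\<close> by blast
    then have "u + v - w = a0 + (u' + v' - w')" by simp
    moreover have "u' + v' - w' \<in> generated_lattice A"
      using m unfolding generated_lattice_def by (intro group_closure.diff group_closure_add)
    ultimately show ?thesis by blast
  qed
  have sub: "convex hull {x, y, z} \<subseteq> convex hull A" by (rule hull_mono[OF xyz(1)])
  have vertex: "q \<in> {x, y, z}" if "q \<in> ?K" "q \<in> convex hull {x, y, z}" for q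
    using that a0(2) sub xyz(3) by blast
  have abK: "a \<in> ?K" "b \<in> ?K" and xK: "x \<in> ?K" "y \<in> ?K" "z \<in> ?K" using ab xyz(1) AK by auto
  let ?m = "midpoint a b"
  have mm: "2 *\<^sub>R ?m = a + b" by (simp add: midpoint_def)
  note D = xyz(2)
  have D': "cr (z - y) (x - y) \<noteq> 0" "cr (x - z) (y - z) \<noteq> 0" using D cr_cyc[of z y x] cr_cyc(2)[of x z y] by auto
  have n: "0 \<le> bary x y z ?m" "0 \<le> bary y z x ?m" "0 \<le> bary z x y ?m"
    using in_triangle_iff[OF D] ab(3) by auto
  note bv = bary_vertex[OF D] bary_vertex[OF D'(1)] bary_vertex[OF D'(2)]
  have refl: "bary u v w (a + b - c) = 2 * bary u v w ?m - bary u v w c" for u v w c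
  proof -
    have "a + b - c = 1 *\<^sub>R ?m + 1 *\<^sub>R ?m + (-1) *\<^sub>R c" using mm by (simp add: scaleR_2[symmetric])
    then show ?thesis using bary_affine3[of 1 1 "-1" u v w ?m ?m c] by simp
  qed
  have corner: "?m \<in> six x y z" if u: "u \<in> {x, y, z}" "a + b - u \<in> convex hull {x, y, z}" for u
  proof -
    have "a + b - u \<in> {x, y, z}" by (rule vertex[OF K[OF abK] u(2)]) (use u(1) xK in auto)
    moreover have "?m = midpoint u (a + b - u)" by (simp add: midpoint_def)
    ultimately show ?thesis unfolding six_iff using u(1) by blast
  qed
  show "?m \<in> six x y z"
  \<comment> \<open>The four triangles of the midpoint subdivision: three corner triangles and the
    middle one.\<close>
  proof (cases "bary x y z ?m \<ge> 1/2 \<or> bary y z x ?m \<ge> 1/2 \<or> bary z x y ?m \<ge> 1/2")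
    case True
    then consider "bary x y z ?m \<ge> 1/2" | "bary y z x ?m \<ge> 1/2" | "bary z x y ?m \<ge> 1/2" by blast
    then show ?thesis
    proof cases
      case 1
      have "a + b - x \<in> convex hull {x, y, z}" unfolding in_triangle_iff[OF D] refl bv using 1 n by simp
      then show ?thesis using corner[of x] by simp
    next
      case 2
      have "a + b - y \<in> convex hull {x, y, z}" unfolding in_triangle_iff[OF D] refl bv using 2 n by simp
      then show ?thesis using corner[of y] by simp
    next
      case 3
      have "a + b - z \<in> convex hull {x, y, z}" unfolding in_triangle_iff[OF D] refl bv using 3 n by simp
      then show ?thesis using corner[of z] by simp
    qed
  next
    case False
    let ?q = "x + (y + z - a) - b"
    have qe: "bary u v w ?q = bary u v w x + bary u v w y + bary u v w z - 2 * bary u v w ?m" for u v w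
    proof -
      have 1: "y + z - a = 1 *\<^sub>R y + 1 *\<^sub>R z + (-1) *\<^sub>R a" "?q = 1 *\<^sub>R x + 1 *\<^sub>R (y + z - a) + (-1) *\<^sub>R b" by simp_all
      have "bary u v w ?q = bary u v w x + bary u v w (y + z - a) - bary u v w b"
        unfolding 1(2) using bary_affine3[of 1 1 "-1" u v w x "y + z - a" b] by simp
      also have "bary u v w (y + z - a) = bary u v w y + bary u v w z - bary u v w a"
        unfolding 1(1) using bary_affine3[of 1 1 "-1" u v w y z a] by simp
      finally have f: "bary u v w ?q = bary u v w x + (bary u v w y + bary u v w z - bary u v w a) - bary u v w b" .
      have "2 * bary u v w ?m = bary u v w a + bary u v w b" by (simp add: bary_midpoint)
      then show ?thesis unfolding f by simp
    qed
    have "?q \<in> convex hull {x, y, z}" unfolding in_triangle_iff[OF D] qe bv using False by simp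
    moreover have "?q \<in> ?K" by (intro K xK abK)
    ultimately have "?q \<in> {x, y, z}" by (rule vertex[rotated])
    then have "a + b = y + z \<or> a + b = x + z \<or> a + b = x + y" by (auto simp: algebra_simps)
    then have "?m = midpoint y z \<or> ?m = midpoint x z \<or> ?m = midpoint x y" unfolding midpoint_def by auto
    then show ?thesis unfolding six_def by blast
  qed
qed

text \<open>Case (b) of the theorem, with \<open>k = m + 3\<close>, \<open>z (i + 1) = b + i e\<close> for \<open>i \<le> m\<close>, \<open>z (k - 1) = q\<close> and \<open>z k = r\<close>.\<close>

definition comb_set :: "(real^2) set \<Rightarrow> bool" where
  "comb_set A \<longleftrightarrow> (\<exists>b e q r. \<exists>m::nat\<ge>1. A = (\<lambda>i. b + real i *\<^sub>R e) ` {..m} \<union> {q, r} \<and>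
     (\<forall>i<m. b + real i *\<^sub>R e \<in> interior (convex hull {b + real m *\<^sub>R e, q, r})))"

lemma interior_not_collinear:
  fixes p q r :: "real^2"
  assumes "u \<in> interior (convex hull {p, q, r})"
  shows "cr (q - p) (r - p) \<noteq> 0" "u \<notin> {p, q, r}"
proof -
  show D: "cr (q - p) (r - p) \<noteq> 0"
  proof
    assume "cr (q - p) (r - p) = 0"
    then have "collinear (convex hull {p, q, r})" using cr_collinear collinear_hull by blast
    then have "aff_dim (convex hull {p, q, r}) \<le> 1" by (simp add: collinear_aff_dim)
    moreover have "aff_dim (convex hull {p, q, r}) = 2"
      using aff_dim_nonempty_interior[of "convex hull {p, q, r}"] assms by auto
    ultimately show False by simp
  qed
  have D': "cr (r - q) (p - q) \<noteq> 0" "cr (p - r) (q - r) \<noteq> 0" using D cr_cyc[of r q p] cr_cyc(2)[of p r q] by auto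
  show "u \<notin> {p, q, r}"
    using assms unfolding interior_triangle_iff[OF D] using bary_vertex[OF D] bary_vertex[OF D'(1)] bary_vertex[OF D'(2)] by auto
qed

text \<open>With \<open>m\<close> interior points \<open>tr A = 2 * m + 1\<close>. Besides the six
  points there are at most \<open>4 * m\<close> midpoints, each of weight at most 2, hence
  \<open>tr (A + A) \<le> 4 + 8 * m = 4 * tr A\<close>. The reverse bound is the general
  inequality.\<close>

lemma comb_set_tr:
  assumes "comb_set A"
  shows "finite A" "\<not> collinear A" "tr (A + A) = 4 * tr A"
proof -
  obtain b e q r and m :: nat where m: "m \<ge> 1" and A: "A = (\<lambda>i. b + real i *\<^sub>R e) ` {..m} \<union> {q, r}"
    and int: "\<And>i. i < m \<Longrightarrow> b + real i *\<^sub>R e \<in> interior (convex hull {b + real m *\<^sub>R e, q, r})"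
    using assms unfolding comb_set_def by blast
  define z where "z i = b + real i *\<^sub>R e" for i
  define p where "p = z m"
  have Az: "A = z ` {..<m} \<union> {p, q, r}"
    unfolding A p_def z_def lessThan_Suc_atMost[symmetric] lessThan_Suc by auto
  have zint: "z i \<in> interior (convex hull {p, q, r})" if "i < m" for i
    using int[OF that] unfolding z_def p_def .
  note D = interior_not_collinear(1)[OF zint[of 0]]
  have D: "cr (q - p) (r - p) \<noteq> 0" using D m by simp
  show fin: "finite A" unfolding A by simp
  show nc: "\<not> collinear A" unfolding collinear_cr_iff Az using D by blast
  have hull: "convex hull A = convex hull {p, q, r}"
  proof
    have "z ` {..<m} \<subseteq> convex hull {p, q, r}" using zint interior_subset by blast
    then show "convex hull A \<subseteq> convex hull {p, q, r}"
      unfolding Az using hull_subset[of "{p, q, r}" convex] by (intro hull_minimal) auto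
    show "convex hull {p, q, r} \<subseteq> convex hull A" unfolding Az by (intro hull_mono) auto
  qed
  obtain d where d: "generic d (A \<union> (A + A))"
    using generic_exists[of "A \<union> (A + A)"] fin by (auto simp: finite_set_plus)
  then have g: "generic d A" "generic d (A + A)" by (auto intro: generic_subset)
  have gg: "generic d {p, q, r}" by (rule generic_subset[OF g(1)]) (auto simp: Az)
  let ?w = "wt d (convex hull {p, q, r})"
  have e0: "e \<noteq> 0"
  proof
    assume "e = 0"
    then have "z 0 = p" unfolding p_def z_def by simp
    then show False using interior_not_collinear(2)[OF zint[of 0]] m by simp
  qed
  have inj: "inj_on z {..<m}" using e0 by (intro inj_onI) (simp add: z_def)
  have wz: "?w u = 2" if "u \<in> interior (convex hull {p, q, r})" for u
    using wt_triangle(1)[OF D gg] that interior_subset unfolding interior_triangle_iff[OF D] by (metis in_triangle_iff[OF D] order_less_imp_le)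
  have "tr A = (\<Sum>x\<in>A. ?w x)" unfolding tr_eq[OF fin nc g(1)] hull ..
  also have "\<dots> = (\<Sum>x\<in>z ` {..<m}. ?w x) + (\<Sum>x\<in>{p, q, r}. ?w x)"
    unfolding Az by (rule sum.union_disjoint) (use interior_not_collinear(2)[OF zint] in auto)
  also have "(\<Sum>x\<in>{p, q, r}. ?w x) = 1"
    using wt_triangle_vertices[OF D gg] not_collinear_affine[OF D] by simp
  also have "(\<Sum>x\<in>z ` {..<m}. ?w x) = 2 * m"
    unfolding sum.reindex[OF inj] comp_def using wz[OF zint] by simp
  finally have trA: "tr A = 2 * m + 1" .
  \<comment> \<open>Equal spacing is used here: midpoints within the progression depend only on the
    index sum, so there are \<open>2 * m\<close> of them apart from \<open>p\<close>, instead of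
    quadratically many.\<close>
  define I where "I = (\<lambda>k. b + (real k / 2) *\<^sub>R e) ` {..<2 * m} \<union> (\<lambda>i. midpoint q (z i)) ` {..<m} \<union> (\<lambda>i. midpoint r (z i)) ` {..<m}"
  have cI: "card I \<le> 4 * m"
  proof -
    have "card I \<le> card ((\<lambda>k. b + (real k / 2) *\<^sub>R e) ` {..<2 * m}) + card ((\<lambda>i. midpoint q (z i)) ` {..<m}) + card ((\<lambda>i. midpoint r (z i)) ` {..<m})"
      unfolding I_def by (meson add_mono card_Un_le le_refl order_trans)
    also have "\<dots> \<le> 2 * m + m + m"
      by (intro add_mono order_trans[OF card_image_le]) auto
    finally show ?thesis by simp
  qed
  have finI: "finite I" unfolding I_def by simp
  have sub: "midpoints A A \<subseteq> six p q r \<union> I"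
  proof -
    have zz: "midpoint (z i) (z j) \<in> six p q r \<union> I" if "i \<le> m" "j \<le> m" for i j
    proof (cases "i + j = 2 * m")
      case True
      then have "i = m" "j = m" using that by auto
      then show ?thesis unfolding six_def p_def by simp
    next
      case False
      have "midpoint (z i) (z j) = b + (real (i + j) / 2) *\<^sub>R e"
        unfolding z_def midpoint_def by (simp add: vec_eq_iff field_simps)
      moreover have "i + j < 2 * m" using False that by simp
      ultimately show ?thesis unfolding I_def by blast
    qed
    have zq: "midpoint u (z i) \<in> six p q r \<union> I" if "i \<le> m" "u = q \<or> u = r" for i u
    proof (cases "i = m")
      case True
      then have "z i = p" unfolding p_def by simp
      then show ?thesis using that(2) unfolding six_iff Un_iff by blast
    next
      case False
      then have "i < m" using that by simp
      then show ?thesis using that(2) unfolding I_def by blast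
    qed
    have uv: "midpoint u w \<in> six p q r \<union> I" if "u = q \<or> u = r" "w = q \<or> w = r" for u w
      using that unfolding six_iff Un_iff by blast
    have "midpoint u w \<in> six p q r \<union> I" if "u \<in> A" "w \<in> A" for u w
    proof -
      have "(\<exists>i\<le>m. u = z i) \<or> u = q \<or> u = r" "(\<exists>i\<le>m. w = z i) \<or> w = q \<or> w = r"
        using that unfolding A z_def by auto
      then show ?thesis
        using zz zq uv midpoint_sym by metis
    qed
    then show ?thesis unfolding midpoints_def by auto
  qed
  have fsix: "finite (six p q r)" by (simp add: six_def)
  have "tr (A + A) = (\<Sum>u\<in>midpoints A A. ?w u)"
    unfolding tr_sum_midpoints[OF fin fin nc nc refl g(2)] hull ..
  also have "\<dots> \<le> (\<Sum>u\<in>six p q r \<union> I. ?w u)" by (rule sum_mono2) (use sub finI fsix in auto)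
  also have "\<dots> \<le> (\<Sum>u\<in>six p q r. ?w u) + (\<Sum>u\<in>I. ?w u)"
    using sum.union_inter[OF fsix finI, of ?w] by linarith
  also have "(\<Sum>u\<in>I. ?w u) \<le> (\<Sum>u\<in>I. 2)" by (intro sum_mono wt_le_2)
  also have "(\<Sum>u\<in>six p q r. ?w u) + (\<Sum>u\<in>I. 2) \<le> 4 + 2 * (4 * m)" using cI sum_six[OF D gg] by simp
  finally have "tr (A + A) \<le> 4 * tr A" using trA by simp
  then show "tr (A + A) = 4 * tr A" using tr_sum_ge(1)[OF fin fin nc nc refl] by simp
qed

lemma comb_set_iff:
  "comb_set A \<longleftrightarrow> (\<exists>k z. 4 \<le> k \<and> inj_on z {1..k} \<and> A = z ` {1..k::nat} \<and>
          (\<forall>i\<in>{1..k-3}. z i \<in> interior (convex hull {z (k-2), z (k-1), z k})) \<and>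
          collinear (z ` {1..k-2}) \<and>
          (\<exists>d. \<forall>i\<in>{1..k-3}. z (Suc i) - z i = d))" (is "_ \<longleftrightarrow> ?r")
proof
  assume "comb_set A"
  then obtain b e q r and m :: nat where m: "m \<ge> 1" and A: "A = (\<lambda>i. b + real i *\<^sub>R e) ` {..m} \<union> {q, r}"
    and int: "\<And>i. i < m \<Longrightarrow> b + real i *\<^sub>R e \<in> interior (convex hull {b + real m *\<^sub>R e, q, r})"
    unfolding comb_set_def by blast
  let ?p = "b + real m *\<^sub>R e"
  \<comment> \<open>The index is shifted by one, since the enumeration starts at 1 while the
    progression starts at 0; \<open>m + 2\<close> and \<open>m + 3\<close> carry the two remaining
    vertices.\<close>
  define z where "z i = (if i \<le> m + 1 then b + real (i - 1) *\<^sub>R e else if i = m + 2 then q else r)" for i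
  have D: "cr (q - ?p) (r - ?p) \<noteq> 0" using interior_not_collinear(1)[OF int[of 0]] m by simp
  have ne: "?p \<noteq> q" "q \<noteq> r" "?p \<noteq> r" using not_collinear_affine[OF D] by auto
  have ne2: "b + real i *\<^sub>R e \<noteq> q" "b + real i *\<^sub>R e \<noteq> r" if "i \<le> m" for i
    using interior_not_collinear(2)[OF int[of i]] ne that by (cases "i < m"; force)+
  have e0: "e \<noteq> 0" using interior_not_collinear(2)[OF int[of 0]] m by auto
  have z1: "z i = b + real (i - 1) *\<^sub>R e" if "i \<le> m + 1" for i using that unfolding z_def by simp
  have z2: "z (m + 2) = q" "z (m + 3) = r" unfolding z_def by simp_all
  show ?r
  proof (intro exI[of _ "m + 3"] exI[of _ z] conjI)
    show "4 \<le> m + 3" using m by simp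
    have nq: "z i \<noteq> q" "z i \<noteq> r" if "i \<le> m + 1" for i
    proof -
      have "i - 1 \<le> m" using that by simp
      then show "z i \<noteq> q" "z i \<noteq> r" using ne2 z1[OF that] by simp_all
    qed
    have cases: "i \<le> m + 1 \<or> i = m + 2 \<or> i = m + 3" if "i \<in> {1..m+3}" for i using that by auto
    show "inj_on z {1..m+3}"
    proof (rule inj_onI)
      fix i j assume ij: "i \<in> {1..m+3}" "j \<in> {1..m+3}" "z i = z j"
      have l: "i \<noteq> 0" "j \<noteq> 0" using ij by auto
      from cases[OF ij(1)] cases[OF ij(2)] show "i = j"
      proof (elim disjE)
        assume "i \<le> m + 1" "j \<le> m + 1"
        then have "real (i - 1) *\<^sub>R e = real (j - 1) *\<^sub>R e" using ij(3) z1 by simp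
        then have "i - 1 = j - 1" using e0 by simp
        then show "i = j" using l by simp
      qed (use ij(3) z2 nq ne(2) in metis)+
    qed
    show "A = z ` {1..m+3}"
    proof -
      have s: "{1..m+3} = Suc ` {..m} \<union> {m + 2, m + 3}" unfolding image_Suc_atMost by auto
      have "z ` {1..m+3} = (\<lambda>i. z (Suc i)) ` {..m} \<union> {q, r}"
        unfolding s image_Un image_image using z2 by simp
      also have "(\<lambda>i. z (Suc i)) ` {..m} = (\<lambda>i. b + real i *\<^sub>R e) ` {..m}"
        by (rule image_cong) (simp_all add: z1)
      finally show ?thesis using A by simp
    qed
    have k: "m + 3 - 2 = m + 1" "m + 3 - 1 = m + 2" "m + 3 - 3 = m" by simp_all
    show "\<forall>i\<in>{1..m+3-3}. z i \<in> interior (convex hull {z (m+3-2), z (m+3-1), z (m+3)})"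
    proof
      fix i assume "i \<in> {1..m+3-3}"
      then have i: "i - 1 < m" "i \<le> m + 1" by auto
      have "z (m + 1) = b + real m *\<^sub>R e" using z1[of "m + 1"] by simp
      then show "z i \<in> interior (convex hull {z (m+3-2), z (m+3-1), z (m+3)})"
        unfolding k z2 z1[OF i(2)] using int[OF i(1)] by simp
    qed
    show "collinear (z ` {1..m+3-2})"
      unfolding k collinear_def
    proof (intro exI[of _ e] ballI)
      fix u w assume "u \<in> z ` {1..m+1}" "w \<in> z ` {1..m+1}"
      then obtain i j where "i \<in> {1..m+1}" "u = z i" "j \<in> {1..m+1}" "w = z j" by blast
      then have "u = b + real (i - 1) *\<^sub>R e" "w = b + real (j - 1) *\<^sub>R e" using z1 by simp_all
      then have "u - w = (real (i - 1) - real (j - 1)) *\<^sub>R e" by (simp add: scaleR_left_diff_distrib)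
      then show "\<exists>c. u - w = c *\<^sub>R e" by blast
    qed
    show "\<exists>d. \<forall>i\<in>{1..m+3-3}. z (Suc i) - z i = d"
    proof (intro exI[of _ e] ballI)
      fix i assume i: "i \<in> {1..m+3-3}"
      then obtain j where "i = Suc j" by (cases i) auto
      then show "z (Suc i) - z i = e" using z1 i by (simp add: algebra_simps)
    qed
  qed
next
  assume ?r
  then obtain k :: nat and z and d where k: "4 \<le> k" and A: "A = z ` {1..k}" and
    int: "\<And>i. i \<in> {1..k-3} \<Longrightarrow> z i \<in> interior (convex hull {z (k-2), z (k-1), z k})" and
    d: "\<And>i. i \<in> {1..k-3} \<Longrightarrow> z (Suc i) - z i = d" by blast
  define m where "m = k - 3"
  have m: "m \<ge> 1" "k = m + 3" using k unfolding m_def by auto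
  have kk: "k - 3 = m" "k - 2 = Suc m" "k - 1 = m + 2" using m by auto
  have zi: "i \<le> m \<Longrightarrow> z (Suc i) = z 1 + real i *\<^sub>R d" for i
  proof (induction i)
    case (Suc i)
    then have "z (Suc (Suc i)) = z (Suc i) + d" using d[of "Suc i"] unfolding kk by (simp add: algebra_simps)
    then show ?case using Suc by (simp add: algebra_simps)
  qed simp
  have s: "{1..k} = Suc ` {..m} \<union> {m + 2, m + 3}" unfolding image_Suc_atMost using m by auto
  have "A = (\<lambda>i. z 1 + real i *\<^sub>R d) ` {..m} \<union> {z (k - 1), z k}"
  proof -
    have "A = (\<lambda>i. z (Suc i)) ` {..m} \<union> {z (m + 2), z (m + 3)}"
    proof -
      have "A = z ` (Suc ` {..m}) \<union> z ` {m + 2, m + 3}" by (simp only: A s image_Un)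
      also have "z ` (Suc ` {..m}) = (\<lambda>i. z (Suc i)) ` {..m}" by (rule image_image)
      also have "z ` {m + 2, m + 3} = {z (m + 2), z (m + 3)}" by (simp only: image_insert image_empty)
      finally show ?thesis .
    qed
    also have "(\<lambda>i. z (Suc i)) ` {..m} = (\<lambda>i. z 1 + real i *\<^sub>R d) ` {..m}"
      by (intro image_cong refl zi) simp
    finally show ?thesis using m by simp
  qed
  moreover have "z 1 + real i *\<^sub>R d \<in> interior (convex hull {z 1 + real m *\<^sub>R d, z (k - 1), z k})" if "i < m" for i
    using int[of "Suc i"] that zi[of i] zi[of m] unfolding kk by simp
  ultimately show "comb_set A" unfolding comb_set_def using m(1) by blast
qed

section \<open>Lattice coordinates\<close>

lemma coord_unique:
  assumes "cr u w \<noteq> 0"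
  shows "b + s *\<^sub>R u + t *\<^sub>R w = b + s' *\<^sub>R u + t' *\<^sub>R w \<longleftrightarrow> s = s' \<and> t = t'"
proof
  assume "b + s *\<^sub>R u + t *\<^sub>R w = b + s' *\<^sub>R u + t' *\<^sub>R w"
  then have "s *\<^sub>R u + t *\<^sub>R w = s' *\<^sub>R u + t' *\<^sub>R w" by (simp add: add.assoc)
  then have "cr (s *\<^sub>R u + t *\<^sub>R w) w = cr (s' *\<^sub>R u + t' *\<^sub>R w) w" "cr u (s *\<^sub>R u + t *\<^sub>R w) = cr u (s' *\<^sub>R u + t' *\<^sub>R w)"
    by simp_all
  then show "s = s' \<and> t = t'" using assms by (simp add: cr_simps)
qed simp

lemma coord_exists:
  assumes "cr u w \<noteq> 0"
  shows "\<exists>s t. p = b + s *\<^sub>R u + t *\<^sub>R w"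
proof -
  let ?c = "cr u w"
  have "p - b = (1 / ?c) *\<^sub>R (?c *\<^sub>R (p - b))" using assms by simp
  also have "\<dots> = (cr (p - b) w / ?c) *\<^sub>R u + (cr u (p - b) / ?c) *\<^sub>R w"
    unfolding cr_cramer[of u w "p - b"] by (simp add: scaleR_add_right)
  finally have "p = b + (cr (p - b) w / ?c) *\<^sub>R u + (cr u (p - b) / ?c) *\<^sub>R w" by (simp add: algebra_simps)
  then show ?thesis by blast
qed

lemma coord_triangle:
  assumes "cr u w \<noteq> 0"
  shows "b + s *\<^sub>R u + t *\<^sub>R w \<in> convex hull {b, b + u, b + w} \<longleftrightarrow> 0 \<le> s \<and> 0 \<le> t \<and> s + t \<le> 1"
proof
  have comb: "(1 - s - t) *\<^sub>R b + s *\<^sub>R (b + u) + t *\<^sub>R (b + w) = b + s *\<^sub>R u + t *\<^sub>R w" for s t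
    by (simp add: algebra_simps)
  {
    assume "b + s *\<^sub>R u + t *\<^sub>R w \<in> convex hull {b, b + u, b + w}"
    then obtain r s' t' where r: "0 \<le> r" "0 \<le> s'" "0 \<le> t'" "r + s' + t' = 1"
      "b + s *\<^sub>R u + t *\<^sub>R w = r *\<^sub>R b + s' *\<^sub>R (b + u) + t' *\<^sub>R (b + w)" by (auto simp: convex_hull_3)
    have "r = 1 - s' - t'" using r(4) by simp
    then have "b + s *\<^sub>R u + t *\<^sub>R w = b + s' *\<^sub>R u + t' *\<^sub>R w" using r(5) comb[of s' t'] by simp
    then show "0 \<le> s \<and> 0 \<le> t \<and> s + t \<le> 1" using r unfolding coord_unique[OF assms] by simp
  }
  assume "0 \<le> s \<and> 0 \<le> t \<and> s + t \<le> 1"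
  then show "b + s *\<^sub>R u + t *\<^sub>R w \<in> convex hull {b, b + u, b + w}"
    using in_hull3I[of "1 - s - t" s t b "b + u" "b + w"] unfolding comb by simp
qed

text \<open>Saturation together with an explicit affine lattice basis whose base triangle has its
  vertices in \<open>A\<close>. \<open>frame_saturated\<close> and \<open>saturated_frame\<close>
  lead back and forth.\<close>

definition frame :: "(real^2) set \<Rightarrow> real^2 \<Rightarrow> real^2 \<Rightarrow> real^2 \<Rightarrow> bool" where
  "frame A b u w \<longleftrightarrow> cr u w \<noteq> 0 \<and> {b, b + u, b + w} \<subseteq> A \<and>
     (\<forall>p\<in>A. \<exists>i j::int. p = b + of_int i *\<^sub>R u + of_int j *\<^sub>R w) \<and>
     (\<forall>i j::int. b + of_int i *\<^sub>R u + of_int j *\<^sub>R w \<in> convex hull A \<longrightarrow> b + of_int i *\<^sub>R u + of_int j *\<^sub>R w \<in> A)"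

lemma frameD:
  assumes "frame A b u w"
  shows "cr u w \<noteq> 0" "b \<in> A" "b + u \<in> A" "b + w \<in> A"
    and "p \<in> A \<Longrightarrow> \<exists>i j::int. p = b + of_int i *\<^sub>R u + of_int j *\<^sub>R w"
    and "b + of_int i *\<^sub>R u + of_int j *\<^sub>R w \<in> convex hull A \<Longrightarrow> b + of_int i *\<^sub>R u + of_int j *\<^sub>R w \<in> A"
  using assms unfolding frame_def by auto

lemma frame_swap: "frame A b u w \<Longrightarrow> frame A b w u"
  unfolding frame_def by (simp add: cr_anti[of w u] add.assoc add.left_commute add.commute) (metis add.commute)

lemma frame_empty:
  assumes f: "frame A b u w"
  shows "A \<inter> convex hull {b, b + u, b + w} = {b, b + u, b + w}"
proof
  show "{b, b + u, b + w} \<subseteq> A \<inter> convex hull {b, b + u, b + w}"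
    using frameD(2-4)[OF f] hull_subset[of "{b, b + u, b + w}" convex] by blast
  show "A \<inter> convex hull {b, b + u, b + w} \<subseteq> {b, b + u, b + w}"
  proof
    fix p assume p: "p \<in> A \<inter> convex hull {b, b + u, b + w}"
    then obtain i j :: int where ij: "p = b + of_int i *\<^sub>R u + of_int j *\<^sub>R w" using frameD(5)[OF f] by blast
    have "0 \<le> (of_int i :: real) \<and> 0 \<le> (of_int j :: real) \<and> (of_int i :: real) + of_int j \<le> 1"
      using p coord_triangle[OF frameD(1)[OF f], of b "of_int i" "of_int j"] unfolding ij by simp
    then have "0 \<le> i \<and> 0 \<le> j \<and> i + j \<le> 1" by linarith
    then have "(i = 0 \<and> j = 0) \<or> (i = 1 \<and> j = 0) \<or> (i = 0 \<and> j = 1)" by arith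
    then show "p \<in> {b, b + u, b + w}" unfolding ij by auto
  qed
qed

text \<open>A shear does not change the lattice. It is used to slide the third frame point along its
  lattice row.\<close>

lemma frame_shift:
  assumes f: "frame A b u w" and m: "b + of_int k *\<^sub>R u + w \<in> A"
  shows "frame A b u (w + of_int k *\<^sub>R u)"
proof -
  have e: "b + of_int i *\<^sub>R u + of_int j *\<^sub>R (w + of_int k *\<^sub>R u) = b + of_int (i + j * k) *\<^sub>R u + of_int j *\<^sub>R w" for i j :: int
    by (simp add: algebra_simps)
  show ?thesis
    unfolding frame_def
  proof (intro conjI ballI allI impI)
    show "cr u (w + of_int k *\<^sub>R u) \<noteq> 0" using frameD(1)[OF f] by (simp add: cr_simps)
    show "{b, b + u, b + (w + of_int k *\<^sub>R u)} \<subseteq> A"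
      using frameD(2,3)[OF f] m by (simp add: algebra_simps)
    show "\<exists>i j. p = b + of_int i *\<^sub>R u + of_int j *\<^sub>R (w + of_int k *\<^sub>R u)" if p: "p \<in> A" for p
    proof -
      obtain i j :: int where ij: "p = b + of_int i *\<^sub>R u + of_int j *\<^sub>R w" using frameD(5)[OF f p] by blast
      have "p = b + of_int (i - j * k) *\<^sub>R u + of_int j *\<^sub>R (w + of_int k *\<^sub>R u)" unfolding e ij by simp
      then show ?thesis by blast
    qed
    show "b + of_int i *\<^sub>R u + of_int j *\<^sub>R (w + of_int k *\<^sub>R u) \<in> A"
      if "b + of_int i *\<^sub>R u + of_int j *\<^sub>R (w + of_int k *\<^sub>R u) \<in> convex hull A" for i j :: int
      using frameD(6)[OF f] that unfolding e by blast
  qed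
qed

text \<open>All frames of \<open>A\<close> span the same lattice, because the points of one frame
  have integer coordinates in any other.\<close>

lemma frame_change:
  assumes f: "frame A b u w" and f': "frame A b' u' w'" and p: "p = b + of_int i *\<^sub>R u + of_int j *\<^sub>R w"
  shows "\<exists>i' j'::int. p = b' + of_int i' *\<^sub>R u' + of_int j' *\<^sub>R w'"
proof -
  obtain i0 j0 i1 j1 i2 j2 :: int where
    e: "b = b' + of_int i0 *\<^sub>R u' + of_int j0 *\<^sub>R w'"
       "b + u = b' + of_int i1 *\<^sub>R u' + of_int j1 *\<^sub>R w'"
       "b + w = b' + of_int i2 *\<^sub>R u' + of_int j2 *\<^sub>R w'"
    using frameD(5)[OF f' frameD(2)[OF f]] frameD(5)[OF f' frameD(3)[OF f]] frameD(5)[OF f' frameD(4)[OF f]] by blast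
  have "p = b + of_int i *\<^sub>R ((b + u) - b) + of_int j *\<^sub>R ((b + w) - b)" unfolding p by simp
  also have "\<dots> = b' + of_int (i0 + i * (i1 - i0) + j * (i2 - i0)) *\<^sub>R u' + of_int (j0 + i * (j1 - j0) + j * (j2 - j0)) *\<^sub>R w'"
    unfolding e(2,3) unfolding e(1) by (simp add: algebra_simps)
  finally show ?thesis by blast
qed

lemma group_closure_of_int:
  fixes g :: "real^2"
  assumes "g \<in> group_closure S"
  shows "of_int k *\<^sub>R g \<in> group_closure S"
proof -
  have n: "real n *\<^sub>R g \<in> group_closure S" for n
  proof (induction n)
    case (Suc n)
    have "real (Suc n) *\<^sub>R g = real n *\<^sub>R g + g" by (simp add: algebra_simps)
    then show ?case using group_closure_add[OF Suc assms] by simp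
  qed simp
  show ?thesis
  proof (cases "k \<ge> 0")
    case True
    then show ?thesis using n[of "nat k"] by simp
  next
    case False
    then have "of_int k *\<^sub>R g = - (real (nat (- k)) *\<^sub>R g)" by simp
    then show ?thesis using n[of "nat (- k)"] by simp
  qed
qed

lemma frame_saturated:
  assumes f: "frame A b u w"
  shows "saturated A"
proof -
  let ?D = "{x - y | x y. x \<in> A \<and> y \<in> A}"
  have u: "u \<in> generated_lattice A" "w \<in> generated_lattice A"
  proof -
    have "(b + u) - b \<in> ?D" "(b + w) - b \<in> ?D" using frameD(2-4)[OF f] by blast+
    then show "u \<in> generated_lattice A" "w \<in> generated_lattice A"
      unfolding generated_lattice_def by (auto intro: group_closure.base)
  qed
  have lat: "\<exists>i j::int. g = of_int i *\<^sub>R u + of_int j *\<^sub>R w" if "g \<in> generated_lattice A" for g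
    using that unfolding generated_lattice_def
  proof (induction rule: group_closure.induct)
    case (base s)
    show ?case
    proof (cases "s = 0")
      case True
      then show ?thesis by (intro exI[of _ 0]) simp
    next
      case False
      then obtain x y where "s = x - y" "x \<in> A" "y \<in> A" using base by blast
      then obtain i j i' j' :: int where "x = b + of_int i *\<^sub>R u + of_int j *\<^sub>R w" "y = b + of_int i' *\<^sub>R u + of_int j' *\<^sub>R w"
        using frameD(5)[OF f] by meson
      then have "s = of_int (i - i') *\<^sub>R u + of_int (j - j') *\<^sub>R w" using \<open>s = x - y\<close> by (simp add: algebra_simps)
      then show ?thesis by blast
    qed
  next
    case (diff s t)
    then obtain i j i' j' :: int where "s = of_int i *\<^sub>R u + of_int j *\<^sub>R w" "t = of_int i' *\<^sub>R u + of_int j' *\<^sub>R w" by blast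
    then have "s - t = of_int (i - i') *\<^sub>R u + of_int (j - j') *\<^sub>R w" by (simp add: algebra_simps)
    then show ?case by blast
  qed
  show ?thesis
    unfolding saturated_def
  proof (intro bexI[of _ b] equalityI subsetI)
    show "b \<in> A" by (rule frameD(2)[OF f])
    fix p assume "p \<in> A"
    then obtain i j :: int where p: "p = b + (of_int i *\<^sub>R u + of_int j *\<^sub>R w)" using frameD(5)[OF f] by (metis add.assoc)
    have "of_int i *\<^sub>R u + of_int j *\<^sub>R w \<in> generated_lattice A"
      using u unfolding generated_lattice_def by (intro group_closure_add group_closure_of_int)
    then show "p \<in> convex hull A \<inter> (\<lambda>v. b + v) ` generated_lattice A" using p \<open>p \<in> A\<close> hull_inc by fastforce
  next
    fix p assume p: "p \<in> convex hull A \<inter> (\<lambda>v. b + v) ` generated_lattice A"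
    then obtain i j :: int where "p = b + (of_int i *\<^sub>R u + of_int j *\<^sub>R w)" using lat by blast
    then have "p = b + of_int i *\<^sub>R u + of_int j *\<^sub>R w" by (simp add: add.assoc)
    then show "p \<in> A" using frameD(6)[OF f] p by blast
  qed
qed

text \<open>Every empty triangle of a saturated set is unimodular: a lattice point, reduced to the
  unit parallelogram, lies in the triangle or does so after reflection in the centre of the
  parallelogram; it is then a vertex, which leaves only the reduced coordinates 0.\<close>

lemma saturated_frame:
  assumes sat: "saturated A" and xyz: "{x, y, s} \<subseteq> A" "cr (y - x) (s - x) \<noteq> 0" "A \<inter> convex hull {x, y, s} = {x, y, s}"
  shows "frame A x (y - x) (s - x)"
proof -
  define u where "u = y - x"
  define w where "w = s - x"
  have ys: "y = x + u" "s = x + w" unfolding u_def w_def by simp_all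
  have c: "cr u w \<noteq> 0" using xyz(2) unfolding u_def w_def .
  obtain a0 where a0: "a0 \<in> A" "A = convex hull A \<inter> (\<lambda>v. a0 + v) ` generated_lattice A"
    using sat unfolding saturated_def by blast
  let ?K = "(\<lambda>v. a0 + v) ` generated_lattice A"
  have AK: "A \<subseteq> ?K" using a0(2) by blast
  have mem: "q \<in> ?K \<longleftrightarrow> q - a0 \<in> generated_lattice A" for q by force
  have uw: "u \<in> generated_lattice A" "w \<in> generated_lattice A"
    unfolding generated_lattice_def u_def w_def using xyz(1) by (auto intro!: group_closure.base)
  have Kint: "q + of_int i *\<^sub>R u + of_int j *\<^sub>R w \<in> ?K" if "q \<in> ?K" for q and i j :: int
  proof -
    have "(q - a0) + (of_int i *\<^sub>R u + of_int j *\<^sub>R w) \<in> generated_lattice A"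
    proof -
      have "q - a0 \<in> generated_lattice A" using that mem by blast
      then show ?thesis
        using uw unfolding generated_lattice_def by (intro group_closure_add group_closure_of_int)
    qed
    then show ?thesis unfolding mem by (simp add: algebra_simps)
  qed
  have sub: "convex hull {x, y, s} \<subseteq> convex hull A" by (rule hull_mono[OF xyz(1)])
  have vertex: "q \<in> {x, x + u, x + w}" if "q \<in> ?K" "q \<in> convex hull {x, x + u, x + w}" for q
    using that a0(2) sub xyz(3) unfolding ys by blast
  have coords: "\<exists>i j::int. p = x + of_int i *\<^sub>R u + of_int j *\<^sub>R w" if p: "p \<in> ?K" for p
  proof -
    obtain \<alpha> \<beta> where ab: "p = x + \<alpha> *\<^sub>R u + \<beta> *\<^sub>R w" using coord_exists[OF c] by blast
    define f where "f = frac \<alpha>"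
    define g where "g = frac \<beta>"
    have fg: "0 \<le> f" "f < 1" "0 \<le> g" "g < 1" unfolding f_def g_def by (simp_all add: frac_lt_1)
    define q where "q = x + f *\<^sub>R u + g *\<^sub>R w"
    have "q = p + of_int (- \<lfloor>\<alpha>\<rfloor>) *\<^sub>R u + of_int (- \<lfloor>\<beta>\<rfloor>) *\<^sub>R w"
      unfolding q_def ab f_def g_def frac_def by (simp add: algebra_simps)
    then have qK: "q \<in> ?K" using Kint[OF p] by (simp only:)
    have "f = 0 \<and> g = 0"
    proof (cases "f + g \<le> 1")
      case True
      then have "q \<in> convex hull {x, x + u, x + w}" unfolding q_def coord_triangle[OF c] using fg by simp
      then have "q \<in> {x, x + u, x + w}" using vertex[OF qK] by simp
      then have "x + f *\<^sub>R u + g *\<^sub>R w = x + 0 *\<^sub>R u + 0 *\<^sub>R w \<or> x + f *\<^sub>R u + g *\<^sub>R w = x + 1 *\<^sub>R u + 0 *\<^sub>R w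
         \<or> x + f *\<^sub>R u + g *\<^sub>R w = x + 0 *\<^sub>R u + 1 *\<^sub>R w" unfolding q_def by auto
      then show ?thesis unfolding coord_unique[OF c] using fg by auto
    next
      case False
      \<comment> \<open>The reflection of \<open>q\<close> in the centre of the parallelogram, again
        a lattice point.\<close>
      let ?q' = "x + (1 - f) *\<^sub>R u + (1 - g) *\<^sub>R w"
      have "?q' - a0 = ((x - a0) + (x - a0) - (q - a0)) + (u + w)" unfolding q_def by (simp add: algebra_simps)
      moreover have "x - a0 \<in> generated_lattice A" using xyz(1) AK mem by blast
      moreover have "q - a0 \<in> generated_lattice A" using qK unfolding mem .
      moreover have "(s + s - t) + (u + w) \<in> generated_lattice A"
        if "s \<in> generated_lattice A" "t \<in> generated_lattice A" for s t
        using that uw unfolding generated_lattice_def by (intro group_closure_add group_closure.diff)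
      ultimately have "?q' - a0 \<in> generated_lattice A" by (simp only:)
      then have "?q' \<in> ?K" unfolding mem .
      moreover have "?q' \<in> convex hull {x, x + u, x + w}" unfolding coord_triangle[OF c] using fg False by simp
      ultimately have "?q' \<in> {x, x + u, x + w}" by (rule vertex)
      then have "?q' = x + 0 *\<^sub>R u + 0 *\<^sub>R w \<or> ?q' = x + 1 *\<^sub>R u + 0 *\<^sub>R w \<or> ?q' = x + 0 *\<^sub>R u + 1 *\<^sub>R w" by auto
      then show ?thesis unfolding coord_unique[OF c] using fg by auto
    qed
    then have "\<alpha> = of_int \<lfloor>\<alpha>\<rfloor>" "\<beta> = of_int \<lfloor>\<beta>\<rfloor>" unfolding f_def g_def frac_def by simp_all
    then show ?thesis using ab by metis
  qed
  have xK: "x \<in> ?K" using xyz(1) AK by blast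
  have "frame A x u w"
    unfolding frame_def
  proof (intro conjI ballI allI impI)
    show "cr u w \<noteq> 0" by (rule c)
    show "{x, x + u, x + w} \<subseteq> A" using xyz(1) unfolding ys .
    show "\<exists>i j. p = x + of_int i *\<^sub>R u + of_int j *\<^sub>R w" if "p \<in> A" for p using coords that AK by blast
    show "x + of_int i *\<^sub>R u + of_int j *\<^sub>R w \<in> A" if "x + of_int i *\<^sub>R u + of_int j *\<^sub>R w \<in> convex hull A" for i j :: int
      using that Kint[OF xK] a0(2) by blast
  qed
  then show ?thesis unfolding u_def w_def .
qed

section \<open>Recognising sets of type (b)\<close>

lemma hull3_mem:
  assumes "p \<in> S" "q \<in> S" "r \<in> S" "a + b + c = 1" "0 \<le> a" "0 \<le> b" "0 \<le> c"
  shows "a *\<^sub>R p + b *\<^sub>R q + c *\<^sub>R r \<in> convex hull S"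
proof -
  have "a *\<^sub>R p + b *\<^sub>R q + c *\<^sub>R r \<in> convex hull {p, q, r}" by (rule in_hull3I[OF assms(4-7)])
  moreover have "convex hull {p, q, r} \<subseteq> convex hull S" by (rule hull_mono) (use assms in auto)
  ultimately show ?thesis by blast
qed

lemma interior3I:
  assumes D: "cr (q - p) (r - p) \<noteq> 0" and "a + b + c = 1" "0 < a" "0 < b" "0 < c"
  shows "a *\<^sub>R p + b *\<^sub>R q + c *\<^sub>R r \<in> interior (convex hull {p, q, r})"
proof -
  have "DIM(real^2) = 2" by simp
  moreover have "\<not> collinear {p, q, r}" using D cr_collinear by blast
  ultimately show ?thesis using interior_convex_hull_3_minimal[of p q r] assms by blast
qed

lemma comb_on_axis:
  assumes f: "frame A x u w" and fin: "finite A" and v: "v = x - a *\<^sub>R u - h *\<^sub>R w" and ah: "a > 0" "h > 0"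
    and axis: "\<And>p. p \<in> A \<Longrightarrow> (\<exists>i::nat. p = x + real i *\<^sub>R u) \<or> p = x + w"
  shows "comb_set (insert v A)"
proof -
  have c: "cr u w \<noteq> 0" by (rule frameD(1)[OF f])
  have u0: "u \<noteq> 0" using c by auto
  define M where "M = {i::nat. x + real i *\<^sub>R u \<in> A}"
  have inj: "inj (\<lambda>i::nat. x + real i *\<^sub>R u)" using u0 by (intro injI) simp
  have finM: "finite M" unfolding M_def using finite_vimageI[OF fin inj] by (simp add: vimage_def)
  have oneM: "1 \<in> M" unfolding M_def using frameD(3)[OF f] by simp
  define m where "m = Max M"
  have m1: "m \<ge> 1" unfolding m_def using finM oneM by simp
  have mM: "m \<in> M" unfolding m_def using finM oneM by (intro Max_in) auto
  then have mA: "x + real m *\<^sub>R u \<in> A" unfolding M_def by simp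
  have le: "i \<le> m" if "x + real i *\<^sub>R u \<in> A" for i
    unfolding m_def using finM that by (intro Max_ge) (simp_all add: M_def)
  have in_A: "x + real i *\<^sub>R u \<in> A" if "i \<le> m" for i
  proof -
    have "(1 - real i / real m) *\<^sub>R x + (real i / real m) *\<^sub>R (x + real m *\<^sub>R u) + 0 *\<^sub>R x \<in> convex hull A"
      by (rule hull3_mem) (use that m1 mA frameD(2)[OF f] in auto)
    also have "(1 - real i / real m) *\<^sub>R x + (real i / real m) *\<^sub>R (x + real m *\<^sub>R u) + 0 *\<^sub>R x = x + of_int (int i) *\<^sub>R u + of_int 0 *\<^sub>R w"
      using m1 by (simp add: algebra_simps)
    finally show ?thesis using frameD(6)[OF f, of "int i" 0] by simp
  qed
  have "A = (\<lambda>i. x + real i *\<^sub>R u) ` {..m} \<union> {x + w}"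
  proof
    show "A \<subseteq> (\<lambda>i. x + real i *\<^sub>R u) ` {..m} \<union> {x + w}" using axis le by blast
    show "(\<lambda>i. x + real i *\<^sub>R u) ` {..m} \<union> {x + w} \<subseteq> A" using in_A frameD(4)[OF f] by auto
  qed
  then have eq: "insert v A = (\<lambda>i. x + real i *\<^sub>R u) ` {..m} \<union> {x + w, v}" by auto
  have int: "x + real i *\<^sub>R u \<in> interior (convex hull {x + real m *\<^sub>R u, x + w, v})" if i: "i < m" for i
  proof -
    have m0: "real m > 0" using m1 by simp
    let ?p = "x + real m *\<^sub>R u" and ?q = "x + w"
    have "cr (?q - ?p) (v - ?p) = (a + real m + real m * h) * cr u w"
      unfolding v by (simp add: cr_simps cr_anti[of w u] algebra_simps)
    moreover have "a + real m + real m * h > 0" using ah m0 by (simp add: add_pos_nonneg)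
    ultimately have D: "cr (?q - ?p) (v - ?p) \<noteq> 0" using c by simp
    \<comment> \<open>Since \<open>v - x\<close> is \<open>- a *\<^sub>R u - h *\<^sub>R w\<close>,
      the point \<open>x\<close> is the average of \<open>?p\<close>, \<open>?q\<close>,
      \<open>v\<close> with weights proportional to \<open>a / real m\<close>, \<open>h\<close>, 1;
      \<open>\<nu>\<close> normalises them. The point with index \<open>i\<close> then mixes
      \<open>x\<close> and \<open>?p\<close> in the ratio \<open>1 - i / m\<close> to
      \<open>i / m\<close>.\<close>
    define \<nu> where "\<nu> = 1 / (1 + a / real m + h)"
    have pos: "1 + a / real m + h > 0" using ah m0 by (simp add: add_pos_pos)
    have \<nu>: "\<nu> > 0" "\<nu> * (1 + a / real m + h) = 1" unfolding \<nu>_def using pos by simp_all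
    define \<rho> where "\<rho> = (1 - real i / real m) * \<nu>"
    have \<rho>: "\<rho> > 0" unfolding \<rho>_def using i m0 \<nu> by simp
    have \<rho>s: "\<rho> * (1 + a / real m + h) = 1 - real i / real m" unfolding \<rho>_def mult.assoc \<nu>(2) by simp
    define \<alpha> where "\<alpha> = \<rho> * (a / real m) + real i / real m"
    have s: "\<alpha> + \<rho> * h + \<rho> = 1" unfolding \<alpha>_def using \<rho>s by (simp add: algebra_simps)
    have \<alpha>: "\<alpha> > 0" unfolding \<alpha>_def using \<rho> ah m0 by (simp add: add_pos_nonneg)
    have am: "\<alpha> * real m - \<rho> * a = real i" unfolding \<alpha>_def using m0 by (simp add: field_simps)
    have "\<alpha> *\<^sub>R ?p + (\<rho> * h) *\<^sub>R ?q + \<rho> *\<^sub>R v \<in> interior (convex hull {?p, ?q, v})"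
      by (rule interior3I[OF D s]) (use \<alpha> \<rho> ah in auto)
    also have "\<alpha> *\<^sub>R ?p + (\<rho> * h) *\<^sub>R ?q + \<rho> *\<^sub>R v = (\<alpha> + \<rho> * h + \<rho>) *\<^sub>R x + (\<alpha> * real m - \<rho> * a) *\<^sub>R u"
      unfolding v by (simp add: algebra_simps)
    finally show ?thesis unfolding s am by simp
  qed
  show ?thesis unfolding comb_set_def using eq int m1 by blast
qed

text \<open>The missing point \<open>x + u + w\<close> would lie in the hull if some point of
  \<open>A\<close> were off both axes, or if both axes carried a point at distance 2 or more. So one
  axis carries a progression and the other a single further point.\<close>

lemma comb_from_quadrant:
  assumes f: "frame A x u w" and fin: "finite A" and v: "v = x - a *\<^sub>R u - h *\<^sub>R w" and ah: "a > 0" "h > 0"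
    and out: "x + u + w \<notin> A"
    and quad: "\<And>p i j. p \<in> A \<Longrightarrow> p = x + of_int i *\<^sub>R u + of_int j *\<^sub>R w \<Longrightarrow> 0 \<le> i \<and> 0 \<le> j"
  shows "comb_set (insert v A)"
proof -
  have c: "cr u w \<noteq> 0" by (rule frameD(1)[OF f])
  have notin: "x + u + w \<notin> convex hull A" using frameD(6)[OF f, of 1 1] out by auto
  have axes: "i = 0 \<or> j = 0" if p: "p \<in> A" "p = x + of_int i *\<^sub>R u + of_int j *\<^sub>R w" for p and i j :: int
  proof (rule ccontr)
    assume "\<not> (i = 0 \<or> j = 0)"
    then have ij: "i \<ge> 1" "j \<ge> 1" using quad[OF p] by auto
    show False
    proof (cases "j \<le> i")
      case True
      \<comment> \<open>The weight \<open>1 / i\<close> brings the \<open>u\<close>-coordinate to 1,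
        and \<open>x + w\<close> supplies what is then missing in the
        \<open>w\<close>-coordinate.\<close>
      have "(1 / of_int i) *\<^sub>R p + (1 - of_int j / of_int i) *\<^sub>R (x + w) + ((of_int j - 1) / of_int i) *\<^sub>R x \<in> convex hull A"
        by (rule hull3_mem[OF p(1) frameD(4)[OF f] frameD(2)[OF f]]) (use ij True in \<open>auto simp: field_simps\<close>)
      also have "(1 / of_int i) *\<^sub>R p + (1 - of_int j / of_int i) *\<^sub>R (x + w) + ((of_int j - 1) / of_int i) *\<^sub>R x
          = (1 / of_int i + (1 - of_int j / of_int i) + (of_int j - 1) / of_int i) *\<^sub>R x + (of_int i / of_int i) *\<^sub>R u + (of_int j / of_int i + (1 - of_int j / of_int i)) *\<^sub>R w"
        unfolding p(2) by (simp add: algebra_simps)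
      also have "\<dots> = x + u + w" using ij by (simp add: field_simps)
      finally show False using notin by simp
    next
      case False
      have "(1 / of_int j) *\<^sub>R p + (1 - of_int i / of_int j) *\<^sub>R (x + u) + ((of_int i - 1) / of_int j) *\<^sub>R x \<in> convex hull A"
        by (rule hull3_mem[OF p(1) frameD(3)[OF f] frameD(2)[OF f]]) (use ij False in \<open>auto simp: field_simps\<close>)
      also have "(1 / of_int j) *\<^sub>R p + (1 - of_int i / of_int j) *\<^sub>R (x + u) + ((of_int i - 1) / of_int j) *\<^sub>R x
          = (1 / of_int j + (1 - of_int i / of_int j) + (of_int i - 1) / of_int j) *\<^sub>R x + (of_int i / of_int j + (1 - of_int i / of_int j)) *\<^sub>R u + (of_int j / of_int j) *\<^sub>R w"
        unfolding p(2) by (simp add: algebra_simps)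
      also have "\<dots> = x + u + w" using ij by (simp add: field_simps)
      finally show False using notin by simp
    qed
  qed
  have not_both: False if p: "x + of_int i *\<^sub>R u \<in> A" "x + of_int j *\<^sub>R w \<in> A" "i \<ge> 2" "j \<ge> 2" for i j :: int
  proof -
    have le: "1 / real_of_int i \<le> 1 / 2" "1 / real_of_int j \<le> 1 / 2" using that by (simp_all add: field_simps)
    have nn: "0 \<le> 1 / real_of_int i" "0 \<le> 1 / real_of_int j" using that by simp_all
    have nn3: "0 \<le> 1 - 1 / real_of_int i - 1 / real_of_int j" using le by linarith
    have "(1 / of_int i) *\<^sub>R (x + of_int i *\<^sub>R u) + (1 / of_int j) *\<^sub>R (x + of_int j *\<^sub>R w) + (1 - 1 / of_int i - 1 / of_int j) *\<^sub>R x \<in> convex hull A"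
      by (rule hull3_mem[OF p(1,2) frameD(2)[OF f] _ nn nn3]) simp
    also have "(1 / of_int i) *\<^sub>R (x + of_int i *\<^sub>R u) + (1 / of_int j) *\<^sub>R (x + of_int j *\<^sub>R w) + (1 - 1 / of_int i - 1 / of_int j) *\<^sub>R x
        = x + (of_int i / of_int i) *\<^sub>R u + (of_int j / of_int j) *\<^sub>R w" by (simp add: algebra_simps)
    also have "\<dots> = x + u + w" using that by simp
    finally show False using notin by simp
  qed
  have nat_of: "\<exists>n::nat. x + of_int i *\<^sub>R u' = x + real n *\<^sub>R u'" if "0 \<le> i" for i :: int and u' :: "real^2"
    using that by (intro exI[of _ "nat i"]) simp
  show ?thesis
  proof (cases "\<exists>j\<ge>2. x + of_int j *\<^sub>R w \<in> A")
    case False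
    show ?thesis
    proof (rule comb_on_axis[OF f fin v ah])
      fix p assume p: "p \<in> A"
      obtain i j :: int where ij: "p = x + of_int i *\<^sub>R u + of_int j *\<^sub>R w" using frameD(5)[OF f p] by blast
      note q = quad[OF p ij] axes[OF p ij]
      show "(\<exists>i::nat. p = x + real i *\<^sub>R u) \<or> p = x + w"
      proof (cases "j = 0")
        case True
        then show ?thesis using nat_of[of i u] q ij by simp
      next
        case j: False
        then have i0: "i = 0" using q by simp
        have "j < 2"
        proof (rule ccontr)
          assume "\<not> j < 2"
          moreover have "x + of_int j *\<^sub>R w \<in> A" using p ij i0 by simp
          ultimately show False using False by simp
        qed
        then have "j = 1" using j q by simp
        then show ?thesis using i0 ij by simp
      qed
    qed
  next
    case True
    show ?thesis
    proof (rule comb_on_axis[OF frame_swap[OF f] fin _ ah(2,1)])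
      show "v = x - h *\<^sub>R w - a *\<^sub>R u" unfolding v by simp
      fix p assume p: "p \<in> A"
      obtain i j :: int where ij: "p = x + of_int i *\<^sub>R u + of_int j *\<^sub>R w" using frameD(5)[OF f p] by blast
      note q = quad[OF p ij] axes[OF p ij]
      show "(\<exists>i::nat. p = x + real i *\<^sub>R w) \<or> p = x + u"
      proof (cases "i = 0")
        case True
        then show ?thesis using nat_of[of j w] q ij by simp
      next
        case i: False
        then have j0: "j = 0" using q by simp
        have "i < 2"
        proof (rule ccontr)
          assume i2: "\<not> i < 2"
          have "x + of_int i *\<^sub>R u \<in> A" using p ij j0 by simp
          moreover obtain j' :: int where "j' \<ge> 2" "x + of_int j' *\<^sub>R w \<in> A" using True by blast
          ultimately show False using not_both[of i j'] i2 by simp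
        qed
        then have "i = 1" using i q by simp
        then show ?thesis using j0 ij by simp
      qed
    qed
  qed
qed

lemma cr_flip: "cr (x - y) (p - y) = - cr (y - x) (p - x)"
  by (simp add: cr_def algebra_simps)

lemma sq_pos: "a \<noteq> 0 \<Longrightarrow> 0 < a * a" for a :: real
  using not_real_square_gt_zero by blast

section \<open>Adding a point to a saturated set\<close>

lemma six_coord:
  assumes c: "cr u w \<noteq> 0" and m: "x + \<alpha> *\<^sub>R u + \<beta> *\<^sub>R w \<in> six x (x + u) (x + w)"
  shows "\<beta> \<in> {0, 1/2, 1}" "\<beta> = 0 \<Longrightarrow> \<alpha> \<in> {0, 1/2, 1}"
proof -
  have e: "x = x + 0 *\<^sub>R u + 0 *\<^sub>R w" "x + u = x + 1 *\<^sub>R u + 0 *\<^sub>R w" "x + w = x + 0 *\<^sub>R u + 1 *\<^sub>R w"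
    "midpoint x (x + u) = x + (1/2) *\<^sub>R u + 0 *\<^sub>R w" "midpoint (x + u) (x + w) = x + (1/2) *\<^sub>R u + (1/2) *\<^sub>R w"
    "midpoint x (x + w) = x + 0 *\<^sub>R u + (1/2) *\<^sub>R w"
    by (simp_all add: midpoint_def vec_eq_iff forall_2 field_simps)
  have "(\<alpha> = 0 \<and> \<beta> = 0) \<or> (\<alpha> = 1 \<and> \<beta> = 0) \<or> (\<alpha> = 0 \<and> \<beta> = 1) \<or> (\<alpha> = 1/2 \<and> \<beta> = 0) \<or> (\<alpha> = 1/2 \<and> \<beta> = 1/2) \<or> (\<alpha> = 0 \<and> \<beta> = 1/2)"
  proof -
    have "six x (x + u) (x + w) = {x + 0 *\<^sub>R u + 0 *\<^sub>R w, x + 1 *\<^sub>R u + 0 *\<^sub>R w, x + 0 *\<^sub>R u + 1 *\<^sub>R w,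
      x + (1/2) *\<^sub>R u + 0 *\<^sub>R w, x + (1/2) *\<^sub>R u + (1/2) *\<^sub>R w, x + 0 *\<^sub>R u + (1/2) *\<^sub>R w}"
      unfolding six_def by (intro arg_cong2[of _ _ _ _ insert] e refl)
    then show ?thesis using m by (simp only: insert_iff empty_iff coord_unique[OF c]) blast
  qed
  then show "\<beta> \<in> {0, 1/2, 1}" "\<beta> = 0 \<Longrightarrow> \<alpha> \<in> {0, 1/2, 1}" by auto
qed

lemma rigidD:
  assumes "rigid A" "{x, y, z} \<subseteq> A" "cr (y - x) (z - x) \<noteq> 0" "A \<inter> convex hull {x, y, z} = {x, y, z}"
    "a \<in> A" "b \<in> A" "midpoint a b \<in> convex hull {x, y, z}"
  shows "midpoint a b \<in> six x y z"
  using assms(1)[unfolded rigid_def, rule_format, OF assms(2-7)] .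

text \<open>The inductive step in isolation: \<open>A\<close> is what remains after deletion of the
  extreme point \<open>v\<close>.\<close>

locale cone_point =
  fixes A :: "(real^2) set" and v :: "real^2"
  assumes fin: "finite A" and nc: "\<not> collinear A" and sat: "saturated A"
    and out: "v \<notin> convex hull A" and rig: "rigid (insert v A)"
begin

text \<open>Edges between consecutive points of \<open>A\<close> on the boundary of the hull, seen
  from \<open>v\<close>. The product is nonpositive when \<open>p\<close> and \<open>v\<close> are
  on opposite sides of the line \<open>x y\<close>, or \<open>p\<close> is on it.\<close>

definition vis :: "real^2 \<Rightarrow> real^2 \<Rightarrow> bool" where
  "vis x y \<longleftrightarrow> x \<in> A \<and> y \<in> A \<and> x \<noteq> y \<and> A \<inter> closed_segment x y = {x, y} \<and> cr (y - x) (v - x) \<noteq> 0 \<and>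
     (\<forall>p\<in>A. cr (y - x) (p - x) * cr (y - x) (v - x) \<le> 0)"

text \<open>\<open>v\<close> lies in the lattice row next to the edge on its outer side, so that
  \<open>v x y\<close> is again a lattice triangle of minimal area.\<close>

definition unimodular :: "real^2 \<Rightarrow> real^2 \<Rightarrow> bool" where
  "unimodular x y \<longleftrightarrow> (\<exists>w. \<exists>k::int. frame A x (y - x) w \<and> v = x + of_int k *\<^sub>R (y - x) - w)"

text \<open>The last equation puts \<open>x\<close> in the interior of the triangle \<open>v, y, x + w\<close>, and \<open>y + w \<notin> A\<close> makes
  \<open>x + w\<close> the last point of its lattice row.\<close>

definition corner :: "real^2 \<Rightarrow> real^2 \<Rightarrow> bool" where
  "corner x y \<longleftrightarrow> (\<exists>w a h. a > 0 \<and> h > 0 \<and> frame A x (y - x) w \<and> y + w \<notin> A \<and> v = x - a *\<^sub>R (y - x) - h *\<^sub>R w)"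

lemma vis_sym: "vis x y \<Longrightarrow> vis y x"
  unfolding vis_def by (auto simp: cr_flip[of x y] closed_segment_commute[of y x])

text \<open>An empty triangle on the edge is a frame by saturation, and \<open>v\<close> lies across
  the edge from it, so its coordinate along \<open>w\<close> is negative.\<close>

lemma vis_frame:
  assumes "vis x y"
  obtains w v1 h where "frame A x (y - x) w" "h > 0" "v = x + v1 *\<^sub>R (y - x) - h *\<^sub>R w"
proof -
  note V = assms[unfolded vis_def]
  obtain z where z: "z \<in> A" "cr (y - x) (z - x) \<noteq> 0" using point_off_line[OF nc, of x y] V by blast
  obtain s where s: "s \<in> A" "cr (y - x) (s - x) \<noteq> 0" "A \<inter> convex hull {x, y, s} = {x, y, s}"
    using empty_triangle_on_edge[OF fin _ _ _ z] V by blast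
  have f: "frame A x (y - x) (s - x)" by (rule saturated_frame[OF sat _ s(2,3)]) (use V s in auto)
  let ?c = "cr (y - x) (s - x)"
  obtain v1 v2 where v: "v = x + v1 *\<^sub>R (y - x) + v2 *\<^sub>R (s - x)" using coord_exists[OF s(2)] by blast
  have "v - x = v1 *\<^sub>R (y - x) + v2 *\<^sub>R (s - x)" using v by (metis add_diff_cancel_left' add.assoc)
  then have cv: "cr (y - x) (v - x) = v2 * ?c" by (simp add: cr_simps(3,6))
  have "v2 \<noteq> 0" using V unfolding cv by auto
  moreover have "?c * (v2 * ?c) \<le> 0" using V s(1) unfolding cv by blast
  then have "v2 \<le> 0" using s(2) by (simp add: mult_le_0_iff zero_le_mult_iff) (metis linorder_neqE_linordered_idom order_less_imp_le not_le)
  ultimately have "- v2 > 0" by simp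
  moreover have "v = x + v1 *\<^sub>R (y - x) - (- v2) *\<^sub>R (s - x)" using v by simp
  ultimately show ?thesis using that f by blast
qed

lemma vis_height:
  assumes V: "vis x y" and f: "frame A x (y - x) w" and v: "v = x + v1 *\<^sub>R (y - x) - h *\<^sub>R w" and h: "h > 0"
    and p: "p \<in> A" "p = x + s *\<^sub>R (y - x) + t *\<^sub>R w"
  shows "0 \<le> t"
proof -
  let ?c = "cr (y - x) w"
  have c: "?c \<noteq> 0" by (rule frameD(1)[OF f])
  have "p - x = s *\<^sub>R (y - x) + t *\<^sub>R w" "v - x = v1 *\<^sub>R (y - x) - h *\<^sub>R w" using p(2) v by simp_all
  then have "cr (y - x) (p - x) = t * ?c" "cr (y - x) (v - x) = - h * ?c" by (simp_all add: cr_simps(3,4,6))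
  then have "(t * ?c) * (- h * ?c) \<le> 0" using V p(1) unfolding vis_def by metis
  then have "0 \<le> t * (h * (?c * ?c))" by (simp add: algebra_simps)
  moreover have "h * (?c * ?c) > 0" using h c by (simp add: sq_pos mult_pos_pos)
  ultimately show ?thesis by (simp add: zero_le_mult_iff)
qed

lemma rigid_frame:
  assumes f: "frame A x u w" and ab: "a \<in> insert v A" "b \<in> insert v A" "midpoint a b \<in> convex hull {x, x + u, x + w}"
  shows "midpoint a b \<in> six x (x + u) (x + w)"
proof -
  have "convex hull {x, x + u, x + w} \<subseteq> convex hull A" by (rule hull_mono) (use frameD(2-4)[OF f] in auto)
  then have "insert v A \<inter> convex hull {x, x + u, x + w} = {x, x + u, x + w}"
    using out frame_empty[OF f] by blast
  moreover have "cr ((x + u) - x) ((x + w) - x) \<noteq> 0" using frameD(1)[OF f] by simp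
  moreover have "{x, x + u, x + w} \<subseteq> insert v A" using frameD(2-4)[OF f] by blast
  ultimately show ?thesis by (intro rigidD[OF rig _ _ _ ab])
qed

lemma vis_empty:
  assumes V: "vis x y"
  shows "insert v A \<inter> convex hull {v, x, y} = {v, x, y}"
proof
  note V' = V[unfolded vis_def]
  show "{v, x, y} \<subseteq> insert v A \<inter> convex hull {v, x, y}" using V' hull_subset[of "{v, x, y}" convex] by blast
  show "insert v A \<inter> convex hull {v, x, y} \<subseteq> {v, x, y}"
  proof
    fix p assume p: "p \<in> insert v A \<inter> convex hull {v, x, y}"
    show "p \<in> {v, x, y}"
    proof (cases "p = v")
      case False
      then have pA: "p \<in> A" using p by blast
      obtain a b c where abc: "0 \<le> a" "0 \<le> b" "0 \<le> c" "a + b + c = 1" "p = a *\<^sub>R v + b *\<^sub>R x + c *\<^sub>R y"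
        using p by (auto simp: convex_hull_3)
      have b: "b = 1 - a - c" using abc(4) by simp
      have "p - x = a *\<^sub>R (v - x) + c *\<^sub>R (y - x)" unfolding abc(5) b by (simp add: algebra_simps)
      then have "cr (y - x) (p - x) = a * cr (y - x) (v - x)" by (simp add: cr_simps(3,6))
      moreover have "cr (y - x) (p - x) * cr (y - x) (v - x) \<le> 0" using V' pA by blast
      ultimately have "a * (cr (y - x) (v - x) * cr (y - x) (v - x)) \<le> 0" by (simp only: mult.assoc)
      moreover have "cr (y - x) (v - x) * cr (y - x) (v - x) > 0" using V' sq_pos by blast
      ultimately have "\<not> 0 < a" using mult_pos_pos linorder_not_less by blast
      then have "a = 0" using abc(1) by simp
      then have "p \<in> closed_segment x y" using abc b by (auto simp: in_segment)
      then show ?thesis using V' pA by blast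
    qed simp
  qed
qed

lemma rigid_vis:
  assumes V: "vis x y" and ab: "a \<in> insert v A" "b \<in> insert v A" "midpoint a b \<in> convex hull {v, x, y}"
  shows "midpoint a b \<in> six v x y"
proof -
  have "cr (x - v) (y - v) = cr (y - x) (v - x)" by (simp add: cr_def algebra_simps)
  then have "cr (x - v) (y - v) \<noteq> 0" using V unfolding vis_def by simp
  moreover have "{v, x, y} \<subseteq> insert v A" using V unfolding vis_def by blast
  ultimately show ?thesis by (intro rigidD[OF rig _ _ vis_empty[OF V] ab])
qed

text \<open>The bounds on \<open>t\<close> say that the segment from \<open>v\<close> to
  \<open>x + w\<close> crosses the edge. Its midpoint lies in one of the two empty triangles on the
  edge. If \<open>h \<le> 1\<close> it is the inner one, and rigidity there forces
  \<open>h = 1\<close> and integral \<open>t\<close>; if \<open>h > 1\<close> it is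
  \<open>v x y\<close>, whose six points all have other heights.\<close>

lemma crossing_unimodular:
  assumes V: "vis x y" and f: "frame A x (y - x) w" and v: "v = x + t *\<^sub>R (y - x) - h *\<^sub>R w" and h: "h > 0"
    and t: "0 \<le> t" "t \<le> 1 + h"
  shows "unimodular x y"
proof -
  define u where "u = y - x"
  have y: "y = x + u" unfolding u_def by simp
  have f: "frame A x u w" and v: "v = x + t *\<^sub>R u - h *\<^sub>R w" using f v unfolding u_def by auto
  have c: "cr u w \<noteq> 0" by (rule frameD(1)[OF f])
  let ?m = "midpoint v (x + w)"
  have m: "?m = x + (t / 2) *\<^sub>R u + ((1 - h) / 2) *\<^sub>R w"
    unfolding v midpoint_def by (simp add: vec_eq_iff forall_2 field_simps)
  show ?thesis
  proof (cases "h \<le> 1")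
    case True
    have "?m \<in> convex hull {x, x + u, x + w}" unfolding m coord_triangle[OF c] using True t by (simp add: field_simps)
    then have "?m \<in> six x (x + u) (x + w)" using rigid_frame[OF f] frameD(4)[OF f] by blast
    note s = six_coord[OF c this[unfolded m]]
    have "h = 1" using s(1) h by auto
    then have "t / 2 \<in> {0, 1/2, 1}" using s(2) by simp
    then have "t = of_int 0 \<or> t = of_int 1 \<or> t = of_int 2" by auto
    then obtain k :: int where k: "t = of_int k" by blast
    then have "v = x + of_int k *\<^sub>R (y - x) - w" using v \<open>h = 1\<close> unfolding u_def k by simp
    then show ?thesis using f unfolding unimodular_def u_def by blast
  next
    case False
    \<comment> \<open>The barycentric coordinates of the midpoint in \<open>v x y\<close>:
      \<open>a\<close> is found from the height \<open>- (a * h) = (1 - h) / 2\<close>, the others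
      from the coordinate along the edge.\<close>
    define a where "a = (h - 1) / (2 * h)"
    define b where "b = (h + 1 - t) / (2 * h)"
    define b' where "b' = t / (2 * h)"
    have nn: "0 \<le> a" "0 \<le> b" "0 \<le> b'" unfolding a_def b_def b'_def using False h t by auto
    have s: "a + b + b' = 1" unfolding a_def b_def b'_def using h by (simp add: field_simps)
    have e1: "a * t + b' = t / 2" "- (a * h) = (1 - h) / 2" unfolding a_def b'_def using h by (simp_all add: field_simps)
    have "a *\<^sub>R v + b *\<^sub>R x + b' *\<^sub>R y = (a + b + b') *\<^sub>R x + (a * t + b') *\<^sub>R u + (- (a * h)) *\<^sub>R w"
      unfolding v y by (simp add: algebra_simps)
    also have "\<dots> = ?m" unfolding s e1 m by simp
    finally have "?m \<in> convex hull {v, x, y}" using in_hull3I[OF s nn, of v x y] by simp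
    then have mem: "?m \<in> six v x y" using rigid_vis[OF V] frameD(4)[OF f] by blast
    have e: "v = x + t *\<^sub>R u + (- h) *\<^sub>R w" "x = x + 0 *\<^sub>R u + 0 *\<^sub>R w" "y = x + 1 *\<^sub>R u + 0 *\<^sub>R w"
      "midpoint v x = x + (t/2) *\<^sub>R u + (- h / 2) *\<^sub>R w" "midpoint x y = x + (1/2) *\<^sub>R u + 0 *\<^sub>R w"
      "midpoint v y = x + ((t + 1) / 2) *\<^sub>R u + (- h / 2) *\<^sub>R w"
      unfolding v y midpoint_def by (simp_all add: vec_eq_iff forall_2 field_simps)
    have sx: "six v x y = {x + t *\<^sub>R u + (- h) *\<^sub>R w, x + 0 *\<^sub>R u + 0 *\<^sub>R w, x + 1 *\<^sub>R u + 0 *\<^sub>R w,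
      x + (t/2) *\<^sub>R u + (- h / 2) *\<^sub>R w, x + (1/2) *\<^sub>R u + 0 *\<^sub>R w, x + ((t + 1) / 2) *\<^sub>R u + (- h / 2) *\<^sub>R w}"
      unfolding six_def using e by (intro arg_cong2[of _ _ _ _ insert] refl)
    have "(1 - h) / 2 = - h \<or> (1 - h) / 2 = 0 \<or> (1 - h) / 2 = - h / 2"
      using mem[unfolded sx m] by (simp only: insert_iff empty_iff coord_unique[OF c]) blast
    then show ?thesis using False h by (auto simp: field_simps)
  qed
qed

text \<open>\<open>J\<close> lists the points of \<open>A\<close> in the first lattice row behind
  the edge. Taking point \<open>j\<close> as third frame point changes the coordinate of
  \<open>v\<close> along the edge to \<open>v1 + j * h\<close>. A value between 0 and
  \<open>1 + h\<close> means a crossing; otherwise a corner is found at the end of the row or where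
  the values jump.\<close>

lemma vis_trichotomy:
  assumes V: "vis x y"
  shows "unimodular x y \<or> corner x y \<or> corner y x"
proof -
  obtain w v1 h where f0: "frame A x (y - x) w" and h: "h > 0" and v0: "v = x + v1 *\<^sub>R (y - x) - h *\<^sub>R w"
    using vis_frame[OF V] by blast
  define u where "u = y - x"
  have y: "y = x + u" unfolding u_def by simp
  have f: "frame A x u w" and v: "v = x + v1 *\<^sub>R u - h *\<^sub>R w" using f0 v0 unfolding u_def by auto
  have c: "cr u w \<noteq> 0" by (rule frameD(1)[OF f])
  have u0: "u \<noteq> 0" using c by auto
  define J where "J = {j::int. x + of_int j *\<^sub>R u + w \<in> A}"
  have inj: "inj (\<lambda>j::int. x + of_int j *\<^sub>R u + w)" using u0 by (intro injI) simp
  have finJ: "finite J" unfolding J_def using finite_vimageI[OF fin inj] by (simp add: vimage_def)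
  have J0: "0 \<in> J" unfolding J_def using frameD(4)[OF f] by simp
  have fj: "frame A x u (w + of_int j *\<^sub>R u)" if "j \<in> J" for j
    using frame_shift[OF f, of j] that unfolding J_def by simp
  have vj: "v = x + (v1 + of_int j * h) *\<^sub>R u - h *\<^sub>R (w + of_int j *\<^sub>R u)" for j :: int
    unfolding v by (simp add: algebra_simps)
  show ?thesis
  proof (cases "\<exists>j\<in>J. 0 \<le> v1 + of_int j * h \<and> v1 + of_int j * h \<le> 1 + h")
    case True
    then obtain j where j: "j \<in> J" "0 \<le> v1 + of_int j * h" "v1 + of_int j * h \<le> 1 + h" by blast
    show ?thesis
      using crossing_unimodular[OF V fj[OF j(1), unfolded u_def] vj[of j, unfolded u_def] h j(2,3)] by blast
  next
    case False
    then have bad: "v1 + of_int j * h < 0 \<or> v1 + of_int j * h > 1 + h" if "j \<in> J" for j using that by force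
    show ?thesis
    proof (cases "\<exists>j\<in>J. v1 + of_int j * h < 0")
      case True
      define L where "L = {j \<in> J. v1 + of_int j * h < 0}"
      have L: "finite L" "L \<noteq> {}" using finJ True unfolding L_def by auto
      define j where "j = Max L"
      have jL: "j \<in> L" unfolding j_def using L by simp
      then have j: "j \<in> J" "v1 + of_int j * h < 0" unfolding L_def by auto
      \<comment> \<open>One step in the row changes the coordinate by \<open>h\<close>, too little
        to jump over the interval from 0 to \<open>1 + h\<close>.\<close>
      have "j + 1 \<notin> J"
      proof
        assume j1: "j + 1 \<in> J"
        have "j + 1 \<notin> L" using Max_ge[OF L(1), of "j + 1"] unfolding j_def by auto
        then have "v1 + of_int (j + 1) * h > 1 + h" using bad[OF j1] j1 unfolding L_def by auto
        then show False using j(2) by (simp add: algebra_simps)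
      qed
      then have "y + (w + of_int j *\<^sub>R u) \<notin> A" unfolding J_def y by (simp add: algebra_simps)
      moreover have "v = x - (- (v1 + of_int j * h)) *\<^sub>R (y - x) - h *\<^sub>R (w + of_int j *\<^sub>R u)"
        using vj[of j] unfolding u_def by (simp add: algebra_simps)
      moreover have "frame A x (y - x) (w + of_int j *\<^sub>R u)" using fj[OF j(1)] unfolding u_def .
      moreover have "- (v1 + of_int j * h) > 0" using j(2) by simp
      ultimately have "corner x y" using h unfolding corner_def by blast
      then show ?thesis by blast
    next
      case False
      define j where "j = Min J"
      have jJ: "j \<in> J" unfolding j_def using finJ J0 by (intro Min_in) auto
      have big: "v1 + of_int j * h > 1 + h" using bad[OF jJ] False jJ by blast
      have j1: "j - 1 \<notin> J"
      proof
        assume "j - 1 \<in> J"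
        then have "j \<le> j - 1" unfolding j_def using finJ by (intro Min_le)
        then show False by simp
      qed
      \<comment> \<open>The mirror case: the same empty triangle is read from \<open>y\<close>,
        where \<open>v\<close> gets the coordinate \<open>1 + h - (v1 + j * h) < 0\<close> along
        \<open>x - y\<close>.\<close>
      define w' where "w' = w + of_int j *\<^sub>R u"
      have fw: "frame A x u w'" unfolding w'_def by (rule fj[OF jJ])
      have "A \<inter> convex hull {y, x, x + w'} = {y, x, x + w'}"
        using frame_empty[OF fw] unfolding y by (simp add: insert_commute)
      moreover have "cr (x - y) ((x + w') - y) \<noteq> 0" using frameD(1)[OF fw] unfolding y by (simp add: cr_simps)
      ultimately have fy: "frame A y (x - y) ((x + w') - y)"
        using saturated_frame[OF sat, of y x "x + w'"] frameD(2-4)[OF fw] unfolding y by simp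
      have "x + ((x + w') - y) \<notin> A" using j1 unfolding J_def w'_def y by (simp add: algebra_simps)
      moreover have "v = y - (v1 + of_int j * h - 1 - h) *\<^sub>R (x - y) - h *\<^sub>R ((x + w') - y)"
        using vj[of j] unfolding w'_def[symmetric] y by (simp add: algebra_simps)
      moreover have "v1 + of_int j * h - 1 - h > 0" using big by simp
      ultimately have "corner y x" using fy h unfolding corner_def by blast
      then show ?thesis by blast
    qed
  qed
qed

text \<open>Gift wrapping: \<open>f\<close> minimises a slope over the points on one side of the line \<open>vx\<close>.\<close>

lemma next_edge:
  assumes x: "x \<in> A" and \<phi>: "linear \<phi>" "\<And>p. p \<in> A \<Longrightarrow> 0 \<le> \<phi> (p - x)" "\<phi> (v - x) < (0::real)"
    and q: "q \<in> A" "\<kappa> * cr (v - x) (q - x) > 0"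
  obtains f where "f \<in> A" "\<kappa> * cr (v - x) (f - x) > 0" "vis f x"
proof -
  define \<psi> where "\<psi> p = \<kappa> * cr (v - x) (p - x)" for p
  define S where "S = {p \<in> A. \<psi> p > 0}"
  define r where "r p = \<phi> (p - x) / \<psi> p" for p
  have S: "finite S" "S \<noteq> {}" using fin q unfolding S_def \<psi>_def by auto
  define S0 where "S0 = {p \<in> S. \<forall>p'\<in>S. r p \<le> r p'}"
  have "S0 \<noteq> {}"
  proof -
    obtain p where "p \<in> S" "\<forall>p'\<in>S. \<not> r p' < r p" using ex_min_if_finite[of "r ` S"] S by auto
    then show ?thesis unfolding S0_def by force
  qed
  moreover have "finite S0" unfolding S0_def using S by simp
  \<comment> \<open>Among the points of least slope the one nearest to \<open>x\<close> is taken,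
    measured by \<psi>, so that no point of \<open>A\<close> lies strictly between.\<close>
  ultimately obtain f where f: "f \<in> S0" "\<forall>p\<in>S0. \<not> \<psi> p < \<psi> f" using ex_min_if_finite[of "\<psi> ` S0"] by auto
  have fS: "f \<in> S" and fmin: "\<And>p. p \<in> S \<Longrightarrow> r f \<le> r p" using f(1) unfolding S0_def by auto
  have fA: "f \<in> A" "\<psi> f > 0" using fS unfolding S_def by auto
  have \<kappa>: "\<kappa> \<noteq> 0" using q by auto
  define C where "C p = \<kappa> * cr (f - x) (p - x)" for p
  \<comment> \<open>The functional applied to Cramer's rule: comparing slopes of \<open>p\<close>
    and \<open>f\<close> becomes the question on which side of the line \<open>x f\<close> the point
    \<open>p\<close> lies.\<close>
  have id: "C p * \<phi> (v - x) = \<psi> p * \<phi> (f - x) - \<psi> f * \<phi> (p - x)" for p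
  proof -
    have "\<phi> (cr (f - x) (p - x) *\<^sub>R (v - x)) = \<phi> (cr (v - x) (p - x) *\<^sub>R (f - x) + cr (f - x) (v - x) *\<^sub>R (p - x))"
      by (subst cr_cramer) simp
    then have "cr (f - x) (p - x) * \<phi> (v - x) = cr (v - x) (p - x) * \<phi> (f - x) + cr (f - x) (v - x) * \<phi> (p - x)"
      by (simp add: linear_add[OF \<phi>(1)] linear_cmul[OF \<phi>(1)])
    also have "cr (f - x) (v - x) = - cr (v - x) (f - x)" by (rule cr_anti)
    finally have "\<kappa> * (cr (f - x) (p - x) * \<phi> (v - x)) = \<kappa> * (cr (v - x) (p - x) * \<phi> (f - x) + - cr (v - x) (f - x) * \<phi> (p - x))"
      by simp
    then show ?thesis unfolding C_def \<psi>_def by (simp add: algebra_simps)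
  qed
  have Cp: "0 \<le> C p" if p: "p \<in> A" for p
  proof -
    have "\<psi> p * \<phi> (f - x) \<le> \<psi> f * \<phi> (p - x)"
    proof (cases "p \<in> S")
      case True
      then have "\<phi> (f - x) / \<psi> f \<le> \<phi> (p - x) / \<psi> p" using fmin unfolding r_def by blast
      then show ?thesis using fA True unfolding S_def by (simp add: field_simps)
    next
      case False
      then have "\<psi> p \<le> 0" using p unfolding S_def by simp
      then have "\<psi> p * \<phi> (f - x) \<le> 0" using \<phi>(2)[OF fA(1)] by (simp add: mult_nonpos_nonneg)
      moreover have "0 \<le> \<psi> f * \<phi> (p - x)" using \<phi>(2)[OF p] fA by simp
      ultimately show ?thesis by linarith
    qed
    then have "C p * \<phi> (v - x) \<le> 0" unfolding id by simp
    then show ?thesis using \<phi>(3) by (simp add: mult_le_0_iff)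
  qed
  have Cv: "C v < 0"
    using fA(2) cr_anti[of "v - x" "f - x"] unfolding C_def \<psi>_def by simp
  have "vis f x"
    unfolding vis_def
  proof (intro conjI ballI)
    show "f \<in> A" "x \<in> A" by fact+
    show "f \<noteq> x" using fA(2) unfolding \<psi>_def by auto
    show "cr (x - f) (v - f) \<noteq> 0" unfolding cr_flip[of x f] using Cv unfolding C_def by auto
    show "cr (x - f) (p - f) * cr (x - f) (v - f) \<le> 0" if p: "p \<in> A" for p
    proof -
      have "C p * C v \<le> 0" using Cp[OF p] Cv by (simp add: mult_nonneg_nonpos)
      then have "(\<kappa> * \<kappa>) * (cr (x - f) (p - f) * cr (x - f) (v - f)) \<le> 0"
        unfolding C_def cr_flip[of x f] by (simp add: algebra_simps)
      moreover have "\<kappa> * \<kappa> > 0" using \<kappa> by (simp add: sq_pos)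
      ultimately show ?thesis using mult_pos_pos linorder_not_less by blast
    qed
    show "A \<inter> closed_segment f x = {f, x}"
    proof
      show "{f, x} \<subseteq> A \<inter> closed_segment f x" using fA x by simp
      show "A \<inter> closed_segment f x \<subseteq> {f, x}"
      proof
        fix p assume p: "p \<in> A \<inter> closed_segment f x"
        then obtain s where s: "p = (1 - s) *\<^sub>R x + s *\<^sub>R f" "0 \<le> s" "s \<le> 1"
          unfolding closed_segment_commute[of f x] Int_iff in_segment by blast
        have px: "p - x = s *\<^sub>R (f - x)" unfolding s(1) by (simp add: algebra_simps)
        show "p \<in> {f, x}"
        proof (cases "s = 0")
          case True
          then show ?thesis using s by simp
        next
          case False
          have \<psi>p: "\<psi> p = s * \<psi> f" unfolding \<psi>_def px by (simp add: cr_simps(6))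
          have "\<phi> (p - x) = s * \<phi> (f - x)" unfolding px by (simp add: linear_cmul[OF \<phi>(1)])
          then have "r p = r f" unfolding r_def \<psi>p using False by simp
          moreover have "p \<in> S" unfolding S_def using p \<psi>p fA False s by simp
          ultimately have "p \<in> S0" unfolding S0_def using fmin by simp
          then have "\<psi> f \<le> s * \<psi> f" using f(2) \<psi>p by force
          then have "s = 1" using s fA by simp
          then show ?thesis using s by simp
        qed
      qed
    qed
  qed
  then show ?thesis using that[of f] fA unfolding \<psi>_def by blast
qed

text \<open>The points of \<open>A\<close> across the line \<open>v x\<close> from \<open>y\<close>.
  Their number is the termination measure for walking along visible edges past
  \<open>x\<close>.\<close>

definition beyond :: "real^2 \<Rightarrow> real^2 \<Rightarrow> (real^2) set" where
  "beyond x y = {p \<in> A. cr (v - x) (y - x) * cr (v - x) (p - x) < 0}"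

text \<open>All of \<open>A\<close> lies across the line \<open>f x\<close> from \<open>v\<close>,
  or on it, so a point past the line \<open>v f\<close> is also past \<open>v x\<close>; and
  \<open>f\<close> itself drops out.\<close>

lemma beyond_decreases:
  assumes V: "vis f x" and f: "f \<in> beyond x y"
  shows "beyond f x \<subset> beyond x y"
proof -
  define w where "w = cr (v - x) (f - x)"
  have cfx: "cr (v - f) (x - f) = - w" unfolding w_def by (simp add: cr_def algebra_simps)
  have fA: "f \<in> A" and f0: "cr (v - x) (y - x) * w < 0" using f unfolding beyond_def w_def by auto
  have w0: "w \<noteq> 0" using f0 by auto
  have sub: "p \<in> beyond x y" if p: "p \<in> beyond f x" for p
  proof -
    have pA: "p \<in> A" and pl: "- w * cr (v - f) (p - f) < 0" using p unfolding beyond_def cfx by auto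
    \<comment> \<open>Signed areas split at \<open>f\<close>; after multiplication by
      \<open>w\<close> each part gets a known sign.\<close>
    have "cr (v - x) (p - x) = cr (v - f) (p - f) + (w + cr (f - x) (p - x))" unfolding w_def by (simp add: cr_def algebra_simps)
    then have "w * cr (v - x) (p - x) = w * cr (v - f) (p - f) + (w * w + w * cr (f - x) (p - x))"
      by (simp only: distrib_left)
    then have 1: "w * cr (v - x) (p - x) > w * w + w * cr (f - x) (p - x)" using pl by simp
    have "cr (x - f) (p - f) * cr (x - f) (v - f) \<le> 0" using V pA unfolding vis_def by blast
    moreover have "cr (x - f) (p - f) * cr (x - f) (v - f) = cr (f - x) (p - x) * - w"
      unfolding cr_flip[of x f] w_def using cr_anti[of "v - x" "f - x"] by simp
    ultimately have "0 \<le> w * cr (f - x) (p - x)" by (simp add: mult.commute)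
    moreover have "w * w > 0" using w0 by (simp add: sq_pos)
    ultimately have "w * cr (v - x) (p - x) > 0" using 1 by linarith
    then have "cr (v - x) (y - x) * cr (v - x) (p - x) < 0" using f0 by (auto simp: zero_less_mult_iff mult_less_0_iff)
    then show ?thesis using pA unfolding beyond_def by simp
  qed
  moreover have "f \<notin> beyond f x" unfolding beyond_def by simp
  ultimately show ?thesis using f by blast
qed

lemma beyond_card:
  assumes "vis f x" "f \<in> beyond x y"
  shows "card (beyond f x) < card (beyond x y)"
  using beyond_decreases[OF assms] fin by (intro psubset_card_mono) (auto simp: beyond_def)

end

lemma hull_cr_nonneg:
  assumes "\<And>p. p \<in> A \<Longrightarrow> 0 \<le> m * cr e (p - x)" "q \<in> convex hull A"
  shows "0 \<le> m * cr e (q - x)"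
proof -
  have "convex {p. 0 \<le> m * cr e (p - x)}"
  proof (rule convexI)
    fix p q and s t :: real
    assume pq: "p \<in> {p. 0 \<le> m * cr e (p - x)}" "q \<in> {p. 0 \<le> m * cr e (p - x)}" and st: "0 \<le> s" "0 \<le> t" "s + t = 1"
    have "s *\<^sub>R p + t *\<^sub>R q - x = s *\<^sub>R p + t *\<^sub>R q - (s + t) *\<^sub>R x" using st(3) by simp
    also have "\<dots> = s *\<^sub>R (p - x) + t *\<^sub>R (q - x)" by (simp add: algebra_simps)
    finally have e: "s *\<^sub>R p + t *\<^sub>R q - x = s *\<^sub>R (p - x) + t *\<^sub>R (q - x)" .
    have "m * cr e (s *\<^sub>R p + t *\<^sub>R q - x) = s * (m * cr e (p - x)) + t * (m * cr e (q - x))"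
      unfolding e cr_simps(3,6) by (simp add: distrib_left mult.left_commute)
    then show "s *\<^sub>R p + t *\<^sub>R q \<in> {p. 0 \<le> m * cr e (p - x)}" using pq st by simp
  qed
  then have "convex hull A \<subseteq> {p. 0 \<le> m * cr e (p - x)}" using assms(1) by (intro hull_minimal) auto
  then show ?thesis using assms(2) by blast
qed

context cone_point
begin

text \<open>The edge before a corner is again seen from \<open>v\<close>. Unless that edge has its corner at its far end, where the
  argument is repeated, both edges at \<open>x\<close> are restricted to the two coordinate rays.\<close>

lemma corner_comb:
  assumes "vis x y" "corner x y" "\<not> unimodular x y"
  shows "comb_set (insert v A)"
  using assms
proof (induction "card (beyond x y)" arbitrary: x y rule: less_induct)
  case less
  note V = less.prems(1)
  obtain w a h where ah: "a > 0" "h > 0" and f0: "frame A x (y - x) w" and nout: "y + w \<notin> A" and v0: "v = x - a *\<^sub>R (y - x) - h *\<^sub>R w"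
    using less.prems(2) unfolding corner_def by blast
  define u where "u = y - x"
  have y: "y = x + u" unfolding u_def by simp
  have f: "frame A x u w" and v: "v = x - a *\<^sub>R u - h *\<^sub>R w" using f0 v0 unfolding u_def by auto
  define \<delta> where "\<delta> = cr u w"
  have \<delta>: "\<delta> \<noteq> 0" "\<delta> * \<delta> > 0" unfolding \<delta>_def using frameD(1)[OF f] sq_pos by auto
  have vx: "v - x = - (a *\<^sub>R u) - h *\<^sub>R w" unfolding v by simp
  have xA: "x \<in> A" by (rule frameD(2)[OF f])
  have nonneg: "0 \<le> t" if "p \<in> A" "p = x + s *\<^sub>R u + t *\<^sub>R w" for p s t
    using vis_height[OF V f0 _ ah(2) that(1)] that(2) v unfolding u_def by (metis diff_conv_add_uminus scaleR_minus_left)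
  \<comment> \<open>The lattice height over the edge \<open>x y\<close>: nonnegative on
    \<open>A\<close> and negative at \<open>v\<close>, as gift wrapping at \<open>x\<close>
    requires.\<close>
  define \<phi> where "\<phi> q = cr u q / \<delta>" for q
  have lin: "linear \<phi>" unfolding \<phi>_def by (rule linearI) (simp_all add: cr_simps(3,6) add_divide_distrib)
  have \<phi>A: "0 \<le> \<phi> (p - x)" if p: "p \<in> A" for p
  proof -
    obtain i j :: int where ij: "p = x + of_int i *\<^sub>R u + of_int j *\<^sub>R w" using frameD(5)[OF f p] by blast
    then have "p - x = of_int i *\<^sub>R u + of_int j *\<^sub>R w" by simp
    then have "\<phi> (p - x) = of_int j" unfolding \<phi>_def using \<delta> by (simp add: cr_simps(3,6) \<delta>_def)
    then show ?thesis using nonneg[OF p ij] by simp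
  qed
  have \<phi>v: "\<phi> (v - x) < 0" unfolding \<phi>_def vx using \<delta> ah by (simp add: cr_simps \<delta>_def)
  have crw: "cr w u = - \<delta>" unfolding \<delta>_def by (rule cr_anti)
  have s: "x + w \<in> A" "- \<delta> * cr (v - x) (x + w - x) > 0"
    unfolding vx using frameD(4)[OF f] ah \<delta> by (simp_all add: cr_simps \<delta>_def[symmetric] mult.left_commute[of \<delta>])
  \<comment> \<open>The other visible edge at \<open>x\<close>: gift wrapping on the side of the
    line \<open>v x\<close> away from \<open>y\<close>, where \<open>x + w\<close> shows that there
    are points.\<close>
  obtain F where F: "F \<in> A" "- \<delta> * cr (v - x) (F - x) > 0" "vis F x"
    using next_edge[OF xA lin \<phi>A \<phi>v s] by blast
  obtain f1 d :: int where F_eq: "F = x + of_int f1 *\<^sub>R u + of_int d *\<^sub>R w" using frameD(5)[OF f F(1)] by blast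
  define c where "c = - f1"
  have Fx: "F - x = - (of_int c *\<^sub>R u) + of_int d *\<^sub>R w" unfolding F_eq c_def by simp
  \<comment> \<open>Up to a factor the height over the edge \<open>x F\<close>.\<close>
  define C where "C q = cr (F - x) q" for q
  have Cu: "C u = - (of_int d * \<delta>)" and Cw: "C w = - (of_int c * \<delta>)"
    unfolding C_def Fx by (simp_all add: cr_simps crw \<delta>_def[symmetric])
  have Clin: "C (p + q) = C p + C q" "C (p - q) = C p - C q" "C (s *\<^sub>R p) = s * C p" "C (- p) = - C p" for p q s
    unfolding C_def by (simp_all add: cr_simps)
  have CF: "C (F - x) = 0" "C (x - F) = 0" unfolding C_def using cr_simps(8)[of "F - x" "F - x"] by simp_all
  \<comment> \<open>Positive because \<open>F\<close> and \<open>y\<close> lie on different sides of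
    the line \<open>v x\<close>.\<close>
  define G where "G = a * of_int d + h * of_int c"
  have vF: "cr (v - x) (F - x) = - (G * \<delta>)"
    unfolding vx Fx G_def by (simp add: cr_simps crw \<delta>_def[symmetric] algebra_simps)
  have "G * (\<delta> * \<delta>) > 0" using F(2) unfolding vF by (simp add: algebra_simps)
  then have G: "G > 0" using \<delta>(2) by (simp add: zero_less_mult_iff)
  have Cv: "C (v - x) = G * \<delta>" using vF cr_anti[of "v - x" "F - x"] unfolding C_def by simp
  have N: "0 \<le> of_int d * s + of_int c * t" if p: "p \<in> A" "p = x + s *\<^sub>R u + t *\<^sub>R w" for p s t
  proof -
    have "p - x = s *\<^sub>R u + t *\<^sub>R w" using p(2) by simp
    then have Cp: "C (p - x) = - ((of_int d * s + of_int c * t) * \<delta>)" by (simp add: Clin Cu Cw algebra_simps)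
    have "C (p - x) * C (v - x) = - ((of_int d * s + of_int c * t) * (G * (\<delta> * \<delta>)))"
      unfolding Cp Cv by (simp only: mult_minus_left mult.assoc mult.left_commute)
    moreover have "C (p - x) * C (v - x) \<le> 0"
      using F(3) p(1) unfolding vis_def cr_flip[of x F] C_def by (metis minus_mult_minus)
    ultimately have "0 \<le> (of_int d * s + of_int c * t) * (G * (\<delta> * \<delta>))" by linarith
    moreover have "G * (\<delta> * \<delta>) > 0" using G \<delta> by simp
    ultimately show ?thesis by (metis mult_less_0_iff not_le)
  qed
  \<comment> \<open>The half-plane of the edge \<open>x F\<close>, tested at \<open>x + w\<close>
    and \<open>x + u\<close>, fixes the signs of \<open>c\<close> and \<open>d\<close>.\<close>
  have "0 \<le> (of_int d * 0 + of_int c * 1 :: real)" by (rule N[OF frameD(4)[OF f]]) simp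
  then have c0: "0 \<le> c" by simp
  have "0 \<le> (of_int d * 1 + of_int c * 0 :: real)" by (rule N[OF frameD(3)[OF f]]) simp
  then have d0: "0 \<le> d" by simp
  \<comment> \<open>For \<open>c = 0\<close> the edge \<open>x F\<close> runs along
    \<open>w\<close>, so both edges at \<open>x\<close> are coordinate rays and \<open>A\<close>
    lies in the quadrant.\<close>
  have fin_quad: "comb_set (insert v A)" if "c = 0"
  proof -
    have "a * of_int d > 0" using G that unfolding G_def by simp
    then have d1: "d > 0" using ah by (simp add: zero_less_mult_iff)
    show ?thesis
    proof (rule comb_from_quadrant[OF f fin v ah])
      show "x + u + w \<notin> A" using nout unfolding y .
      fix p and i j :: int assume p: "p \<in> A" "p = x + of_int i *\<^sub>R u + of_int j *\<^sub>R w"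
      have "0 \<le> (of_int d * of_int i :: real)" using N[OF p] that by simp
      then have "0 \<le> i" using d1 by (simp add: zero_le_mult_iff)
      then show "0 \<le> i \<and> 0 \<le> j" using nonneg[OF p] by simp
    qed
  qed
  \<comment> \<open>\<open>j\<close> and \<open>j'\<close> are the heights of \<open>u\<close> and
    \<open>w\<close> over the edge \<open>x F\<close>, in units of \<open>w'\<close>. Because
    \<open>c\<close> and \<open>d\<close> are nonnegative they cannot have opposite signs, and the
    last hypothesis rules out negative ones.\<close>
  have signs: "0 \<le> j \<and> 0 \<le> j'" if w': "C w' \<noteq> 0" "C u = of_int j * C w'" "C w = of_int j' * C w'" "a * of_int j + h * of_int j' > 0"
    for w' and j j' :: int
  proof -
    define \<eta> where "\<eta> = - (C w' / \<delta>)"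
    have e: "real_of_int d = of_int j * \<eta>" "real_of_int c = of_int j' * \<eta>"
      using w'(2,3) \<delta> unfolding Cu Cw \<eta>_def by (simp_all add: field_simps)
    have \<eta>: "\<eta> \<noteq> 0" unfolding \<eta>_def using w' \<delta> by simp
    have "\<eta> > 0"
    proof (rule ccontr)
      assume "\<not> \<eta> > 0"
      then have neg: "\<eta> < 0" using \<eta> by simp
      have "of_int j \<le> (0::real)" "of_int j' \<le> (0::real)"
        using c0 d0 e neg by (metis of_int_0_le_iff zero_le_mult_iff not_le)+
      then have "a * of_int j \<le> 0" "h * of_int j' \<le> 0" using ah by (simp_all add: mult_nonneg_nonpos)
      then show False using w'(4) by linarith
    qed
    then show ?thesis using c0 d0 e by (metis of_int_0_le_iff zero_le_mult_iff not_le)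
  qed
  have vC: "C (v - x) = - (a * C u + h * C w)" unfolding vx by (simp add: Clin)
  consider "unimodular F x" | "corner x F" | "corner F x" "\<not> unimodular F x" using vis_trichotomy[OF F(3)] by blast
  then show ?case
  proof cases
    case 1
    then obtain w' and k :: int where fF: "frame A F (x - F) w'" and vk: "v = F + of_int k *\<^sub>R (x - F) - w'"
      unfolding unimodular_def by blast
    have Cw': "C w' \<noteq> 0" using frameD(1)[OF fF] cr_simps(7)[of "x - F" w'] unfolding C_def by simp
    have inC: "\<exists>j::int. C (p - x) = of_int j * C w'" if p: "p \<in> A" for p
    proof -
      obtain i j :: int where ij: "p = F + of_int i *\<^sub>R (x - F) + of_int j *\<^sub>R w'" using frameD(5)[OF fF p] by blast
      have e: "p - x = (F - x) + of_int i *\<^sub>R (x - F) + of_int j *\<^sub>R w'" unfolding ij by simp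
      have "C (p - x) = of_int j * C w'" unfolding e Clin(1,3) CF by simp
      then show ?thesis by blast
    qed
    obtain j :: int where j: "C u = of_int j * C w'" using inC[OF frameD(3)[OF f]] by auto
    obtain j' :: int where j': "C w = of_int j' * C w'" using inC[OF frameD(4)[OF f]] by auto
    have e: "v - x = (F - x) + of_int k *\<^sub>R (x - F) + - w'" unfolding vk by simp
    have "C (v - x) = - C w'" unfolding e Clin(1,3,4) CF by simp
    then have "(a * of_int j + h * of_int j') * C w' = 1 * C w'" unfolding vC j j' by (simp add: algebra_simps)
    \<comment> \<open>The height of \<open>v\<close> over the unimodular edge is -1.\<close>
    then have one: "a * of_int j + h * of_int j' = 1" using Cw' by (simp only: mult_cancel_right) simp
    have jj: "0 \<le> j" "0 \<le> j'" using signs[OF Cw' j j'] one by simp_all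
    have "v = F + of_int k *\<^sub>R (x - F) + of_int (-1) *\<^sub>R w'" unfolding vk by simp
    from frame_change[OF fF f this] obtain i0 j0 :: int where v': "v = x + of_int i0 *\<^sub>R u + of_int j0 *\<^sub>R w" by blast
    have "v = x + (- a) *\<^sub>R u + (- h) *\<^sub>R w" unfolding v by simp
    then have hj: "h = - of_int j0" using v' coord_unique[OF frameD(1)[OF f]] by (metis minus_minus)
    \<comment> \<open>\<open>v\<close> is a lattice point in this case, so \<open>h\<close> is a
      positive integer, and \<open>h = 1\<close> would make \<open>x y\<close> unimodular. With
      \<open>h \<ge> 2\<close> the equation above leaves no room for
      \<open>j' \<ge> 1\<close>.\<close>
    have "h \<noteq> 1"
    proof
      assume "h = 1"
      then have "v = x + of_int i0 *\<^sub>R (y - x) - w" using v' hj unfolding u_def by simp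
      then show False using less.prems(3) f0 unfolding unimodular_def by blast
    qed
    then have "j0 \<noteq> -1" using hj by auto
    moreover have "j0 < 0" using ah(2) unfolding hj by simp
    ultimately have "j0 \<le> -2" by simp
    then have h2: "h \<ge> 2" unfolding hj by simp
    have "j' = 0"
    proof (rule ccontr)
      assume "j' \<noteq> 0"
      then have "j' \<ge> 1" using jj by simp
      then have "1 \<le> real_of_int j'" by simp
      then have "2 * 1 \<le> h * of_int j'" using h2 by (intro mult_mono) auto
      moreover have "0 \<le> a * of_int j" using ah jj by simp
      ultimately show False using one by linarith
    qed
    then have "c = 0" using j' Cw \<delta> by simp
    then show ?thesis by (rule fin_quad)
  next
    case 2
    then obtain w' a' h' where ah': "a' > 0" "h' > 0" and fF: "frame A x (F - x) w'" and nF: "F + w' \<notin> A"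
      and vk: "v = x - a' *\<^sub>R (F - x) - h' *\<^sub>R w'"
      unfolding corner_def by blast
    have Cw': "C w' \<noteq> 0" using frameD(1)[OF fF] unfolding C_def by simp
    have inC: "\<exists>i j::int. p - x = of_int i *\<^sub>R (F - x) + of_int j *\<^sub>R w' \<and> C (p - x) = of_int j * C w'" if p: "p \<in> A" for p
    proof -
      obtain i j :: int where ij: "p = x + of_int i *\<^sub>R (F - x) + of_int j *\<^sub>R w'" using frameD(5)[OF fF p] by blast
      have e: "p - x = of_int i *\<^sub>R (F - x) + of_int j *\<^sub>R w'" unfolding ij by simp
      have "C (p - x) = of_int j * C w'" unfolding e Clin(1,3) CF by simp
      then show ?thesis using e by blast
    qed
    obtain j :: int where j: "C u = of_int j * C w'" using inC[OF frameD(3)[OF f]] by auto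
    obtain i' j' :: int where w_eq: "w = of_int i' *\<^sub>R (F - x) + of_int j' *\<^sub>R w'" and j': "C w = of_int j' * C w'"
      using inC[OF frameD(4)[OF f]] by auto
    have vx': "v - x = - (a' *\<^sub>R (F - x)) - h' *\<^sub>R w'" unfolding vk by simp
    have "v - x = - (a' *\<^sub>R (F - x)) + - (h' *\<^sub>R w')" unfolding vk by simp
    then have "C (v - x) = - (h' * C w')" by (simp only: Clin(1,3,4) CF)
    then have "(a * of_int j + h * of_int j') * C w' = h' * C w'" unfolding vC j j' by (simp add: algebra_simps)
    then have "a * of_int j + h * of_int j' = h'" using Cw' by simp
    then have jj: "0 \<le> j" "0 \<le> j'" using signs[OF Cw' j j'] ah' by simp_all
    obtain \<alpha> \<beta> :: int where g: "x + w' = x + of_int \<alpha> *\<^sub>R u + of_int \<beta> *\<^sub>R w" using frameD(5)[OF f frameD(4)[OF fF]] by blast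
    then have w': "w' = of_int \<alpha> *\<^sub>R u + of_int \<beta> *\<^sub>R w" by (simp add: add.assoc)
    have \<beta>: "0 \<le> \<beta>" using nonneg[OF frameD(4)[OF fF] g] by simp
    have "C w' = of_int \<alpha> * C u + of_int \<beta> * C w" unfolding w' by (simp add: Clin)
    then have "real_of_int (\<alpha> * j + \<beta> * j') * C w' = 1 * C w'" unfolding j j' by (simp add: algebra_simps)
    then have "real_of_int (\<alpha> * j + \<beta> * j') = 1" using Cw' by (simp only: mult_cancel_right) simp
    \<comment> \<open>\<open>w'\<close> has height 1 over \<open>x F\<close>, while \<open>u\<close>
      and \<open>w\<close> have heights \<open>j\<close> and \<open>j'\<close>.\<close>
    then have one: "\<alpha> * j + \<beta> * j' = 1" by linarith
    \<comment> \<open>The \<open>u\<close>-coordinate of \<open>v\<close>, computed from both corner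
      equations, shows that \<alpha> is positive.\<close>
    have "- (a * \<delta>) = cr (v - x) w" unfolding vx by (simp add: cr_simps \<delta>_def)
    also have "\<dots> = (a' * of_int c - h' * of_int \<alpha>) * \<delta>"
      unfolding vx' Fx w' by (simp add: cr_simps \<delta>_def algebra_simps)
    finally have "(h' * of_int \<alpha> - a' * of_int c) * \<delta> = a * \<delta>" by (simp add: algebra_simps)
    then have "h' * of_int \<alpha> - a' * of_int c = a" using \<delta>(1) mult_right_cancel by blast
    then have "h' * of_int \<alpha> = a + a' * of_int c" by simp
    moreover have "a' * of_int c \<ge> 0" using ah' c0 by simp
    ultimately have "h' * of_int \<alpha> > 0" using ah by simp
    then have \<alpha>: "\<alpha> \<ge> 1" using ah' by (simp add: zero_less_mult_iff)
    show ?thesis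
    proof (cases "j' = 0")
      case True
      then have "c = 0" using j' Cw \<delta> by simp
      then show ?thesis by (rule fin_quad)
    next
      case False
      then have j1: "j' \<ge> 1" using jj by simp
      have \<alpha>j: "0 \<le> \<alpha> * j" using \<alpha> jj by simp
      show ?thesis
      proof (cases "\<beta> = 0")
        case True
        then have "\<alpha> * j = 1" using one by simp
        then have aj: "\<alpha> = 1" "j = 1" using \<alpha> zmult_eq_1_iff[of \<alpha> j] by auto
        have w'u: "w' = u" using w' True aj by simp
        have "0 *\<^sub>R u + 1 *\<^sub>R w = (of_int j' - of_int i' * of_int c) *\<^sub>R u + (of_int i' * of_int d) *\<^sub>R w"
          using w_eq unfolding Fx w'u by (simp add: algebra_simps)
        then have "x + 0 *\<^sub>R u + 1 *\<^sub>R w = x + (of_int j' - of_int i' * of_int c) *\<^sub>R u + (of_int i' * of_int d) *\<^sub>R w"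
          by (simp add: add.assoc)
        then have "real_of_int (i' * d) = 1" unfolding coord_unique[OF frameD(1)[OF f]] by simp
        then have "i' * d = 1" by linarith
        then have d1: "d = 1" using d0 zmult_eq_1_iff[of i' d] by auto
        have "C w' = - \<delta>" unfolding w'u Cu d1 by simp
        then have "of_int c * \<delta> = of_int j' * \<delta>" using j' Cw by simp
        then have c1: "c \<ge> 1" using \<delta> j1 by simp
        \<comment> \<open>\<open>F\<close> and \<open>x + w\<close> lie in the same row,
          \<open>c\<close> steps apart. The first step from \<open>F\<close> leads to
          \<open>F + w'\<close>, which belongs to the hull and contradicts the corner at
          \<open>x F\<close>.\<close>
        define t where "t = (real_of_int c - 1) / of_int c"
        have t: "0 \<le> t" "0 \<le> 1 - t" "t * of_int c = of_int c - 1" unfolding t_def using c1 by (simp_all add: field_simps)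
        have "t *\<^sub>R F + (1 - t) *\<^sub>R (x + w) + 0 *\<^sub>R x \<in> convex hull A"
          by (rule hull3_mem[OF F(1) frameD(4)[OF f] xA]) (use t in auto)
        also have "t *\<^sub>R F + (1 - t) *\<^sub>R (x + w) + 0 *\<^sub>R x = x + (- (t * of_int c)) *\<^sub>R u + w"
          unfolding F_eq d1 c_def by (simp add: algebra_simps)
        also have "\<dots> = x + of_int (1 - c) *\<^sub>R u + of_int 1 *\<^sub>R w" unfolding t(3) by simp
        finally have "x + of_int (1 - c) *\<^sub>R u + of_int 1 *\<^sub>R w \<in> A" by (rule frameD(6)[OF f])
        moreover have "x + of_int (1 - c) *\<^sub>R u + of_int 1 *\<^sub>R w = F + w'"
          unfolding F_eq d1 w'u c_def by (simp add: algebra_simps)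
        ultimately show ?thesis using nF by simp
      next
        case False
        then have b1: "\<beta> \<ge> 1" using \<beta> by simp
        then have "\<beta> * j' \<ge> 1 * 1" using j1 by (intro mult_mono) auto
        then have "\<beta> * j' = 1" using one \<alpha>j by linarith
        then have "\<beta> = 1" using b1 zmult_eq_1_iff[of \<beta> j'] by auto
        then have gA: "x + of_int \<alpha> *\<^sub>R u + w \<in> A" using g frameD(4)[OF fF] by (simp add: add.assoc)
        \<comment> \<open>The row through \<open>x + w\<close> also contains \<open>x + w'\<close>,
          so \<open>x + u + w\<close> lies between two points of \<open>A\<close>, against the
          corner at \<open>x y\<close>.\<close>
        have "(1 / of_int \<alpha>) *\<^sub>R (x + of_int \<alpha> *\<^sub>R u + w) + (1 - 1 / of_int \<alpha>) *\<^sub>R (x + w) + 0 *\<^sub>R x \<in> convex hull A"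
          by (rule hull3_mem[OF gA frameD(4)[OF f] xA]) (use \<alpha> in auto)
        also have "(1 / of_int \<alpha>) *\<^sub>R (x + of_int \<alpha> *\<^sub>R u + w) + (1 - 1 / of_int \<alpha>) *\<^sub>R (x + w) + 0 *\<^sub>R x
          = x + (of_int \<alpha> / of_int \<alpha>) *\<^sub>R u + w" by (simp add: algebra_simps)
        also have "\<dots> = x + of_int 1 *\<^sub>R u + of_int 1 *\<^sub>R w" using \<alpha> by simp
        finally have "x + of_int 1 *\<^sub>R u + of_int 1 *\<^sub>R w \<in> A" by (rule frameD(6)[OF f])
        then show ?thesis using nout unfolding y by simp
      qed
    qed
  next
    case 3
    have "cr (v - x) (y - x) = h * \<delta>" unfolding vx u_def[symmetric] by (simp add: cr_simps crw)
    then have "cr (v - x) (y - x) * cr (v - x) (F - x) = - (h * (G * (\<delta> * \<delta>)))" unfolding vF by simp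
    also have "\<dots> < 0" using ah G \<delta> by simp
    finally have "F \<in> beyond x y" using F(1) unfolding beyond_def by simp
    from less.hyps[OF beyond_card[OF F(3) this] F(3) 3] show ?thesis .
  qed
qed

section \<open>The visible triangles cover the new part of the hull\<close>

text \<open>A functional separating \<open>v\<close> from the hull is minimal on \<open>A\<close> at
  some \<open>x\<close>; gift wrapping at \<open>x\<close> then finds an edge, started at any point
  of \<open>A\<close> off the line \<open>v x\<close>.\<close>

lemma vis_exists: "\<exists>x y. vis x y"
proof -
  have "closed (convex hull A)" using fin by (simp add: compact_imp_closed finite_imp_compact_convex_hull)
  then obtain e b where e: "e \<bullet> v < b" "\<And>p. p \<in> convex hull A \<Longrightarrow> e \<bullet> p > b"
    using separating_hyperplane_closed_point[OF convex_convex_hull _ out] by blast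
  have "A \<noteq> {}" using nc by auto
  then obtain x where x: "x \<in> A" "\<And>p. p \<in> A \<Longrightarrow> e \<bullet> x \<le> e \<bullet> p"
    using arg_min_if_finite[OF fin, of "\<lambda>p. e \<bullet> p"] by (metis not_le)
  have xh: "x \<in> convex hull A" using x hull_inc by metis
  have "x \<noteq> v" using out xh by blast
  then obtain z where z: "z \<in> A" "cr (v - x) (z - x) \<noteq> 0" using point_off_line[OF nc, of x v] by blast
  have lin: "linear (\<lambda>p. e \<bullet> p)" by (rule linearI) (simp_all add: inner_add_right)
  have "e \<bullet> (v - x) < 0" using e(1) e(2)[OF xh] by (simp add: inner_diff_right)
  moreover have "0 \<le> e \<bullet> (p - x)" if "p \<in> A" for p using x(2)[OF that] by (simp add: inner_diff_right)
  ultimately show ?thesis using next_edge[OF x(1) lin _ _ z(1), of "cr (v - x) (z - x)"] sq_pos[OF z(2)] by blast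
qed

text \<open>Gift wrapping at \<open>x\<close> with the distance from the line of the known edge as
  functional, on the side of \<open>v x\<close> away from \<open>y\<close>.\<close>

lemma vis_next:
  assumes V: "vis x y" and p: "p \<in> beyond x y"
  obtains f where "f \<in> beyond x y" "vis f x"
proof -
  note V' = V[unfolded vis_def]
  define \<phi> where "\<phi> q = - (cr (y - x) q * cr (y - x) (v - x))" for q
  have lin: "linear \<phi>" unfolding \<phi>_def by (rule linearI) (simp_all add: cr_simps(3,6) algebra_simps)
  have "0 \<le> \<phi> (q - x)" if "q \<in> A" for q using V' that unfolding \<phi>_def by simp
  moreover have "\<phi> (v - x) < 0" using V' sq_pos unfolding \<phi>_def by simp
  moreover have "p \<in> A" "- cr (v - x) (y - x) * cr (v - x) (p - x) > 0" using p unfolding beyond_def by simp_all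
  ultimately obtain f where "f \<in> A" "- cr (v - x) (y - x) * cr (v - x) (f - x) > 0" "vis f x"
    using next_edge[OF _ lin, of x p "- cr (v - x) (y - x)"] V' by blast
  then show ?thesis using that[of f] unfolding beyond_def by simp
qed

text \<open>Walk along visible edges until the cone from \<open>v\<close> over an edge contains
  \<open>q\<close>. The third assumption, that \<open>q\<close> is not past the line through
  \<open>v\<close> and the rear end of the edge, is the invariant.\<close>

lemma cone_cover:
  assumes "vis x y" "q \<in> convex hull A" "0 \<le> cr (v - y) (x - y) * cr (v - y) (q - y)"
  shows "\<exists>x y. vis x y \<and> 0 \<le> cr (v - y) (x - y) * cr (v - y) (q - y) \<and> 0 \<le> cr (v - x) (y - x) * cr (v - x) (q - x)"
  using assms
proof (induction "card (beyond x y)" arbitrary: x y rule: less_induct)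
  case less
  show ?case
  proof (cases "0 \<le> cr (v - x) (y - x) * cr (v - x) (q - x)")
    case True
    then show ?thesis using less.prems by blast
  next
    case False
    have "beyond x y \<noteq> {}"
    proof
      assume "beyond x y = {}"
      then have "0 \<le> cr (v - x) (y - x) * cr (v - x) (p - x)" if "p \<in> A" for p
        using that unfolding beyond_def by force
      then show False using False hull_cr_nonneg[OF _ less.prems(2)] by blast
    qed
    then obtain f where f: "f \<in> beyond x y" "vis f x" using vis_next[OF less.prems(1)] by blast
    have "cr (v - x) (y - x) * cr (v - x) (f - x) < 0" using f(1) unfolding beyond_def by simp
    then have "0 \<le> cr (v - x) (f - x) * cr (v - x) (q - x)"
      using False by (auto simp: mult_less_0_iff zero_le_mult_iff not_le)
    from less.hyps[OF beyond_card[OF f(2,1)] f(2) less.prems(2) this] show ?thesis .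
  qed
qed

text \<open>Write \<open>p\<close> on a segment from \<open>v\<close> to a point \<open>q\<close> of
  the old hull and take the visible edge whose cone contains \<open>q\<close>. Either
  \<open>p\<close> comes before the edge and lies in the triangle, or it lies between the crossing
  point and \<open>q\<close>, hence in the old hull.\<close>

lemma vis_triangles_cover:
  assumes p: "p \<in> convex hull (insert v A)" "p \<notin> convex hull A"
  shows "\<exists>x y. vis x y \<and> p \<in> convex hull {v, x, y}"
proof -
  have "A \<noteq> {}" using nc by auto
  then obtain l m q where lm: "0 \<le> l" "0 \<le> m" "l + m = 1" "q \<in> convex hull A" "p = l *\<^sub>R v + m *\<^sub>R q"
    using p(1) unfolding convex_hull_insert[OF \<open>A \<noteq> {}\<close>] by blast
  obtain x0 y0 where V0: "vis x0 y0" using vis_exists by blast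
  have "\<exists>x y. vis x y \<and> 0 \<le> cr (v - y) (x - y) * cr (v - y) (q - y)"
  proof (cases "0 \<le> cr (v - y0) (x0 - y0) * cr (v - y0) (q - y0)")
    case True
    then show ?thesis using V0 by blast
  next
    case False
    have "beyond y0 x0 \<noteq> {}"
    proof
      assume "beyond y0 x0 = {}"
      then have "0 \<le> cr (v - y0) (x0 - y0) * cr (v - y0) (p - y0)" if "p \<in> A" for p
        using that unfolding beyond_def by force
      then show False using False hull_cr_nonneg[OF _ lm(4)] by blast
    qed
    then obtain f where f: "f \<in> beyond y0 x0" "vis f y0" using vis_next[OF vis_sym[OF V0]] by blast
    have "cr (v - y0) (x0 - y0) * cr (v - y0) (f - y0) < 0" using f(1) unfolding beyond_def by simp
    then have "0 \<le> cr (v - y0) (f - y0) * cr (v - y0) (q - y0)"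
      using False by (auto simp: mult_less_0_iff zero_le_mult_iff not_le)
    then show ?thesis using f(2) by blast
  qed
  then obtain x y where V: "vis x y" and q1: "0 \<le> cr (v - y) (x - y) * cr (v - y) (q - y)"
    and q2: "0 \<le> cr (v - x) (y - x) * cr (v - x) (q - x)"
    using cone_cover[OF _ lm(4)] by blast
  note V' = V[unfolded vis_def]
  let ?D = "cr (y - x) (v - x)"
  have D: "cr (x - v) (y - v) = ?D" by (simp add: cr_def algebra_simps)
  have D0: "cr (x - v) (y - v) \<noteq> 0" unfolding D using V' by blast
  have sq: "?D * ?D > 0" using V' sq_pos by blast
  have q3: "0 \<le> - ?D * cr (y - x) (q - x)"
    using hull_cr_nonneg[OF _ lm(4), of "- ?D" "y - x" x] V' by (simp add: mult.commute)
  have div: "s / ?D = s * ?D / (?D * ?D)" for s using V' by simp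
  have bv: "bary v x y q \<le> 0"
  proof -
    have "cr (x - q) (y - q) = cr (y - x) (q - x)" by (simp add: cr_def algebra_simps)
    then have "bary v x y q = cr (y - x) (q - x) * ?D / (?D * ?D)" unfolding bary_def D div[symmetric] by simp
    moreover have "cr (y - x) (q - x) * ?D \<le> 0" using q3 by (simp add: mult.commute)
    ultimately show ?thesis using divide_nonpos_pos[OF _ sq] by metis
  qed
  have bx: "0 \<le> bary x y v q"
  proof -
    have "cr (y - q) (v - q) = cr (v - y) (q - y)" "?D = cr (v - y) (x - y)" by (simp_all add: cr_def algebra_simps)
    then have "bary x y v q = (cr (v - y) (x - y) * cr (v - y) (q - y)) / (?D * ?D)" unfolding bary_def div[of "cr (y - q) (v - q)"] by simp
    then show ?thesis using q1 sq by simp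
  qed
  have byq: "0 \<le> bary y v x q"
  proof -
    have "cr (v - q) (x - q) = - cr (v - x) (q - x)" "?D = - cr (v - x) (y - x)" "cr (v - y) (x - y) = ?D"
      by (simp_all add: cr_def algebra_simps)
    then have "bary y v x q = (cr (v - x) (y - x) * cr (v - x) (q - x)) / (?D * ?D)"
      unfolding bary_def using div[of "cr (v - q) (x - q)"] by simp
    then show ?thesis using q2 sq by simp
  qed
  have vv: "bary v x y v = 1" "bary x y v v = 0" "bary y v x v = 0"
  proof -
    have "cr (y - x) (v - x) \<noteq> 0" "cr (v - y) (x - y) \<noteq> 0" using D0 D cr_cyc[of v y x] by auto
    then show "bary v x y v = 1" "bary x y v v = 0" "bary y v x v = 0" using bary_vertex D0 by blast+
  qed
  have bl: "bary i j k (s *\<^sub>R v + t *\<^sub>R q) = s * bary i j k v + t * bary i j k q" if "s + t = 1" for i j k s t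
    using bary_affine3[of s t 0 i j k v q q] that by simp
  show ?thesis
  proof (cases "0 \<le> bary v x y p")
    case True
    have "p \<in> convex hull {v, x, y}"
      unfolding in_triangle_iff[OF D0] using True bx byq lm unfolding lm(5) bl[OF lm(3)] vv by simp
    then show ?thesis using V by blast
  next
    case False
    let ?b = "bary v x y q"
    have neg: "l + m * ?b < 0" using False unfolding lm(5) bl[OF lm(3)] vv by simp
    have b0: "?b < 0" using bv neg lm by (cases "?b = 0") auto
    \<comment> \<open>The parameter at which the \<open>v\<close>-coordinate
      \<open>1 - t + t * ?b\<close> vanishes, so that \<open>c\<close> is the crossing with the line
      \<open>x y\<close>.\<close>
    define t where "t = 1 / (1 - ?b)"
    have t: "0 < t" "t < 1" "t * (1 - ?b) = 1" unfolding t_def using b0 by (simp_all add: field_simps)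
    have "m * (1 - ?b) > 1" using neg lm(3) by (simp add: algebra_simps)
    then have mt: "m > t" using b0 unfolding t_def by (simp add: field_simps)
    define c where "c = (1 - t) *\<^sub>R v + t *\<^sub>R q"
    have bc: "bary v x y c = 0" "0 \<le> bary x y v c" "0 \<le> bary y v x c"
    proof -
      have s1: "(1 - t) + t = 1" by simp
      show "bary v x y c = 0" "0 \<le> bary x y v c" "0 \<le> bary y v x c"
        unfolding c_def bl[OF s1] vv using t bx byq by (simp_all add: algebra_simps)
    qed
    have "c = bary x y v c *\<^sub>R x + bary y v x c *\<^sub>R y" using bary_eq[OF D0, of c] bc by simp
    moreover have "bary x y v c + bary y v x c = 1" using bary_sum[OF D0, of c] bc by simp
    ultimately have "c \<in> convex hull {x, y}" unfolding convex_hull_2 using bc by blast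
    then have cA: "c \<in> convex hull A" using V' hull_mono[of "{x, y}" A convex] by blast
    define s where "s = (m - t) / (1 - t)"
    have m1: "m \<le> 1" using lm by simp
    have s: "0 \<le> s" "s \<le> 1" unfolding s_def using mt t m1 by (simp_all add: field_simps)
    have s1: "s * (1 - t) = m - t" unfolding s_def using t by simp
    have "(1 - s) *\<^sub>R c + s *\<^sub>R q = ((1 - t) - s * (1 - t)) *\<^sub>R v + (t + s * (1 - t)) *\<^sub>R q"
      unfolding c_def by (simp add: algebra_simps)
    also have "\<dots> = p" unfolding s1 lm(5) using lm(3) by (simp add: algebra_simps flip: scaleR_add_left)
    finally have "(1 - s) *\<^sub>R c + s *\<^sub>R q = p" .
    then have "p \<in> convex hull A" using convexD_alt[OF convex_convex_hull cA lm(4) s] by metis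
    then show ?thesis using p(2) by blast
  qed
qed

text \<open>If all visible edges are unimodular, every lattice point of the new hull outside the old
  one is \<open>v\<close>, and the old frame still works. A visible edge that is not unimodular has
  a corner at one of its ends, so \<open>corner_comb\<close> applies.\<close>

theorem insert_saturated_or_comb: "saturated (insert v A) \<or> comb_set (insert v A)"
proof (cases "\<forall>x y. vis x y \<longrightarrow> unimodular x y")
  case False
  then obtain x y where xy: "vis x y" "\<not> unimodular x y" by blast
  have "unimodular y x \<Longrightarrow> unimodular x y"
  proof -
    assume "unimodular y x"
    then obtain w and k :: int where f: "frame A y (x - y) w" and v: "v = y + of_int k *\<^sub>R (x - y) - w"
      unfolding unimodular_def by blast
    have m: "x \<in> A" "y \<in> A" "y + w \<in> A" "cr (x - y) w \<noteq> 0" using frameD(1-4)[OF f] by simp_all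
    have "A \<inter> convex hull {x, y, y + w} = {x, y, y + w}" using frame_empty[OF f] by (simp add: insert_commute)
    moreover have "cr (y - x) (y + w - x) \<noteq> 0"
    proof -
      have "cr (y - x) (y + w - x) = - cr (x - y) w" by (simp add: cr_def algebra_simps)
      then show ?thesis using m by simp
    qed
    ultimately have "frame A x (y - x) (y + w - x)" using saturated_frame[OF sat, of x y "y + w"] m by simp
    moreover have "v = x + of_int (2 - k) *\<^sub>R (y - x) - (y + w - x)" unfolding v by (simp add: algebra_simps scaleR_2)
    ultimately show "unimodular x y" unfolding unimodular_def by blast
  qed
  then have "\<not> unimodular y x" using xy by blast
  then show ?thesis using vis_trichotomy[OF xy(1)] corner_comb[OF xy(1) _ xy(2)] corner_comb[OF vis_sym[OF xy(1)]] xy(2) by blast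
next
  case True
  obtain x y where V: "vis x y" using vis_exists by blast
  then obtain w and k :: int where f0: "frame A x (y - x) w" and v0: "v = x + of_int k *\<^sub>R (y - x) - w"
    using True unfolding unimodular_def by blast
  define u where "u = y - x"
  have f: "frame A x u w" and v: "v = x + of_int k *\<^sub>R u - w" using f0 v0 unfolding u_def by auto
  have "frame (insert v A) x u w"
    unfolding frame_def
  proof (intro conjI ballI allI impI)
    show "cr u w \<noteq> 0" "{x, x + u, x + w} \<subseteq> insert v A" using frameD(1-4)[OF f] by auto
    show "\<exists>i j. p = x + of_int i *\<^sub>R u + of_int j *\<^sub>R w" if p: "p \<in> insert v A" for p
    proof (cases "p \<in> A")
      case True
      then show ?thesis by (rule frameD(5)[OF f])
    next
      case False
      then have "p = x + of_int k *\<^sub>R u + of_int (-1) *\<^sub>R w" using p v by simp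
      then show ?thesis by blast
    qed
    fix i j :: int
    let ?p = "x + of_int i *\<^sub>R u + of_int j *\<^sub>R w"
    assume p: "?p \<in> convex hull (insert v A)"
    show "?p \<in> insert v A"
    proof (cases "?p \<in> convex hull A")
      case True
      then show ?thesis using frameD(6)[OF f] by blast
    next
      case pA: False
      obtain x' y' where V': "vis x' y'" "?p \<in> convex hull {v, x', y'}" using vis_triangles_cover[OF p pA] by blast
      then obtain w' and k' :: int where f': "frame A x' (y' - x') w'" and v': "v = x' + of_int k' *\<^sub>R (y' - x') - w'"
        using True unfolding unimodular_def by blast
      obtain a b c where abc: "0 \<le> a" "0 \<le> b" "0 \<le> c" "a + b + c = 1" "?p = a *\<^sub>R v + b *\<^sub>R x' + c *\<^sub>R y'"
        using V'(2) unfolding convex_hull_3 by blast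
      obtain i' j' :: int where ij: "?p = x' + of_int i' *\<^sub>R (y' - x') + of_int j' *\<^sub>R w'"
        using frame_change[OF f f' refl] by blast
      have b: "b = 1 - a - c" using abc(4) by simp
      \<comment> \<open>The weight \<open>a\<close> of \<open>v\<close> is minus the lattice height
        over the edge, so it is an integer between 0 and 1.\<close>
      have "?p = x' + (a * of_int k' + c) *\<^sub>R (y' - x') + (- a) *\<^sub>R w'"
        unfolding abc(5) b v' by (simp add: algebra_simps)
      then have "of_int j' = - a" using ij coord_unique[OF frameD(1)[OF f']] by metis
      then have a: "a = of_int (- j')" by simp
      have "a \<le> 1" using abc by simp
      then have "j' = 0 \<or> j' = -1" using abc(1) unfolding a by linarith
      then consider "a = 0" | "a = 1" using a by auto
      then show ?thesis
      proof cases
        case 1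
        then have "?p \<in> convex hull {x', y'}" using abc unfolding convex_hull_2 by auto
        then have "?p \<in> convex hull A" using V'(1) hull_mono[of "{x', y'}" A convex] unfolding vis_def by blast
        then show ?thesis using pA by blast
      next
        case 2
        then have "b = 0" "c = 0" using abc by auto
        then show ?thesis using abc(5) 2 by simp
      qed
    qed
  qed
  then show ?thesis using frame_saturated by blast
qed

end

section \<open>Structure of the equality case\<close>

text \<open>\<open>v\<close> lies in no triangle of the remaining points, so its deletion creates no
  new empty triangle.\<close>

lemma rigid_delete:
  assumes "rigid A" "v \<notin> convex hull (A - {v})"
  shows "rigid (A - {v})"
  unfolding rigid_def
proof (intro allI impI ballI)
  fix x y z a b
  assume xyz: "{x, y, z} \<subseteq> A - {v}" "cr (y - x) (z - x) \<noteq> 0" "(A - {v}) \<inter> convex hull {x, y, z} = {x, y, z}"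
    and ab: "a \<in> A - {v}" "b \<in> A - {v}" "midpoint a b \<in> convex hull {x, y, z}"
  have "v \<notin> convex hull {x, y, z}" using hull_mono[OF xyz(1), of convex] assms(2) by blast
  then have "A \<inter> convex hull {x, y, z} = {x, y, z}" using xyz(3) by blast
  then show "midpoint a b \<in> six x y z" using rigidD[OF assms(1), of x y z a b] xyz ab by blast
qed

lemma interior_signs:
  assumes "y \<in> interior (convex hull {a, b, c})"
  shows "0 < cr (a - y) (b - y) * cr (b - y) (c - y)" "0 < cr (b - y) (c - y) * cr (c - y) (a - y)"
proof -
  have D: "cr (b - a) (c - a) \<noteq> 0" by (rule interior_not_collinear(1)[OF assms])
  let ?D = "cr (b - a) (c - a)"
  have "0 < cr (b - y) (c - y) / ?D" "0 < cr (c - y) (a - y) / ?D" "0 < cr (a - y) (b - y) / ?D"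
    using assms unfolding interior_triangle_iff[OF D] bary_def cr_cyc(1)[of c b a] cr_cyc(2)[of a c b] by auto
  then show "0 < cr (a - y) (b - y) * cr (b - y) (c - y)" "0 < cr (b - y) (c - y) * cr (c - y) (a - y)"
    by (auto simp: zero_less_divide_iff zero_less_mult_iff)
qed

lemma interior_edge_not_collinear:
  fixes y :: "real^2"
  assumes "y \<in> interior (convex hull {a, b, c})" "p \<in> {a, b, c}" "q \<in> {a, b, c}" "p \<noteq> q"
  shows "\<not> collinear {y, p, q}"
proof -
  note s = interior_signs[OF assms(1)]
  have "cr (a - y) (b - y) \<noteq> 0" "cr (b - y) (c - y) \<noteq> 0" "cr (c - y) (a - y) \<noteq> 0" using s by auto
  then show ?thesis
    using assms(2-4) unfolding cr_collinear
    using cr_anti[of "a - y" "b - y"] cr_anti[of "b - y" "c - y"] cr_anti[of "c - y" "a - y"] by auto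
qed

text \<open>Seen from \<open>y\<close>, the pair \<open>b, d\<close> is oriented like
  \<open>a, b\<close> by the second triangle, \<open>a, b\<close> like \<open>b, c\<close> by the
  first, and \<open>b, c\<close> like \<open>d, b\<close> by the third.\<close>

lemma no_common_interior_point:
  fixes y :: "real^2"
  assumes "y \<in> interior (convex hull {a, b, c})" "y \<in> interior (convex hull {a, b, d})"
  shows "y \<notin> interior (convex hull {b, c, d})"
proof
  assume "y \<in> interior (convex hull {b, c, d})"
  note s = interior_signs[OF assms(1)] interior_signs[OF assms(2)] interior_signs[OF this]
  show False
    using s cr_anti[of "b - y" "d - y"] by (auto simp: zero_less_mult_iff mult_less_0_iff)
qed

text \<open>The line through \<open>c\<close> and \<open>x\<close> separates the two triangles;
  \<open>?x2 * ?y1 - ?x1 * ?y2\<close> records the side on which \<open>y\<close> lies.\<close>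

lemma disjoint_interiors:
  assumes D: "cr (b - a) (c - a) \<noteq> 0" and x: "x \<in> convex hull {a, b, c}"
    and y: "y \<in> interior (convex hull {x, b, c})"
  shows "y \<notin> interior (convex hull {x, a, c})"
proof
  assume y': "y \<in> interior (convex hull {x, a, c})"
  note D1 = interior_not_collinear(1)[OF y] and D2 = interior_not_collinear(1)[OF y']
  define s t r where "s = bary x b c y" and "t = bary b c x y" and "r = bary c x b y"
  have str: "0 < s" "0 < t" "0 < r" "s + t + r = 1" "s *\<^sub>R x + t *\<^sub>R b + r *\<^sub>R c = y"
    using y bary_sum[OF D1, of y] bary_eq[OF D1, of y] unfolding interior_triangle_iff[OF D1] s_def t_def r_def by auto
  define s' t' r' where "s' = bary x a c y" and "t' = bary a c x y" and "r' = bary c x a y"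
  have str': "0 < s'" "0 < t'" "0 < r'" "s' + t' + r' = 1" "s' *\<^sub>R x + t' *\<^sub>R a + r' *\<^sub>R c = y"
    using y' bary_sum[OF D2, of y] bary_eq[OF D2, of y] unfolding interior_triangle_iff[OF D2] s'_def t'_def r'_def by auto
  have D': "cr (c - b) (a - b) \<noteq> 0" using D cr_cyc[of c b a] by auto
  note bv = bary_vertex[OF D] bary_vertex[OF D']
  let ?x1 = "bary a b c x" and ?x2 = "bary b c a x" and ?y1 = "bary a b c y" and ?y2 = "bary b c a y"
  have x0: "0 \<le> ?x1" "0 \<le> ?x2" using x unfolding in_triangle_iff[OF D] by auto
  have 1: "?y1 = s * ?x1" "?y2 = s * ?x2 + t"
    using bary_affine3[OF str(4), of a b c x b c] bary_affine3[OF str(4), of b c a x b c] unfolding str(5) bv by simp_all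
  have 2: "?y1 = s' * ?x1 + t'" "?y2 = s' * ?x2"
    using bary_affine3[OF str'(4), of a b c x a c] bary_affine3[OF str'(4), of b c a x a c] unfolding str'(5) bv by simp_all
  have "?x2 * ?y1 - ?x1 * ?y2 = - (t * ?x1)" unfolding 1 by (simp add: algebra_simps)
  moreover have "?x2 * ?y1 - ?x1 * ?y2 = t' * ?x2" unfolding 2 by (simp add: algebra_simps)
  moreover have "0 \<le> t * ?x1" "0 \<le> t' * ?x2" using str str' x0 by simp_all
  ultimately have "t * ?x1 = 0" by linarith
  then have "?y1 = 0" using str(2) 1 by simp
  moreover have "?y1 > 0" using 2(1) str' x0 by (simp add: add_nonneg_pos)
  ultimately show False by simp
qed

text \<open>The coarse shape of a set of type (b), without the spacing: this is what the exclusion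
  argument works with.\<close>

lemma comb_set_vertices:
  assumes "comb_set B"
  obtains N where "N \<subseteq> B" "card N = 3" "B - N \<noteq> {}" "B - N \<subseteq> interior (convex hull N)" "\<exists>n\<in>N. collinear (insert n (B - N))"
proof -
  obtain b e q r and m :: nat where m: "m \<ge> 1" and B: "B = (\<lambda>i. b + real i *\<^sub>R e) ` {..m} \<union> {q, r}"
    and int: "\<And>i. i < m \<Longrightarrow> b + real i *\<^sub>R e \<in> interior (convex hull {b + real m *\<^sub>R e, q, r})"
    using assms unfolding comb_set_def by blast
  define z where "z i = b + real i *\<^sub>R e" for i
  let ?N = "{z m, q, r}"
  have zint: "z i \<in> interior (convex hull ?N)" if "i < m" for i using int[OF that] unfolding z_def .
  have z0: "z 0 \<in> interior (convex hull ?N)" using zint m by simp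
  have D: "cr (q - z m) (r - z m) \<noteq> 0" by (rule interior_not_collinear(1)[OF z0])
  have BN: "B - ?N \<subseteq> z ` {..<m}"
  proof
    fix p assume p: "p \<in> B - ?N"
    then obtain i where i: "i \<le> m" "p = z i" unfolding B z_def by auto
    then have "i \<noteq> m" using p by auto
    then show "p \<in> z ` {..<m}" using i by simp
  qed
  show ?thesis
  proof (rule that[of ?N])
    show "?N \<subseteq> B" unfolding B z_def by auto
    show "card ?N = 3" by (rule not_collinear_affine(5)[OF D])
    have "z 0 \<in> B - ?N" using interior_not_collinear(2)[OF z0] unfolding B z_def by force
    then show "B - ?N \<noteq> {}" by blast
    show "B - ?N \<subseteq> interior (convex hull ?N)" using BN zint by blast
    have "collinear (insert (z m) (B - ?N))"
      unfolding collinear_def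
    proof (intro exI[of _ e] ballI)
      fix u w assume "u \<in> insert (z m) (B - ?N)" "w \<in> insert (z m) (B - ?N)"
      then obtain i j where "u = z i" "w = z j" using BN by blast
      then have "u - w = (real i - real j) *\<^sub>R e" unfolding z_def by (simp add: scaleR_left_diff_distrib)
      then show "\<exists>c. u - w = c *\<^sub>R e" by blast
    qed
    then show "\<exists>n\<in>?N. collinear (insert n (B - ?N))" by blast
  qed
qed

lemma three_points_saturated:
  assumes "cr (y - x) (z - x) \<noteq> 0"
  shows "saturated {x, y, z}"
proof -
  define u w where "u = y - x" and "w = z - x"
  have yz: "y = x + u" "z = x + w" unfolding u_def w_def by simp_all
  have c: "cr u w \<noteq> 0" using assms unfolding u_def w_def .
  have "frame {x, x + u, x + w} x u w"
    unfolding frame_def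
  proof (intro conjI ballI allI impI)
    show "cr u w \<noteq> 0" by (rule c)
    show "{x, x + u, x + w} \<subseteq> {x, x + u, x + w}" by simp
    fix p assume "p \<in> {x, x + u, x + w}"
    moreover have "x = x + of_int 0 *\<^sub>R u + of_int 0 *\<^sub>R w" "x + u = x + of_int 1 *\<^sub>R u + of_int 0 *\<^sub>R w"
      "x + w = x + of_int 0 *\<^sub>R u + of_int 1 *\<^sub>R w" by simp_all
    ultimately show "\<exists>i j. p = x + of_int i *\<^sub>R u + of_int j *\<^sub>R w" by blast
  next
    fix i j :: int assume "x + of_int i *\<^sub>R u + of_int j *\<^sub>R w \<in> convex hull {x, x + u, x + w}"
    then have "0 \<le> (of_int i :: real) \<and> 0 \<le> (of_int j :: real) \<and> (of_int i :: real) + of_int j \<le> 1"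
      unfolding coord_triangle[OF c] .
    then have "0 \<le> i \<and> 0 \<le> j \<and> i + j \<le> 1" by linarith
    then have "(i = 0 \<and> j = 0) \<or> (i = 1 \<and> j = 0) \<or> (i = 0 \<and> j = 1)" by arith
    then show "x + of_int i *\<^sub>R u + of_int j *\<^sub>R w \<in> {x, x + u, x + w}" by auto
  qed
  then show ?thesis unfolding yz by (rule frame_saturated)
qed

lemma card_le_2_collinear:
  fixes S :: "(real^2) set"
  assumes "finite S" "card S \<le> 2" shows "collinear S"
proof -
  have "card S = 0 \<or> card S = 1 \<or> card S = 2" using assms(2) by linarith
  then show ?thesis using assms(1) by (auto simp: card_1_singleton_iff card_2_iff)
qed

text \<open>If all deletions were combs, their triangular hulls would leave only three or four extreme points. With four,
  a non-extreme point would be interior to all four triangles they span. With three, each deletion of an extreme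
  point would promote another point \<open>X e\<close> to a vertex, and the three promoted points would be distinct and collinear, so the
  middle one would not be a vertex.\<close>

lemma not_all_deletions_comb:
  fixes A :: "(real^2) set"
  defines "E \<equiv> {e. e extreme_point_of (convex hull A)}"
  assumes fin: "finite A" and nc: "\<not> collinear A" and comb: "\<And>e. e \<in> E \<Longrightarrow> comb_set (A - {e})"
  shows False
proof -
  have EA: "E \<subseteq> A" unfolding E_def using extreme_point_of_convex_hull by blast
  have finE: "finite E" using EA fin finite_subset by blast
  have hE: "convex hull E = convex hull A"
    unfolding E_def using fin by (intro Krein_Milman_Minkowski[symmetric]) (auto simp: finite_imp_compact_convex_hull)
  have ncE: "\<not> collinear E"
  proof
    assume "collinear E"
    then have "collinear (convex hull A)" using collinear_hull[of E] hE by simp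
    then have "collinear A" by (rule collinear_subset) (rule hull_subset)
    then show False using nc by blast
  qed
  then have E3: "card E \<ge> 3" using card_le_2_collinear[OF finE] by linarith
  have ext: "e \<notin> interior (convex hull N)" if "e \<in> E" "N \<subseteq> A" for e N
  proof
    assume "e \<in> interior (convex hull N)"
    then have "e \<in> interior (convex hull A)" using interior_mono[OF hull_mono[OF that(2)]] by blast
    then show False using that(1) extreme_point_not_in_interior unfolding E_def by blast
  qed
  have N: "\<exists>N. E - {e} \<subseteq> N \<and> N \<subseteq> A - {e} \<and> card N = 3 \<and> A - {e} - N \<noteq> {} \<and> A - {e} - N \<subseteq> interior (convex hull N)
      \<and> (\<exists>n\<in>N. collinear (insert n (A - {e} - N)))" if e: "e \<in> E" for e
  proof -
    obtain N where N: "N \<subseteq> A - {e}" "card N = 3" "A - {e} - N \<noteq> {}" "A - {e} - N \<subseteq> interior (convex hull N)"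
      "\<exists>n\<in>N. collinear (insert n (A - {e} - N))"
      by (rule comb_set_vertices[OF comb[OF e]])
    have "E - {e} \<subseteq> N"
    proof
      fix f assume f: "f \<in> E - {e}"
      show "f \<in> N"
      proof (rule ccontr)
        assume "f \<notin> N"
        then have "f \<in> interior (convex hull N)" using N(4) f EA by blast
        then show False using ext[of f N] f N(1) by blast
      qed
    qed
    then show ?thesis using N by blast
  qed
  obtain e0 where e0: "e0 \<in> E" using E3 by fastforce
  obtain N0 where "E - {e0} \<subseteq> N0" "card N0 = 3" using N[OF e0] by blast
  then have "card (E - {e0}) \<le> 3" by (metis card_mono card.infinite numeral_eq_Suc old.nat.distinct(1))
  then have "card E \<le> 4" using e0 finE by simp
  then consider "card E = 4" | "card E = 3" using E3 by linarith
  then show False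
  proof cases
    case 1
    have int: "A - E \<noteq> {} \<and> A - E \<subseteq> interior (convex hull (E - {e}))" if e: "e \<in> E" for e
    proof -
      obtain N where N: "E - {e} \<subseteq> N" "card N = 3" "A - {e} - N \<noteq> {}" "A - {e} - N \<subseteq> interior (convex hull N)" using N[OF e] by blast
      have "finite N" using N(2) by (metis card.infinite numeral_eq_Suc old.nat.distinct(1))
      then have "E - {e} = N" using N(1,2) 1 e finE by (intro card_seteq) auto
      moreover have "A - {e} - (E - {e}) = A - E" using e by blast
      ultimately show ?thesis using N by simp
    qed
    have "card (E - {e0}) = 3" using 1 e0 finE by simp
    then obtain a b c where abc: "E - {e0} = {a, b, c}" "a \<noteq> b" "b \<noteq> c" "a \<noteq> c" unfolding card_3_iff by blast
    have "a \<in> E - {e0}" "b \<in> E - {e0}" "c \<in> E - {e0}" unfolding abc(1) by auto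
    then have m: "a \<in> E" "b \<in> E" "c \<in> E" "a \<noteq> e0" "b \<noteq> e0" "c \<noteq> e0" by auto
    have E: "E = {a, b, c, e0}" using abc(1) e0 by blast
    have s: "E - {c} = {a, b, e0}" "E - {a} = {b, c, e0}" unfolding E using abc m by auto
    obtain y where "y \<in> A - E" using int[OF e0] by blast
    then have "y \<in> interior (convex hull {a, b, c})" "y \<in> interior (convex hull {a, b, e0})" "y \<in> interior (convex hull {b, c, e0})"
      using int[OF e0] int[OF m(3)] int[OF m(1)] unfolding abc(1) s by blast+
    then show False using no_common_interior_point by blast
  next
    case 2
    have "\<forall>e\<in>E. \<exists>x. x \<in> A - E \<and> A - E - {x} \<noteq> {} \<and> A - E - {x} \<subseteq> interior (convex hull (insert x (E - {e}))) \<and>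
       (\<exists>n\<in>insert x (E - {e}). collinear (insert n (A - E - {x})))"
    proof
      fix e assume e: "e \<in> E"
      obtain N where N: "E - {e} \<subseteq> N" "N \<subseteq> A - {e}" "card N = 3" "A - {e} - N \<noteq> {}" "A - {e} - N \<subseteq> interior (convex hull N)"
        "\<exists>n\<in>N. collinear (insert n (A - {e} - N))" using N[OF e] by blast
      have "card (N - (E - {e})) = 1" using N(1,3) 2 e finE by (subst card_Diff_subset) auto
      then obtain x where x: "N - (E - {e}) = {x}" by (auto simp: card_1_singleton_iff)
      have Nx: "N = insert x (E - {e})" using x N(1) by blast
      have xA: "x \<in> A - E" using x N(2) by blast
      have eq: "A - {e} - N = A - E - {x}" unfolding Nx using e by blast
      show "\<exists>x. x \<in> A - E \<and> A - E - {x} \<noteq> {} \<and> A - E - {x} \<subseteq> interior (convex hull (insert x (E - {e}))) \<and>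
       (\<exists>n\<in>insert x (E - {e}). collinear (insert n (A - E - {x})))"
        by (intro exI[of _ x] conjI xA N(4-6)[unfolded eq, unfolded Nx])
    qed
    then obtain X where "\<forall>e\<in>E. X e \<in> A - E \<and> A - E - {X e} \<noteq> {} \<and> A - E - {X e} \<subseteq> interior (convex hull (insert (X e) (E - {e}))) \<and>
       (\<exists>n\<in>insert (X e) (E - {e}). collinear (insert n (A - E - {X e})))"
      by (rule bchoice[THEN exE])
    then have X: "X e \<in> A - E" "A - E - {X e} \<noteq> {}" "A - E - {X e} \<subseteq> interior (convex hull (insert (X e) (E - {e})))"
       "\<exists>n\<in>insert (X e) (E - {e}). collinear (insert n (A - E - {X e}))" if "e \<in> E" for e
      using that by blast+
    obtain a b c where E: "E = {a, b, c}" and ne: "a \<noteq> b" "b \<noteq> c" "a \<noteq> c" using 2 unfolding card_3_iff by blast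
    have in_hull: "p \<in> convex hull {a, b, c}" if "p \<in> A" for p
      using that hull_subset[of A convex] hE unfolding E by blast
    have D: "cr (b - a) (c - a) \<noteq> 0" using ncE unfolding E cr_collinear .
    have s: "E - {a} = {b, c}" "E - {b} = {a, c}" "E - {c} = {a, b}" unfolding E using ne by auto
    have m: "a \<in> E" "b \<in> E" "c \<in> E" unfolding E by auto
    have Da: "cr (c - b) (a - b) \<noteq> 0" "cr (a - c) (b - c) \<noteq> 0" using D cr_cyc[of c b a] cr_cyc(2)[of a c b] by auto
    note Xa = X[OF m(1), unfolded s] and Xb = X[OF m(2), unfolded s] and Xc = X[OF m(3), unfolded s]
    have perm: "{a, b, c} = {b, c, a}" "{a, b, c} = {c, a, b}" "{x, a, c} = {x, c, a}" "{x, b, c} = {x, c, b}" "{x, a, b} = {x, b, a}" for x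
      by auto
    have ab: "X a \<noteq> X b"
    proof
      assume e: "X a = X b"
      obtain y where y: "y \<in> A - E - {X a}" using Xa(2) by blast
      have "y \<in> interior (convex hull {X a, b, c})" "y \<in> interior (convex hull {X a, a, c})" using y Xa(3) Xb(3) e by auto
      then show False using disjoint_interiors[OF D in_hull] Xa(1) by blast
    qed
    have bc: "X b \<noteq> X c"
    proof
      assume e: "X b = X c"
      obtain y where y: "y \<in> A - E - {X b}" using Xb(2) by blast
      have "y \<in> interior (convex hull {X b, a, c})" "y \<in> interior (convex hull {X b, a, b})"
        using y Xb(3) Xc(3) e by auto
      then have "y \<in> interior (convex hull {X b, c, a})" "y \<in> interior (convex hull {X b, b, a})"
        by (simp_all only: perm(3)[of "X b"] perm(5)[of "X b"])
      then show False using disjoint_interiors[OF Da(1) in_hull[unfolded perm(1)]] Xb(1) by blast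
    qed
    have ca: "X c \<noteq> X a"
    proof
      assume e: "X c = X a"
      obtain y where y: "y \<in> A - E - {X c}" using Xc(2) by blast
      have "y \<in> interior (convex hull {X c, a, b})" "y \<in> interior (convex hull {X c, b, c})"
        using y Xc(3) Xa(3) e by auto
      then have "y \<in> interior (convex hull {X c, a, b})" "y \<in> interior (convex hull {X c, c, b})"
        by (simp_all only: perm(4)[of "X c"])
      then show False using disjoint_interiors[OF Da(2) in_hull[unfolded perm(2)]] Xc(1) by blast
    qed
    have mem: "X a \<in> A - E - {X b}" "X a \<in> A - E - {X c}" "X b \<in> A - E - {X a}" "X b \<in> A - E - {X c}"
      "X c \<in> A - E - {X a}" "X c \<in> A - E - {X b}"
      using Xa(1) Xb(1) Xc(1) ab ab[symmetric] bc bc[symmetric] ca ca[symmetric] by simp_all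
    note ia = subsetD[OF Xa(3) mem(3)] subsetD[OF Xa(3) mem(5)]
    note ib = subsetD[OF Xb(3) mem(1)] subsetD[OF Xb(3) mem(6)]
    note ic = subsetD[OF Xc(3) mem(2)] subsetD[OF Xc(3) mem(4)]
    have XE: "X a \<notin> E" "X b \<notin> E" "X c \<notin> E" using Xa(1) Xb(1) Xc(1) by blast+
    \<comment> \<open>Deleting \<open>b\<close> makes \<open>X a\<close> and \<open>X c\<close>
      collinear with a vertex \<open>n\<close>. If \<open>n\<close> were \<open>a\<close> or
      \<open>c\<close>, it would lie with two promoted points on a line, one of them an interior
      point of a triangle that has the other and \<open>n\<close> as vertices.\<close>
    obtain n where n: "n \<in> {X b, a, c}" "collinear (insert n (A - E - {X b}))" using Xb(4) by blast
    have coln: "collinear {n, X a, X c}"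
      by (rule collinear_subset[OF n(2)]) (use mem in blast)
    have "n = X b"
    proof (rule ccontr)
      assume "n \<noteq> X b"
      then have "n = a \<or> n = c" using n(1) by blast
      then show False
      proof
        assume "n = a"
        then have "collinear {X a, X c, a}" using coln by (simp add: insert_commute)
        then show False using interior_edge_not_collinear[OF ic(1), of "X c" a] XE(3) m by blast
      next
        assume "n = c"
        then have "collinear {X c, X a, c}" using coln by (simp add: insert_commute)
        then show False using interior_edge_not_collinear[OF ia(2), of "X a" c] XE(1) m by blast
      qed
    qed
    then have "collinear {X b, X a, X c}" using coln by simp
    then have "between (X a, X c) (X b) \<or> between (X c, X b) (X a) \<or> between (X b, X a) (X c)"
      using collinear_between_cases by blast
    moreover have seg: "w \<in> interior (convex hull S)" if "between (u, u') w" "u \<in> interior (convex hull S)" "u' \<in> interior (convex hull S)"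
      for u u' w and S :: "(real^2) set"
      using that convex_interior[OF convex_convex_hull] unfolding between_mem_segment by (meson convex_contains_segment subsetD)
    ultimately show False
      using seg[OF _ ib] seg[OF _ ic(2) ic(1)] seg[OF _ ia(2,1)] seg[OF _ ic(2,1)]
        interior_not_collinear(2)[of _ "X a"] interior_not_collinear(2)[of _ "X b"] interior_not_collinear(2)[of _ "X c"] by blast
  qed
qed

text \<open>In a minimal counterexample no deletion of an extreme point is saturated, by
  \<open>insert_saturated_or_comb\<close>, so every noncollinear one is a comb. Once collinear
  deletions are excluded, \<open>not_all_deletions_comb\<close> gives the contradiction.\<close>

theorem rigid_saturated_or_comb:
  fixes A :: "(real^2) set"
  assumes "finite A" "\<not> collinear A" "rigid A"
  shows "saturated A \<or> comb_set A"
  using assms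
proof (induction "card A" arbitrary: A rule: less_induct)
  case less
  note fin = less.prems(1) and nc = less.prems(2) and rig = less.prems(3)
  let ?E = "{e. e extreme_point_of (convex hull A)}"
  have EA: "?E \<subseteq> A" using extreme_point_of_convex_hull by blast
  show ?case
  proof (rule ccontr)
    assume neg: "\<not> (saturated A \<or> comb_set A)"
    have out: "e \<notin> convex hull (A - {e})" if "e \<in> ?E" for e
    proof -
      have "convex (convex hull A - {e})"
        using that extreme_point_of_stillconvex[of "convex hull A" e] by simp
      moreover have "A - {e} \<subseteq> convex hull A - {e}" using hull_subset[of A convex] by blast
      ultimately have "convex hull (A - {e}) \<subseteq> convex hull A - {e}" by (intro hull_minimal)
      then show ?thesis by blast
    qed
    have comb: "comb_set (A - {e})" if e: "e \<in> ?E" "\<not> collinear (A - {e})" for e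
    proof -
      have r: "rigid (A - {e})" by (rule rigid_delete[OF rig out[OF e(1)]])
      have ins: "insert e (A - {e}) = A" using e(1) EA by blast
      have "card (A - {e}) < card A" using e(1) EA fin by (intro psubset_card_mono) auto
      then have "saturated (A - {e}) \<or> comb_set (A - {e})" using less.hyps[OF _ _ e(2) r] fin by simp
      moreover have "\<not> saturated (A - {e})"
      proof
        assume "saturated (A - {e})"
        then interpret cone_point "A - {e}" e
          by unfold_locales (use fin e out ins rig in auto)
        show False using insert_saturated_or_comb neg unfolding ins by blast
      qed
      ultimately show ?thesis by blast
    qed
    have "comb_set (A - {e})" if e: "e \<in> ?E" for e
    proof (cases "collinear (A - {e})")
      case False
      then show ?thesis using comb e by blast
    next
      case True
      \<comment> \<open>This case is contradictory. Deleting another extreme point \<open>w\<close>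
        leaves a comb; its triangle must use \<open>e\<close>, and then the other two vertices and
        an interior point all lie on the line that carries \<open>A - {e}\<close>.\<close>
      have eA: "e \<in> A" using e EA by blast
      have "card A > 2" using card_le_2_collinear[OF fin] nc by linarith
      moreover have "card A \<noteq> 3"
      proof
        assume "card A = 3"
        then obtain x y z where A: "A = {x, y, z}" unfolding card_3_iff by blast
        have "saturated A" using three_points_saturated[of y x z] nc unfolding A cr_collinear .
        then show False using neg by blast
      qed
      ultimately have card: "card A \<ge> 4" by linarith
      have "\<exists>w\<in>?E. w \<noteq> e"
      proof (rule ccontr)
        assume "\<not> ?thesis"
        then have "?E \<subseteq> {e}" by blast
        then have "convex hull ?E \<subseteq> {e}" by (intro hull_minimal) auto
        moreover have "convex hull A = convex hull ?E"
          using fin by (intro Krein_Milman_Minkowski) (auto simp: finite_imp_compact_convex_hull)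
        ultimately have "A \<subseteq> {e}" using hull_subset[of A convex] by blast
        then show False using nc collinear_subset[OF collinear_sing] by blast
      qed
      then obtain w where w: "w \<in> ?E" "w \<noteq> e" by blast
      have lineA: "cr (q - p) (r - p) = 0" if "p \<in> A - {e}" "q \<in> A - {e}" "r \<in> A - {e}" for p q r
        using True that unfolding collinear_cr_iff by blast
      \<comment> \<open>Two points other than \<open>e\<close> and \<open>w\<close> would lie on
        both lines, so the lines would coincide and contain all of \<open>A\<close>.\<close>
      have ncw: "\<not> collinear (A - {w})"
      proof
        assume cw: "collinear (A - {w})"
        have "card (A - {w} - {e}) \<ge> 2" using card eA w EA fin by (auto simp: card_Diff_singleton_if)
        then obtain p q where pq: "p \<in> A - {w} - {e}" "q \<in> A - {w} - {e}" "p \<noteq> q"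
          by (metis card_le_Suc0_iff_eq fin finite_Diff not_less_eq_eq numeral_2_eq_2)
        have "cr (q - p) (r - p) = 0" if "r \<in> A" for r
        proof (cases "r = e")
          case True
          then show ?thesis using cw pq eA w(2) unfolding collinear_cr_iff by blast
        next
          case False
          then show ?thesis using lineA pq that by blast
        qed
        then show False using point_off_line[OF nc pq(3)] by blast
      qed
      obtain N where N: "N \<subseteq> A - {w}" "card N = 3" "A - {w} - N \<noteq> {}" "A - {w} - N \<subseteq> interior (convex hull N)"
        "\<exists>n\<in>N. collinear (insert n (A - {w} - N))"
        by (rule comb_set_vertices[OF comb[OF w(1) ncw]])
      obtain z where z: "z \<in> A - {w} - N" using N(3) by blast
      obtain p q r where pqr: "N = {p, q, r}" "p \<noteq> q" "q \<noteq> r" "p \<noteq> r" using N(2) unfolding card_3_iff by blast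
      have zi: "z \<in> interior (convex hull {p, q, r})" using N(4) z pqr(1) by blast
      have D: "cr (q - p) (r - p) \<noteq> 0" by (rule interior_not_collinear(1)[OF zi])
      have two: False if "s \<in> {p, q, r}" "t \<in> {p, q, r}" "s \<noteq> t" "s \<noteq> e" "t \<noteq> e" "z \<noteq> e" for s t
        using interior_edge_not_collinear[OF zi that(1-3)] lineA[of z s t] that z N(1) pqr(1) unfolding cr_collinear by blast
      have sub: "{p, q, r} \<subseteq> A" using N(1) pqr(1) by blast
      have "e \<in> {p, q, r}"
      proof (rule ccontr)
        assume "e \<notin> {p, q, r}"
        then have "cr (q - p) (r - p) = 0" using sub by (intro lineA) auto
        then show False using D by blast
      qed
      moreover from this have "z \<noteq> e" using z pqr(1) by blast
      ultimately show ?thesis using two[of p q] two[of q r] two[of p r] pqr(2-4) by blast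
    qed
    then show False using not_all_deletions_comb[OF fin nc] by blast
  qed
qed

theorem theorem1p2:
  fixes A B :: "(real^2) set"
  assumes "finite A" and "finite B"
    and "\<not> collinear A" and "\<not> collinear B"
    and "convex hull A = convex hull B"
  shows "sqrt (real (tr (A + B))) \<ge> sqrt (real (tr A)) + sqrt (real (tr B)) \<and>
    (sqrt (real (tr (A + B))) = sqrt (real (tr A)) + sqrt (real (tr B)) \<longleftrightarrow>
      A = B \<and>
      (saturated A \<or>
       (\<exists>k z. 4 \<le> k \<and> inj_on z {1..k} \<and> A = z ` {1..k::nat} \<and>
          (\<forall>i\<in>{1..k-3}. z i \<in> interior (convex hull {z (k-2), z (k-1), z k})) \<and>
          collinear (z ` {1..k-2}) \<and>
          (\<exists>d. \<forall>i\<in>{1..k-3}. z (Suc i) - z i = d))))"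
proof -
  let ?a = "sqrt (real (tr A))" and ?b = "sqrt (real (tr B))" and ?c = "sqrt (real (tr (A + B)))"
  note ge = tr_sum_ge[OF assms]
  have sq: "(?a + ?b)\<^sup>2 \<le> 2 * real (tr A) + 2 * real (tr B)"
  proof -
    have "0 \<le> (?a - ?b)\<^sup>2" by simp
    then show ?thesis by (simp add: power2_sum power2_diff)
  qed
  have le: "?a + ?b \<le> ?c"
    by (rule real_le_rsqrt) (use sq ge(1) in linarith)
  have "?c = ?a + ?b \<longleftrightarrow> A = B \<and> (saturated A \<or> comb_set A)"
  proof (cases "A = B")
    case False
    then have "real (2 * tr A + 2 * tr B) < real (tr (A + B))" using ge(2)[OF False] by (simp only: of_nat_less_iff)
    then have "?a + ?b < ?c" by (intro real_less_rsqrt) (use sq in simp)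
    then show ?thesis using False by simp
  next
    case True
    have "?c = ?a + ?b \<longleftrightarrow> sqrt (real (tr (A + A))) = sqrt (4 * real (tr A))"
      unfolding True[symmetric] by (simp add: real_sqrt_mult)
    also have "\<dots> \<longleftrightarrow> tr (A + A) = 4 * tr A" by (simp add: real_sqrt_eq_iff) linarith
    also have "\<dots> \<longleftrightarrow> saturated A \<or> comb_set A"
      using doubling_iff_rigid[OF assms(1,3)] rigid_saturated_or_comb[OF assms(1,3)] saturated_rigid comb_set_tr(3) by blast
    finally show ?thesis using True by simp
  qed
  then show ?thesis using le unfolding comb_set_iff by blast
qed

end
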